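(* Let $\mathcal A$ be a finite alphabet, $\ell,N\in\mathbb N$, and let $w^1,\dots,w^\ell$ be pairwise distinct words over $\mathcal A$, each of length $N$, with $|w^{j_1}|_a=|w^{j_2}|_a$ for all $j_1,j_2\in\{1,\dots,\ell\}$ and all $a\in\mathcal A$. For a probability vector $\boldsymbol p=(p_1,\dots,p_\ell)^\intercal$ with positive entries, let $\vartheta$ be the random substitution which maps every letter $a\in\mathcal A$ to $w^j$ with probability $p_j$, $j\in\{1,\dots,\ell\}$ (the same distribution for all letters), and assume that $\vartheta$ is primitive and expanding and that $w^1,\dots,w^\ell$ are $\vartheta$-legal. Then the subshift $\mathbb X_\vartheta$ (which does not depend on the choice of $\boldsymbol p$) is intrinsically ergodic. Moreover, the frequency measure $\mu_\vartheta$ corresponding to the vector $\boldsymbol p=(\frac1\ell,\dots,\frac1\ell)^\intercal$ is the measure of maximal entropy of $\mathbb X_\vartheta$.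
   Context: A subshift is intrinsically ergodic if it has exactly one shift-invariant Borel probability measure whose metric (Kolmogorov–Sinai) entropy equals the topological entropy (the measure of maximal entropy). Words. $\mathcal A^+=\bigcup_{n\ge 1}\mathcal A^n$ is the set of non-empty finite words, $|u|$ is the length of $u$, $u_{[k,m]}=u_k\cdots u_m$, and $|u|_v$ is the number of (possibly overlapping) occurrences of $v$ as a subword of $u$; $v\triangleleft u$ means $|u|_v\ge 1$. Random substitution. A random substitution $\vartheta$ on $\mathcal A$ is determined by a map $a\mapsto P^\vartheta_a$ assigning to each $a\in\mathcal A$ a finitely supported probability measure on $\mathcal A^+$ ("$a$ is mapped to $w$ with probability $P^\vartheta_a(w)$"). The transition kernel is $P(u_1\cdots u_m,v)=\sum_{v^1\cdots v^m=v}P^\vartheta_{u_1}(v^1)\cdots P^\vartheta_{u_m}(v^m)$ (sum over $v^1,\dots,v^m\in\mathcal A^+$ with concatenation $v$). For $u=u_1\cdots u_m\in\mathcal A^+$, $(\vartheta^n(u))_{n\ge 0}$ is the Markov chain on $\mathcal A^+$ with $\vartheta^0(u)=u$ and transition kernel $P$; it is realised on one probability space so that $\vartheta^n(u)=\vartheta^n(u_1)\cdots\vartheta^n(u_m)$ pointwise for all $n$, where $(\vartheta^n(u_1))_n,\dots,(\vartheta^n(u_m))_n$ are independent Markov chains with kernel $P$ started at the letters $u_1,\dots,u_m$. The mean substitution matrix is $(M_\vartheta)_{ab}=\mathbb E|\vartheta(b)|_a$, $a,b\in\mathcal A$. $\vartheta$ is primitive if $M_\vartheta$ is a primitive matrix;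 a primitive $\vartheta$ is expanding if $\mathbb P[|\vartheta(a)|>1]>0$ for some $a\in\mathcal A$. Language and subshift. $\mathcal L_\vartheta=\{u\in\mathcal A^+: u\triangleleft v \text{ for some } v \text{ with } \mathbb P[\vartheta^n(a)=v]>0 \text{ for some } n\in\mathbb N, a\in\mathcal A\}$ is the set of $\vartheta$-legal words, $\mathcal L_\vartheta^n$ is the set of elements of $\mathcal L_\vartheta$ of length $n$, and $\mathbb X_\vartheta=\{x\in\mathcal A^{\mathbb Z}: x_{[k,m]}\in\mathcal L_\vartheta\text{ for all }k\le m\}$. Induced matrix. For $n\in\mathbb N$ let $\mathcal A_n=\mathcal L_\vartheta^n$. For $u=u_1\cdots u_n\in\mathcal A_n$ define the random word over the alphabet $\mathcal A_n$, $\vartheta_n(u)=(\vartheta(u)_{[k,k+n-1]})_{1\le k\le|\vartheta(u_1)|}$, and let $(M_{\vartheta_n})_{uv}=\mathbb E|\vartheta_n(v)|_u$ for $u,v\in\mathcal A_n$. It is known that for expanding primitive $\vartheta$ the matrix $M_{\vartheta_n}$ is primitive with the same Perron–Frobenius eigenvalue as $M_\vartheta$. $R^{(n)}$ denotes its right Perron–Frobenius eigenvector with $\|R^{(n)}\|_1=1$. Frequency measure. $\mathcal Z_{[k,m]}(v)=\{x\in\mathbb X_\vartheta:x_{[k,m]}=v\}$ for $k\le m$, $v\in\mathcal L_\vartheta^{m-k+1}$. $\mu_\vartheta$ is the unique (shift-invariant) Borel probability measure on $\mathbb X_\vartheta$ with $\mu_\vartheta(\mathcal Z_{[k,m]}(v))=R^{(m-k+1)}_v$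 for all $k\le 0\le m$ and $v\in\mathcal L_\vartheta^{m-k+1}$. *)

theory Defs
  imports "HOL-Probability.Probability" "HOL-Library.Sublist"
begin

section \<open>Random substitutions\<close>

text \<open>A random substitution is a map \<open>\<theta> :: 'a \<Rightarrow> 'a list pmf\<close> on a finite alphabet \<open>'a\<close>,
  where every \<open>\<theta> a\<close> is finitely supported on non-empty words.\<close>

definition random_substitution :: "('a \<Rightarrow> 'a list pmf) \<Rightarrow> bool" where
  "random_substitution \<theta> \<longleftrightarrow> (\<forall>a. finite (set_pmf (\<theta> a)) \<and> [] \<notin> set_pmf (\<theta> a))"

text \<open>The transition kernel \<open>P(u, \<cdot>)\<close>: concatenation of independent images of the letters of \<open>u\<close>.\<close>

fun subst_kernel :: "('a \<Rightarrow> 'a list pmf) \<Rightarrow> 'a list \<Rightarrow> 'a list pmf" where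
  "subst_kernel \<theta> [] = return_pmf []"
| "subst_kernel \<theta> (a # u) =
     bind_pmf (\<theta> a) (\<lambda>x. bind_pmf (subst_kernel \<theta> u) (\<lambda>y. return_pmf (x @ y)))"

text \<open>\<open>subst_iter \<theta> n u\<close> is the law of the Markov chain at time \<open>n\<close> when started in \<open>u\<close>.\<close>

fun subst_iter :: "('a \<Rightarrow> 'a list pmf) \<Rightarrow> nat \<Rightarrow> 'a list \<Rightarrow> 'a list pmf" where
  "subst_iter \<theta> 0 u = return_pmf u"
| "subst_iter \<theta> (Suc n) u = bind_pmf (subst_iter \<theta> n u) (subst_kernel \<theta>)"

definition mean_matrix :: "('a \<Rightarrow> 'a list pmf) \<Rightarrow> 'a \<Rightarrow> 'a \<Rightarrow> real" where
  "mean_matrix \<theta> a b = measure_pmf.expectation (\<theta> b) (\<lambda>v. real (count_list v a))"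

text \<open>Square matrices indexed by a finite set \<open>S\<close> are functions of two arguments, of which only the
  values on \<open>S \<times> S\<close> matter; this allows index sets such as the legal words of length \<open>n\<close>.\<close>

fun mat_power :: "'i set \<Rightarrow> ('i \<Rightarrow> 'i \<Rightarrow> real) \<Rightarrow> nat \<Rightarrow> 'i \<Rightarrow> 'i \<Rightarrow> real" where
  "mat_power S M 0 i j = (if i = j then 1 else 0)"
| "mat_power S M (Suc k) i j = (\<Sum>l\<in>S. mat_power S M k i l * M l j)"

definition primitive_matrix :: "'i set \<Rightarrow> ('i \<Rightarrow> 'i \<Rightarrow> real) \<Rightarrow> bool" where
  "primitive_matrix S M \<longleftrightarrow>
     (\<forall>i\<in>S. \<forall>j\<in>S. 0 \<le> M i j) \<and> (\<exists>k\<ge>1. \<forall>i\<in>S. \<forall>j\<in>S. 0 < mat_power S M k i j)"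

definition primitive_subst :: "('a::finite \<Rightarrow> 'a list pmf) \<Rightarrow> bool" where
  "primitive_subst \<theta> \<longleftrightarrow> primitive_matrix UNIV (mean_matrix \<theta>)"

definition expanding_subst :: "('a \<Rightarrow> 'a list pmf) \<Rightarrow> bool" where
  "expanding_subst \<theta> \<longleftrightarrow> (\<exists>a. measure_pmf.prob (\<theta> a) {v. length v > 1} > 0)"

section \<open>Language and subshift\<close>

definition legal_words :: "('a \<Rightarrow> 'a list pmf) \<Rightarrow> 'a list set" where
  "legal_words \<theta> =
     {u. u \<noteq> [] \<and> (\<exists>v n a. n \<ge> 1 \<and> pmf (subst_iter \<theta> n [a]) v > 0 \<and> sublist u v)}"

definition legal_words_of_length :: "('a \<Rightarrow> 'a list pmf) \<Rightarrow> nat \<Rightarrow> 'a list set" where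
  "legal_words_of_length \<theta> n = {u \<in> legal_words \<theta>. length u = n}"

definition window :: "(int \<Rightarrow> 'a) \<Rightarrow> int \<Rightarrow> int \<Rightarrow> 'a list" where
  "window x k m = map x [k..m]"

definition subst_subshift :: "('a \<Rightarrow> 'a list pmf) \<Rightarrow> (int \<Rightarrow> 'a) set" where
  "subst_subshift \<theta> = {x. \<forall>k m. k \<le> m \<longrightarrow> window x k m \<in> legal_words \<theta>}"

section \<open>Shift spaces and entropy\<close>

definition shift_map :: "(int \<Rightarrow> 'a) \<Rightarrow> (int \<Rightarrow> 'a)" where
  "shift_map x = (\<lambda>i. x (i + 1))"

definition fullshift_topology :: "(int \<Rightarrow> 'a) topology" where
  "fullshift_topology = product_topology (\<lambda>_::int. discrete_topology (UNIV :: 'a set)) UNIV"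

definition is_subshift :: "(int \<Rightarrow> 'a) set \<Rightarrow> bool" where
  "is_subshift X \<longleftrightarrow> X \<noteq> {} \<and> closedin fullshift_topology X \<and> shift_map ` X = X"

definition shift_borel :: "(int \<Rightarrow> 'a) set \<Rightarrow> (int \<Rightarrow> 'a) measure" where
  "shift_borel X = sigma X {U. openin (subtopology fullshift_topology X) U}"

definition invariant_prob :: "(int \<Rightarrow> 'a) set \<Rightarrow> (int \<Rightarrow> 'a) measure \<Rightarrow> bool" where
  "invariant_prob X \<mu> \<longleftrightarrow>
     sets \<mu> = sets (shift_borel X) \<and> prob_space \<mu> \<and>
     (\<forall>A\<in>sets \<mu>. emeasure \<mu> (shift_map -` A \<inter> X) = emeasure \<mu> A)"

text \<open>The family \<open>\<alpha> \<or> T\<^sup>-\<^sup>1\<alpha> \<or> \<dots> \<or> T\<^sup>-\<^sup>(\<^sup>n\<^sup>-\<^sup>1\<^sup>)\<alpha>\<close> of subsets of \<open>X\<close>.\<close>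

definition dyn_join :: "'x set \<Rightarrow> ('x \<Rightarrow> 'x) \<Rightarrow> nat \<Rightarrow> 'x set set \<Rightarrow> 'x set set" where
  "dyn_join X T n \<alpha> = {X \<inter> (\<Inter>i<n. (T ^^ i) -` f i) | f. \<forall>i<n. f i \<in> \<alpha>}"

text \<open>Topological entropy in the sense of Adler, Konheim and McAndrew. By subadditivity the limit
  over \<open>n\<close> exists, so it may be written as an upper limit; the same applies to the metric entropy.\<close>

definition subcover_number :: "'x set \<Rightarrow> 'x set set \<Rightarrow> nat" where
  "subcover_number X \<U> = (LEAST k. \<exists>\<V>\<subseteq>\<U>. finite \<V> \<and> card \<V> = k \<and> X \<subseteq> \<Union>\<V>)"

definition open_covers :: "'x topology \<Rightarrow> 'x set set set" where
  "open_covers \<tau> = {\<U>. (\<forall>U\<in>\<U>. openin \<tau> U) \<and> \<Union>\<U> = topspace \<tau>}"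

definition topological_entropy :: "'x topology \<Rightarrow> ('x \<Rightarrow> 'x) \<Rightarrow> ereal" where
  "topological_entropy \<tau> T =
     (SUP \<U>\<in>open_covers \<tau>.
        limsup (\<lambda>n. ereal (ln (real (subcover_number (topspace \<tau>) (dyn_join (topspace \<tau>) T n \<U>))) / real n)))"

text \<open>The convention \<open>0 \<sqdot> ln 0 = 0\<close> holds automatically, and members of the join
  that are null sets (possibly empty) do not contribute.\<close>

definition partition_entropy :: "'x measure \<Rightarrow> 'x set set \<Rightarrow> real" where
  "partition_entropy M \<xi> = - (\<Sum>A\<in>\<xi>. measure M A * ln (measure M A))"

definition finite_measurable_partitions :: "'x measure \<Rightarrow> 'x set set set" where
  "finite_measurable_partitions M = {\<xi>. finite \<xi> \<and> \<xi> \<subseteq> sets M \<and> partition_on (space M) \<xi>}"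

definition metric_entropy :: "'x measure \<Rightarrow> ('x \<Rightarrow> 'x) \<Rightarrow> ereal" where
  "metric_entropy M T =
     (SUP \<xi>\<in>finite_measurable_partitions M.
        limsup (\<lambda>n. ereal (partition_entropy M (dyn_join (space M) T n \<xi>) / real n)))"

definition measure_of_maximal_entropy :: "(int \<Rightarrow> 'a) set \<Rightarrow> (int \<Rightarrow> 'a) measure \<Rightarrow> bool" where
  "measure_of_maximal_entropy X \<mu> \<longleftrightarrow>
     invariant_prob X \<mu> \<and>
     metric_entropy \<mu> shift_map = topological_entropy (subtopology fullshift_topology X) shift_map"

definition intrinsically_ergodic :: "(int \<Rightarrow> 'a) set \<Rightarrow> bool" where
  "intrinsically_ergodic X \<longleftrightarrow> is_subshift X \<and> (\<exists>!\<mu>. measure_of_maximal_entropy X \<mu>)"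

section \<open>Frequency measure\<close>

text \<open>The law of \<open>\<theta>\<^sub>n(u)\<close> with \<open>n = length u \<ge> 1\<close>. The image of the first letter is drawn separately
  since its length determines the number of windows.\<close>

definition induced_subst :: "('a \<Rightarrow> 'a list pmf) \<Rightarrow> nat \<Rightarrow> 'a list \<Rightarrow> 'a list list pmf" where
  "induced_subst \<theta> n u =
     bind_pmf (\<theta> (hd u)) (\<lambda>x. bind_pmf (subst_kernel \<theta> (tl u)) (\<lambda>y.
       return_pmf (map (\<lambda>k. take n (drop k (x @ y))) [0..<length x])))"

definition induced_matrix :: "('a \<Rightarrow> 'a list pmf) \<Rightarrow> nat \<Rightarrow> 'a list \<Rightarrow> 'a list \<Rightarrow> real" where
  "induced_matrix \<theta> n u v =
     measure_pmf.expectation (induced_subst \<theta> n v) (\<lambda>W. real (count_list W u))"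

definition is_eigenvalue_on :: "'i set \<Rightarrow> ('i \<Rightarrow> 'i \<Rightarrow> real) \<Rightarrow> complex \<Rightarrow> bool" where
  "is_eigenvalue_on S M z \<longleftrightarrow>
     (\<exists>x. (\<exists>i\<in>S. x i \<noteq> 0) \<and> (\<forall>i\<in>S. (\<Sum>j\<in>S. complex_of_real (M i j) * x j) = z * x i))"

definition is_PF_eigenvalue :: "'i set \<Rightarrow> ('i \<Rightarrow> 'i \<Rightarrow> real) \<Rightarrow> real \<Rightarrow> bool" where
  "is_PF_eigenvalue S M r \<longleftrightarrow>
     is_eigenvalue_on S M (complex_of_real r) \<and> (\<forall>z. is_eigenvalue_on S M z \<longrightarrow> cmod z \<le> r)"

text \<open>The positive, \<open>\<ell>\<^sup>1\<close>-normalised right eigenvector, extended by \<open>0\<close> outside the index set.\<close>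

definition PF_eigenvector :: "'i set \<Rightarrow> ('i \<Rightarrow> 'i \<Rightarrow> real) \<Rightarrow> 'i \<Rightarrow> real" where
  "PF_eigenvector S M =
     (THE R. (\<forall>i. i \<notin> S \<longrightarrow> R i = 0) \<and> (\<forall>i\<in>S. 0 < R i) \<and> (\<Sum>i\<in>S. R i) = 1 \<and>
        (\<exists>r. is_PF_eigenvalue S M r \<and> (\<forall>i\<in>S. (\<Sum>j\<in>S. M i j * R j) = r * R i)))"

definition freq_vector :: "('a \<Rightarrow> 'a list pmf) \<Rightarrow> nat \<Rightarrow> 'a list \<Rightarrow> real" where
  "freq_vector \<theta> n = PF_eigenvector (legal_words_of_length \<theta> n) (induced_matrix \<theta> n)"

definition cylinder :: "('a \<Rightarrow> 'a list pmf) \<Rightarrow> int \<Rightarrow> int \<Rightarrow> 'a list \<Rightarrow> (int \<Rightarrow> 'a) set" where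
  "cylinder \<theta> k m v = {x \<in> subst_subshift \<theta>. window x k m = v}"

definition is_frequency_measure :: "('a \<Rightarrow> 'a list pmf) \<Rightarrow> (int \<Rightarrow> 'a) measure \<Rightarrow> bool" where
  "is_frequency_measure \<theta> \<mu> \<longleftrightarrow>
     sets \<mu> = sets (shift_borel (subst_subshift \<theta>)) \<and> prob_space \<mu> \<and>
     (\<forall>k m. k \<le> 0 \<and> 0 \<le> m \<longrightarrow> (\<forall>v\<in>legal_words_of_length \<theta> (nat (m - k + 1)).
        measure \<mu> (cylinder \<theta> k m v) = freq_vector \<theta> (nat (m - k + 1)) v))"

definition frequency_measure :: "('a \<Rightarrow> 'a list pmf) \<Rightarrow> (int \<Rightarrow> 'a) measure" where
  "frequency_measure \<theta> = (THE \<mu>. is_frequency_measure \<theta> \<mu>)"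

section \<open>Substitutions with the same image distribution for all letters\<close>

definition positive_prob_vector :: "nat \<Rightarrow> (nat \<Rightarrow> real) \<Rightarrow> bool" where
  "positive_prob_vector l p \<longleftrightarrow> (\<forall>j\<in>{1..l}. p j > 0) \<and> (\<Sum>j\<in>{1..l}. p j) = 1"

text \<open>Every letter is mapped to \<open>w j\<close> with probability \<open>p j\<close>, \<open>j \<in> {1..l}\<close>
  (\<open>common_subst_pmf\<close> below); meaningful if \<open>p\<close> is a probability vector.\<close>

definition common_subst :: "nat \<Rightarrow> (nat \<Rightarrow> 'a list) \<Rightarrow> (nat \<Rightarrow> real) \<Rightarrow> 'a \<Rightarrow> 'a list pmf" where
  "common_subst l w p a = map_pmf w (embed_pmf (\<lambda>j. if j \<in> {1..l} then p j else 0))"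

context
  fixes l :: nat and p :: "nat \<Rightarrow> real"
  assumes p: "positive_prob_vector l p"
begin

lemma pmf_index: "pmf (embed_pmf (\<lambda>j. if j \<in> {1..l} then p j else 0)) j = (if j \<in> {1..l} then p j else 0)"
proof (rule pmf_embed_pmf)
  show nn: "0 \<le> (if j \<in> {1..l} then p j else 0)" for j
    using p by (auto simp: positive_prob_vector_def intro: less_imp_le)
  have "(\<integral>\<^sup>+ j. ennreal (if j \<in> {1..l} then p j else 0) \<partial>count_space UNIV)
      = (\<Sum>j\<in>{1..l}. ennreal (if j \<in> {1..l} then p j else 0))"
    by (rule nn_integral_count_space') auto
  also have "\<dots> = ennreal (\<Sum>j\<in>{1..l}. if j \<in> {1..l} then p j else 0)"
    using nn by (rule sum_ennreal)
  also have "\<dots> = 1" using p by (simp add: positive_prob_vector_def)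
  finally show "(\<integral>\<^sup>+ j. ennreal (if j \<in> {1..l} then p j else 0) \<partial>count_space UNIV) = 1" .
qed

lemma set_pmf_index: "set_pmf (embed_pmf (\<lambda>j. if j \<in> {1..l} then p j else 0)) = {1..l}"
  unfolding set_pmf_eq pmf_index using p by (force simp: positive_prob_vector_def split: if_splits)

lemma set_common_subst: "set_pmf (common_subst l w p a) = w ` {1..l}"
  unfolding common_subst_def set_map_pmf set_pmf_index ..

lemma common_subst_pmf:
  assumes "inj_on w {1..l}" "j \<in> {1..l}"
  shows "pmf (common_subst l w p a) (w j) = p j"
proof -
  have "pmf (common_subst l w p a) (w j) = pmf (embed_pmf (\<lambda>j. if j \<in> {1..l} then p j else 0)) j"
    unfolding common_subst_def by (rule pmf_map_inj) (use assms set_pmf_index in simp_all)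
  then show ?thesis using assms(2) unfolding pmf_index by simp
qed

lemma random_substitution_common_subst:
  assumes "\<forall>j\<in>{1..l}. w j \<noteq> []"
  shows "random_substitution (common_subst l w p)"
  using assms unfolding random_substitution_def set_common_subst by force

end

end

(* Since the law of the image of a letter does not depend on the letter, the legal words are the subwords of
   concatenations of the words w j, and the induced matrices have equal columns, so their
   Perron-Frobenius vectors are read off a column. For uniform probabilities this identifies the
   frequency measure: concatenate independent uniform words w j and choose the origin uniformly among
   the N positions of a block. Counting the full blocks inside a window of length n shows that this
   measure gives each legal word of length n a probability between c exp(-h n) and C exp(-h n) with
   h = ln l / N, whence the topological entropy and the entropy of the measure are both h.

   Uniqueness: an invariant measure nu of entropy h has block entropies at least h n, so by the lower
   bound its relative entropy on words of length n stays bounded in n. Hence sets of words that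
   become rare for the block measure become rare for nu. The words in which the frequency of a given
   word v deviates from its expectation are rare by a second-moment bound (the blocks are independent),
   so nu gives each cylinder the same mass as the block measure. *)

theory Submission
  imports Defs
begin

section \<open>Windows and cylinder sets\<close>

text \<open>The entropy estimates rest on one inequality, \<open>gibbs_inequality\<close>: an
  entropy is at most the mean code length as soon as exp (- code length) is dominated by a
  subprobability. Two explicit codes carry the proof. The metric entropy is a supremum over all
  finite measurable partitions, whose classes need not be visible in any window; the code in
  \<open>name_entropy_le\<close> describes a point by its blocks and pays a penalty for each class
  that the blocks predict wrongly. The code in \<open>rare_event\<close> is half adapted to a rare
  set of words and limits the mass that nu can give to this set. The rare sets consist of words of
  one fixed length, so the second-moment bound enters at a single length; the mean of the word
  frequency under nu is then read off the invariance of nu. One legal word can be read in several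
  phases of the block structure. Both bounds tolerate this: the lower one comes from a single phase,
  the upper one holds in every phase, and the N phases are averaged.\<close>

lemma window_eq_iff: "window x a b = window y a b \<longleftrightarrow> (\<forall>i\<in>{a..b}. x i = y i)"
  by (auto simp: window_def)

lemma length_window [simp]: "length (window x a b) = nat (b - a + 1)"
  by (simp add: window_def)

lemma window_nth: "k < nat (b - a + 1) \<Longrightarrow> window x a b ! k = x (a + int k)"
  by (simp add: window_def)

lemma shift_pow_apply: "(shift_map ^^ n) x = (\<lambda>i. x (i + int n))"
  by (induction n arbitrary: x) (auto simp: shift_map_def funpow_Suc_right algebra_simps simp del: funpow.simps(2))

lemma window_shift_pow: "window ((shift_map ^^ n) x) a b = window x (a + int n) (b + int n)"
  by (rule nth_equalityI) (auto simp: window_nth shift_pow_apply algebra_simps)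

lemma window_shift: "window (shift_map x) a b = window x (a + 1) (b + 1)"
  using window_shift_pow[of 1] by simp

lemma topspace_fullshift [simp]: "topspace fullshift_topology = UNIV"
  by (simp add: fullshift_topology_def)

lemma openin_agree: "openin fullshift_topology {x. \<forall>i\<in>{a..b}. x i = y i}"
proof -
  have 1: "openin fullshift_topology {x. x i = c}" for i :: int and c :: 'a
  proof -
    have "continuous_map fullshift_topology (discrete_topology UNIV) (\<lambda>x::int \<Rightarrow> 'a. x i)"
      unfolding fullshift_topology_def by (rule continuous_map_product_projection) simp
    from openin_continuous_map_preimage[OF this, of "{c}"] show ?thesis by simp
  qed
  have "{x. \<forall>i\<in>{a..b}. x i = y i} = (if a \<le> b then (\<Inter>i\<in>{a..b}. {x. x i = y i}) else UNIV)"
    by auto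
  moreover have "openin fullshift_topology (\<Inter>i\<in>{a..b}. {x. x i = y i})" if "a \<le> b"
    using that by (intro openin_INT2) (auto intro: 1)
  moreover have "openin fullshift_topology (UNIV :: (int \<Rightarrow> 'a) set)"
    using openin_topspace[of "fullshift_topology :: (int \<Rightarrow> 'a) topology"] by simp
  ultimately show ?thesis by simp
qed

lemma openin_window: "openin fullshift_topology {x. window x a b \<in> S}"
proof -
  have "{x. window x a b \<in> S} = (\<Union>y\<in>{y. window y a b \<in> S}. {x. \<forall>i\<in>{a..b}. x i = y i})"
    by (auto simp flip: window_eq_iff)
  moreover have "openin fullshift_topology (\<Union>y\<in>{y. window y a b \<in> S}. {x. \<forall>i\<in>{a..b}. x i = y i})"
    by (intro openin_Union ballI) (auto simp only: image_iff openin_agree)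
  ultimately show ?thesis by simp
qed

text \<open>A basic open set of the product topology restricts only finitely many coordinates, and
  these lie in one symmetric window.\<close>

lemma openin_fullshift_nhd:
  assumes "openin fullshift_topology U" "y \<in> U"
  shows "\<exists>m::nat. {x. window x (- int m) (int m) = window y (- int m) (int m)} \<subseteq> U"
proof -
  obtain V where V: "finite {i. V i \<noteq> (UNIV::'a set)}" "y \<in> Pi\<^sub>E UNIV V" "Pi\<^sub>E UNIV V \<subseteq> U"
    using assms unfolding fullshift_topology_def openin_product_topology_alt by force
  define F where "F = {i. V i \<noteq> (UNIV::'a set)}"
  \<comment> \<open>The inserted 0 covers the case that no coordinate is restricted.\<close>
  define m where "m = nat (Max (insert 0 (abs ` F)))"
  have "finite F" using V by (simp add: F_def)
  then have m: "\<bar>i\<bar> \<le> int m" if "i \<in> F" for i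
    using that by (auto simp: m_def intro!: Max_ge le_nat_iff[THEN iffD1] simp: Max_ge_iff)
  have "x \<in> Pi\<^sub>E UNIV V" if "window x (- int m) (int m) = window y (- int m) (int m)" for x
  proof -
    have "x i \<in> V i" for i
    proof (cases "i \<in> F")
      case True
      then have "i \<in> {- int m..int m}" using m by fastforce
      then have "x i = y i" using that by (auto simp: window_eq_iff)
      then show ?thesis using V by (auto simp: PiE_iff)
    qed (auto simp: F_def)
    then show ?thesis by auto
  qed
  then show ?thesis using V by blast
qed

text \<open>The windows \<open>[-m, m]\<close> are nested and exhaust the integers, so any two
  members can be described by the same window. This makes the family an algebra, and it generates
  the Borel sets.\<close>

definition cylinder_algebra :: "(int \<Rightarrow> 'a) set \<Rightarrow> (int \<Rightarrow> 'a) set set" where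
  "cylinder_algebra X = {X \<inter> {x. window x (- int m) (int m) \<in> S} | m S. True}"

lemma cylinder_algebra_I: "X \<inter> {x. window x (- int m) (int m) \<in> S} \<in> cylinder_algebra X"
  by (auto simp: cylinder_algebra_def)

text \<open>A larger window determines the smaller one, so a member can be rewritten with every
  larger radius; finitely many members thereby receive a common radius.\<close>

lemma cylinder_algebra_mono:
  assumes "A \<in> cylinder_algebra X"
  obtains m0 where "\<And>m. m \<ge> m0 \<Longrightarrow> \<exists>S. A = X \<inter> {x. window x (- int m) (int m) \<in> S}"
proof -
  obtain m0 S where A: "A = X \<inter> {x. window x (- int m0) (int m0) \<in> S}"
    using assms by (auto simp: cylinder_algebra_def)
  have "\<exists>S. A = X \<inter> {x. window x (- int m) (int m) \<in> S}" if "m \<ge> m0" for m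
  proof -
    define S' where "S' = (\<lambda>x. window x (- int m) (int m)) ` A"
    have "x \<in> A" if "x \<in> X" "window x (- int m) (int m) = window y (- int m) (int m)" "y \<in> A" for x y
    proof -
      have "window x (- int m0) (int m0) = window y (- int m0) (int m0)"
        using that \<open>m0 \<le> m\<close> by (auto simp: window_eq_iff)
      then show ?thesis using that A by auto
    qed
    then have "A = X \<inter> {x. window x (- int m) (int m) \<in> S'}"
      using A by (auto simp: S'_def)
    then show ?thesis by blast
  qed
  then show ?thesis using that by blast
qed

lemma cylinder_algebra_Int:
  assumes "A \<in> cylinder_algebra X" "B \<in> cylinder_algebra X"
  shows "A \<inter> B \<in> cylinder_algebra X"
proof -
  obtain a where a: "\<And>m. m \<ge> a \<Longrightarrow> \<exists>S. A = X \<inter> {x. window x (- int m) (int m) \<in> S}"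
    using cylinder_algebra_mono[OF assms(1)] by blast
  obtain b where b: "\<And>m. m \<ge> b \<Longrightarrow> \<exists>S. B = X \<inter> {x. window x (- int m) (int m) \<in> S}"
    using cylinder_algebra_mono[OF assms(2)] by blast
  obtain S S' where "A = X \<inter> {x. window x (- int (max a b)) (int (max a b)) \<in> S}"
    "B = X \<inter> {x. window x (- int (max a b)) (int (max a b)) \<in> S'}"
    using a[of "max a b"] b[of "max a b"] by auto
  then have "A \<inter> B = X \<inter> {x. window x (- int (max a b)) (int (max a b)) \<in> S \<inter> S'}" by auto
  then show ?thesis by (metis cylinder_algebra_I)
qed

lemma cylinder_algebra_compl:
  assumes "A \<in> cylinder_algebra X" shows "X - A \<in> cylinder_algebra X"
proof -
  obtain m S where "A = X \<inter> {x. window x (- int m) (int m) \<in> S}"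
    using assms by (auto simp: cylinder_algebra_def)
  then have "X - A = X \<inter> {x. window x (- int m) (int m) \<in> - S}" by auto
  then show ?thesis by (metis cylinder_algebra_I)
qed

lemma cylinder_algebra_Un:
  assumes "A \<in> cylinder_algebra X" "B \<in> cylinder_algebra X"
  shows "A \<union> B \<in> cylinder_algebra X"
proof -
  have "A \<subseteq> X" "B \<subseteq> X" using assms by (auto simp: cylinder_algebra_def)
  then have "A \<union> B = X - ((X - A) \<inter> (X - B))" by auto
  then show ?thesis using assms by (metis cylinder_algebra_Int cylinder_algebra_compl)
qed

section \<open>Borel sets of a shift space: generation and approximation by cylinder sets\<close>

lemma space_shift_borel [simp]: "space (shift_borel X) = X"
  unfolding shift_borel_def by (rule space_measure_of) (auto simp: openin_subtopology)

lemma sets_shift_borel: "sets (shift_borel X) = sigma_sets X {U. openin (subtopology fullshift_topology X) U}"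
  unfolding shift_borel_def by (rule sets_measure_of) (auto simp: openin_subtopology)

lemma window_in_shift_borel: "X \<inter> {x. window x a b \<in> S} \<in> sets (shift_borel X)"
proof -
  have "openin (subtopology fullshift_topology X) (X \<inter> {x. window x a b \<in> S})"
    by (auto simp: openin_subtopology intro!: exI[of _ "{x. window x a b \<in> S}"] openin_window)
  then show ?thesis unfolding sets_shift_borel by (auto intro: sigma_sets.Basic)
qed

text \<open>Over a finite alphabet there are only countably many words, so every open set is a
  countable union of cylinders.\<close>

lemma sets_shift_borel_cylinders:
  fixes X :: "(int \<Rightarrow> 'a::finite) set"
  shows "sets (shift_borel X) = sigma_sets X (cylinder_algebra X)"
proof
  have "U \<in> sigma_sets X (cylinder_algebra X)" if U: "openin (subtopology fullshift_topology X) U" for U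
  proof -
    obtain V where V: "openin fullshift_topology V" "U = V \<inter> X"
      using U unfolding openin_subtopology by blast
    define C where "C = {X \<inter> {x. window x (- int m) (int m) = v} | m v. X \<inter> {x. window x (- int m) (int m) = v} \<subseteq> U}"
    have "C \<subseteq> (\<lambda>(m, v). X \<inter> {x. window x (- int m) (int m) = v}) ` UNIV"
      unfolding C_def by auto
    then have "countable C" by (rule countable_subset) auto
    moreover have "C \<subseteq> sigma_sets X (cylinder_algebra X)"
      unfolding C_def using cylinder_algebra_I[of X _ "{_}"] by (auto intro!: sigma_sets.Basic)
    ultimately have "\<Union>C \<in> sigma_sets X (cylinder_algebra X)"
      by (rule sigma_algebra.countable_Union[OF sigma_algebra_sigma_sets, rotated])
        (auto simp: cylinder_algebra_def)
    moreover have "\<Union>C = U"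
    proof
      show "U \<subseteq> \<Union>C"
      proof
        fix y assume y: "y \<in> U"
        then obtain m where "{x. window x (- int m) (int m) = window y (- int m) (int m)} \<subseteq> V"
          using openin_fullshift_nhd[OF V(1)] V by blast
        then have "X \<inter> {x. window x (- int m) (int m) = window y (- int m) (int m)} \<in> C"
          unfolding C_def using V by blast
        moreover have "y \<in> X \<inter> {x. window x (- int m) (int m) = window y (- int m) (int m)}"
          using y V by auto
        ultimately show "y \<in> \<Union>C" by blast
      qed
    qed (auto simp: C_def)
    ultimately show ?thesis by simp
  qed
  then have "{U. openin (subtopology fullshift_topology X) U} \<subseteq> sigma_sets X (cylinder_algebra X)"
    by blast
  then show "sets (shift_borel X) \<subseteq> sigma_sets X (cylinder_algebra X)"
    unfolding sets_shift_borel by (rule sigma_sets_mono)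
  have "cylinder_algebra X \<subseteq> sets (shift_borel X)"
    unfolding cylinder_algebra_def using window_in_shift_borel by blast
  then show "sigma_sets X (cylinder_algebra X) \<subseteq> sets (shift_borel X)"
    using sets.sigma_sets_subset[of "cylinder_algebra X" "shift_borel X"] by simp
qed

lemma shift_borel_measure_eqI:
  fixes X :: "(int \<Rightarrow> 'a::finite) set"
  assumes "sets \<mu> = sets (shift_borel X)" "sets \<nu> = sets (shift_borel X)" "finite_measure \<mu>"
    and eq: "\<And>A. A \<in> cylinder_algebra X \<Longrightarrow> emeasure \<mu> A = emeasure \<nu> A"
  shows "\<mu> = \<nu>"
proof (rule measure_eqI_generator_eq[where E = "cylinder_algebra X" and \<Omega> = X and A = "\<lambda>_. X"])
  show "Int_stable (cylinder_algebra X)"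
    by (auto simp: Int_stable_def intro: cylinder_algebra_Int)
  show "range (\<lambda>_::nat. X) \<subseteq> cylinder_algebra X"
    using cylinder_algebra_I[of X 0 UNIV] by auto
  show "cylinder_algebra X \<subseteq> Pow X" by (auto simp: cylinder_algebra_def)
  show "emeasure \<mu> X \<noteq> \<infinity>" using assms(3) by (simp add: finite_measure.emeasure_finite)
qed (use assms sets_shift_borel_cylinders[of X] in auto)

text \<open>The sets that can be approximated form a sigma-algebra: a countable union is first
  replaced by a finite one, whose members are then approximated separately. This is what makes the
  classes of an arbitrary partition predictable from a finite window.\<close>

lemma cylinder_algebra_approx:
  fixes X :: "(int \<Rightarrow> 'a::finite) set"
  assumes M: "sets M = sets (shift_borel X)" and "finite_measure M" and A: "A \<in> sets M" and "e > 0"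
  shows "\<exists>B\<in>cylinder_algebra X. measure M ((A - B) \<union> (B - A)) < e"
proof -
  interpret finite_measure M by fact
  have sp: "space M = X" using sets_eq_imp_space_eq[OF M] by simp
  have cyl_sets: "B \<in> sets M" if "B \<in> cylinder_algebra X" for B
    using that M by (auto simp: sets_shift_borel_cylinders)
  have "A \<in> sigma_sets X (cylinder_algebra X)"
    using A M sets_shift_borel_cylinders by auto
  then have "A \<in> sets M \<and> (\<forall>e>0. \<exists>B\<in>cylinder_algebra X. measure M ((A - B) \<union> (B - A)) < e)"
  proof (induction)
    case (Basic a)
    then show ?case using cyl_sets by (auto intro!: bexI[of _ a])
  next
    case Empty
    then show ?case using cylinder_algebra_I[of X 0 "{}"] by (auto intro!: bexI[of _ "{}"])
  next
    case (Compl a)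
    show ?case
    proof (intro conjI allI impI)
      show "X - a \<in> sets M" using Compl sp by auto
      fix e :: real assume "e > 0"
      then obtain B where B: "B \<in> cylinder_algebra X" "measure M ((a - B) \<union> (B - a)) < e"
        using Compl by blast
      have "a \<subseteq> X" "B \<subseteq> X" using Compl B cyl_sets sp sets.sets_into_space by blast+
      then have "((X - a) - (X - B)) \<union> ((X - B) - (X - a)) = (a - B) \<union> (B - a)" by auto
      then show "\<exists>B\<in>cylinder_algebra X. measure M (((X - a) - B) \<union> (B - (X - a))) < e"
        using B cylinder_algebra_compl by (metis (no_types, lifting))
    qed
  next
    case (Union a)
    have as: "a i \<in> sets M" for i using Union by blast
    show ?case
    proof (intro conjI allI impI)
      show "\<Union> (range a) \<in> sets M" using as by blast
      fix e :: real assume e: "e > 0"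
      have "(\<lambda>n. measure M (\<Union>i\<le>n. a i)) \<longlonglongrightarrow> measure M (\<Union>n. \<Union>i\<le>n. a i)"
        by (rule finite_Lim_measure_incseq) (use as in \<open>force simp: incseq_def\<close>)+
      moreover have "(\<Union>n. \<Union>i\<le>n. a i) = \<Union> (range a)" by auto
      ultimately have "eventually (\<lambda>n. measure M (\<Union> (range a)) - e/2 < measure M (\<Union>i\<le>n. a i)) sequentially"
        using e by (intro order_tendstoD(1)) auto
      then obtain n where n: "measure M (\<Union> (range a)) - e/2 < measure M (\<Union>i\<le>n. a i)"
        unfolding eventually_sequentially by blast
      \<comment> \<open>Half of \<open>e\<close> is spent on cutting the union at \<open>n\<close>;
        the other half is divided among the \<open>Suc n\<close> remaining sets.\<close>
      define d where "d = e / (2 * real (Suc n))"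
      have "d > 0" using e by (simp add: d_def)
      then have "\<forall>i. \<exists>B\<in>cylinder_algebra X. measure M ((a i - B) \<union> (B - a i)) < d"
        using Union by blast
      then obtain B where B: "\<And>i. B i \<in> cylinder_algebra X" "\<And>i. measure M ((a i - B i) \<union> (B i - a i)) < d"
        by metis
      define C where "C = (\<Union>i\<le>n. B i)"
      have "(\<Union>i\<le>k. B i) \<in> cylinder_algebra X" for k
        by (induction k) (auto simp: atMost_Suc intro: cylinder_algebra_Un B)
      then have C: "C \<in> cylinder_algebra X" by (simp add: C_def)
      have sm: "(a i - B i) \<union> (B i - a i) \<in> sets M" for i using as B cyl_sets by blast
      have "(\<Union> (range a) - C) \<union> (C - \<Union> (range a))
          \<subseteq> (\<Union> (range a) - (\<Union>i\<le>n. a i)) \<union> (\<Union>i\<le>n. (a i - B i) \<union> (B i - a i))"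
        unfolding C_def by auto
      then have "measure M ((\<Union> (range a) - C) \<union> (C - \<Union> (range a)))
          \<le> measure M ((\<Union> (range a) - (\<Union>i\<le>n. a i)) \<union> (\<Union>i\<le>n. (a i - B i) \<union> (B i - a i)))"
        using as sm by (intro finite_measure_mono) auto
      also have "\<dots> \<le> measure M (\<Union> (range a) - (\<Union>i\<le>n. a i)) + measure M (\<Union>i\<le>n. (a i - B i) \<union> (B i - a i))"
        by (rule measure_Un_le) (use as sm in auto)
      also have "measure M (\<Union> (range a) - (\<Union>i\<le>n. a i)) = measure M (\<Union> (range a)) - measure M (\<Union>i\<le>n. a i)"
        using as by (intro finite_measure_Diff) auto
      also have "measure M (\<Union>i\<le>n. (a i - B i) \<union> (B i - a i)) \<le> (\<Sum>i\<le>n. measure M ((a i - B i) \<union> (B i - a i)))"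
        using finite_measure_subadditive_finite[of "{..n}" "\<lambda>i. (a i - B i) \<union> (B i - a i)"] sm by blast
      also have "\<dots> \<le> (\<Sum>i\<le>n. d)" using B by (intro sum_mono) (auto intro: less_imp_le)
      also have "\<dots> = e / 2" by (simp add: d_def field_simps)
      finally have "measure M ((\<Union> (range a) - C) \<union> (C - \<Union> (range a))) < e" using n by linarith
      then show "\<exists>B\<in>cylinder_algebra X. measure M ((\<Union> (range a) - B) \<union> (B - \<Union> (range a))) < e"
        using C by blast
    qed
  qed
  then show ?thesis using \<open>e > 0\<close> by blast
qed

lemma compact_subshift:
  fixes X :: "(int \<Rightarrow> 'a::finite) set"
  assumes "closedin fullshift_topology X"
  shows "compact_space (subtopology fullshift_topology X)"
proof -
  have "compact_space (fullshift_topology :: (int \<Rightarrow> 'a) topology)"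
    unfolding fullshift_topology_def by (simp add: compact_space_product_topology compact_space_discrete_topology)
  then show ?thesis using assms closedin_compact_space compact_space_subtopology by blast
qed

section \<open>Entropy of simple functions\<close>

definition fibre_prob :: "'x measure \<Rightarrow> ('x \<Rightarrow> 'b) \<Rightarrow> 'b \<Rightarrow> real" where
  "fibre_prob M f y = measure M (f -` {y} \<inter> space M)"

text \<open>Entropy of the partition into the level sets of \<open>f\<close>. With functions in
  place of partitions, a join becomes a tuple of functions and a coarsening becomes a
  composition.\<close>

definition fun_entropy :: "'x measure \<Rightarrow> ('x \<Rightarrow> 'b) \<Rightarrow> real" where
  "fun_entropy M f = - (\<Sum>y\<in>f ` space M. fibre_prob M f y * ln (fibre_prob M f y))"

lemma fibre_prob_nonneg: "fibre_prob M f y \<ge> 0"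
  by (simp add: fibre_prob_def)

context prob_space
begin

lemma integrable_simple:
  fixes h :: "'b \<Rightarrow> real"
  assumes "simple_function M f"
  shows "integrable M (\<lambda>x. h (f x))"
proof -
  have "simple_function M (\<lambda>x. h (f x))" using simple_function_compose[OF assms, of h] by (simp add: comp_def)
  then show ?thesis by (intro integrable_simple_function) auto
qed

lemma integral_simple:
  fixes h :: "'b \<Rightarrow> real"
  assumes f: "simple_function M f" and W: "finite W" "f ` space M \<subseteq> W"
  shows "(\<integral>x. h (f x) \<partial>M) = (\<Sum>y\<in>W. fibre_prob M f y * h y)"
proof -
  have fib: "f -` {y} \<inter> space M \<in> sets M" for y using f by (rule simple_functionD)
  have "(\<integral>x. h (f x) \<partial>M) = (\<integral>x. (\<Sum>y\<in>W. h y * indicator (f -` {y} \<inter> space M) x) \<partial>M)"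
  proof (rule Bochner_Integration.integral_cong[OF refl])
    fix x assume x: "x \<in> space M"
    have "(\<Sum>y\<in>W. h y * indicator (f -` {y} \<inter> space M) x) = (\<Sum>y\<in>W. if y = f x then h y else 0)"
      by (rule sum.cong) (use x in auto)
    also have "\<dots> = h (f x)" using W x by (subst sum.delta) auto
    finally show "h (f x) = (\<Sum>y\<in>W. h y * indicator (f -` {y} \<inter> space M) x)" by simp
  qed
  also have "\<dots> = (\<Sum>y\<in>W. \<integral>x. h y * indicator (f -` {y} \<inter> space M) x \<partial>M)"
    by (rule Bochner_Integration.integral_sum) (use fib in \<open>auto intro!: integrable_real_indicator simp: emeasure_eq_measure\<close>)
  also have "\<dots> = (\<Sum>y\<in>W. fibre_prob M f y * h y)"
    using fib by (intro sum.cong) (auto simp: fibre_prob_def)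
  finally show ?thesis .
qed

lemma sum_fibre_prob:
  assumes f: "simple_function M f" and W: "finite W" "f ` space M \<subseteq> W"
  shows "(\<Sum>y\<in>W. fibre_prob M f y) = 1"
  using integral_simple[OF assms, of "\<lambda>_. 1"] prob_space by simp

lemma fibre_prob_le_compose:
  assumes F: "simple_function M F" and f: "\<And>x. x \<in> space M \<Longrightarrow> f x = \<phi> (F x)"
  shows "fibre_prob M F y \<le> fibre_prob M f (\<phi> y)"
proof -
  have "simple_function M (\<lambda>x. \<phi> (F x))" using simple_function_compose[OF F, of \<phi>] by (simp add: comp_def)
  then have "(\<lambda>x. \<phi> (F x)) -` {\<phi> y} \<inter> space M \<in> sets M" by (rule simple_functionD)
  moreover have "(\<lambda>x. \<phi> (F x)) -` {\<phi> y} \<inter> space M = f -` {\<phi> y} \<inter> space M" using f by auto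
  ultimately show ?thesis
    unfolding fibre_prob_def by (intro finite_measure_mono) (auto simp: f)
qed

lemma fun_entropy_integral:
  assumes "simple_function M f"
  shows "fun_entropy M f = (\<integral>x. - ln (fibre_prob M f (f x)) \<partial>M)"
  using integral_simple[OF assms _ order_refl, of "\<lambda>y. - ln (fibre_prob M f y)"] simple_functionD(1)[OF assms]
  by (simp add: fun_entropy_def sum_negf)

text \<open>The inequality ln x \<le> x - 1 is applied to \<open>Q y / p (\<phi> y)\<close> and
  weighted with the mass of \<open>y\<close>. \<open>L\<close> plays the role of a code length and
  \<open>Q\<close> that of the subprobability of the code. The code may describe \<open>F\<close>,
  which carries more information than \<open>f\<close>; the extra information only helps, since an
  \<open>F\<close>-fibre is no heavier than the \<open>f\<close>-fibre around it.\<close>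

lemma gibbs_inequality:
  fixes L Q :: "'b \<Rightarrow> real"
  assumes F: "simple_function M F" and f: "\<And>x. x \<in> space M \<Longrightarrow> f x = \<phi> (F x)"
    and Q: "\<And>y. y \<in> F ` space M \<Longrightarrow> Q y \<ge> 0" "(\<Sum>y\<in>F ` space M. Q y) \<le> 1"
    and L: "\<And>y. y \<in> F ` space M \<Longrightarrow> fibre_prob M F y > 0 \<Longrightarrow> exp (- L y) \<le> Q y"
  shows "fun_entropy M f \<le> (\<integral>x. L (F x) \<partial>M)"
proof -
  let ?W = "F ` space M"
  have fin: "finite ?W" using F by (rule simple_functionD)
  have "simple_function M (\<lambda>x. \<phi> (F x))" using simple_function_compose[OF F, of \<phi>] by (simp add: comp_def)
  then have sf: "simple_function M f" using f simple_function_cong[of M f "\<lambda>x. \<phi> (F x)"] by auto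
  define P p where "P = fibre_prob M F" and "p = fibre_prob M f"
  have Pp: "P y \<le> p (\<phi> y)" for y
    unfolding P_def p_def using F f by (rule fibre_prob_le_compose)
  have P0: "P y \<ge> 0" for y by (simp add: P_def fibre_prob_nonneg)
  have "fun_entropy M f = (\<integral>x. - ln (p (\<phi> (F x))) \<partial>M)"
    unfolding fun_entropy_integral[OF sf] p_def
    by (rule Bochner_Integration.integral_cong) (auto simp: f)
  also have "\<dots> = (\<Sum>y\<in>?W. P y * - ln (p (\<phi> y)))"
    unfolding P_def by (rule integral_simple[OF F fin order_refl])
  finally have 1: "fun_entropy M f = (\<Sum>y\<in>?W. P y * - ln (p (\<phi> y)))" .
  have 2: "(\<integral>x. L (F x) \<partial>M) = (\<Sum>y\<in>?W. P y * L y)"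
    unfolding P_def by (rule integral_simple[OF F fin order_refl])
  have "P y * - ln (p (\<phi> y)) - P y * L y \<le> Q y - P y" if y: "y \<in> ?W" for y
  proof (cases "P y > 0")
    case True
    have pp: "p (\<phi> y) > 0" using True Pp[of y] by linarith
    have eL: "exp (- L y) \<le> Q y" using L[OF y] True by (simp add: P_def)
    then have Qp: "Q y > 0" by (rule order_less_le_trans[rotated]) simp
    have "- L y \<le> ln (Q y)" using eL Qp by (simp add: ln_ge_iff)
    then have "- ln (p (\<phi> y)) - L y \<le> ln (Q y / p (\<phi> y))"
      using Qp pp by (simp add: ln_div)
    also have "\<dots> \<le> Q y / p (\<phi> y) - 1" using Qp pp by (intro ln_le_minus_one) simp
    finally have "P y * (- ln (p (\<phi> y)) - L y) \<le> P y * (Q y / p (\<phi> y) - 1)"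
      using True by (intro mult_left_mono) auto
    also have "\<dots> = Q y * (P y / p (\<phi> y)) - P y" by (simp add: algebra_simps)
    \<comment> \<open>The passage from \<open>F\<close> to the coarser \<open>f\<close> is absorbed
      here by \<open>P y \<le> p (\<phi> y)\<close>.\<close>
    also have "\<dots> \<le> Q y * 1 - P y"
      using Qp pp Pp[of y] by (intro diff_right_mono mult_left_mono) (auto simp: field_simps)
    finally show ?thesis by (simp add: algebra_simps)
  next
    case False
    then have "P y = 0" using P0[of y] by linarith
    then show ?thesis using Q(1)[OF y] by simp
  qed
  then have "(\<Sum>y\<in>?W. P y * - ln (p (\<phi> y)) - P y * L y) \<le> (\<Sum>y\<in>?W. Q y - P y)"
    by (rule sum_mono)
  also have "\<dots> \<le> 1 - 1"
    using Q(2) sum_fibre_prob[OF F fin order_refl] by (simp add: sum_subtractf P_def)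
  finally show ?thesis unfolding 1 2 by (simp add: sum_subtractf)
qed

lemma fun_entropy_ge:
  assumes f: "simple_function M f" and c: "\<And>y. fibre_prob M f y \<le> exp (- c)"
  shows "c \<le> fun_entropy M f"
proof -
  have fin: "finite (f ` space M)" using f by (rule simple_functionD)
  have "fibre_prob M f y * c \<le> - (fibre_prob M f y * ln (fibre_prob M f y))" for y
  proof (cases "fibre_prob M f y = 0")
    case False
    then have pos: "fibre_prob M f y > 0" using fibre_prob_nonneg[of M f y] by linarith
    then have "ln (fibre_prob M f y) \<le> - c" using c[of y] by (metis ln_exp ln_le_cancel_iff exp_gt_zero)
    then have "fibre_prob M f y * c \<le> fibre_prob M f y * - ln (fibre_prob M f y)"
      using pos by (intro mult_left_mono) auto
    then show ?thesis by simp
  qed simp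
  then have "(\<Sum>y\<in>f ` space M. fibre_prob M f y * c) \<le> (\<Sum>y\<in>f ` space M. - (fibre_prob M f y * ln (fibre_prob M f y)))"
    by (intro sum_mono)
  then show ?thesis
    using sum_fibre_prob[OF f fin order_refl] by (simp add: fun_entropy_def sum_negf flip: sum_distrib_right)
qed

text \<open>Gibbs' inequality with the law of \<open>f\<close> itself as \<open>Q\<close> and a
  constant code length.\<close>

lemma fun_entropy_le:
  assumes f: "simple_function M f"
    and c: "\<And>y. y \<in> f ` space M \<Longrightarrow> fibre_prob M f y > 0 \<Longrightarrow> exp (- c) \<le> fibre_prob M f y"
  shows "fun_entropy M f \<le> c"
proof -
  have fin: "finite (f ` space M)" using f by (rule simple_functionD)
  have "fun_entropy M f \<le> (\<integral>x. c \<partial>M)"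
    by (rule gibbs_inequality[where \<phi> = id and Q = "fibre_prob M f" and L = "\<lambda>_. c", OF f])
      (use c sum_fibre_prob[OF f fin order_refl] fibre_prob_nonneg in auto)
  then show ?thesis using prob_space by simp
qed

text \<open>Names of length \<open>n\<close> are stored as functions cut off at \<open>n\<close>;
  the cut makes them extensional, so that they range over a finite product.\<close>

lemma simple_function_restrict:
  fixes G :: "nat \<Rightarrow> 'a \<Rightarrow> 'b"
  assumes "\<And>i. i < n \<Longrightarrow> simple_function M (G i)"
  shows "simple_function M (\<lambda>x. \<lambda>i\<in>{..<n}. G i x)"
  unfolding simple_function_def
proof (intro conjI ballI)
  have "(\<lambda>x. \<lambda>i\<in>{..<n}. G i x) ` space M \<subseteq> Pi\<^sub>E {..<n} (\<lambda>i. G i ` space M)"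
    by (intro image_subsetI) (simp only: restrict_PiE_iff, blast)
  moreover have "finite (Pi\<^sub>E {..<n} (\<lambda>i. G i ` space M))"
    using assms simple_functionD(1) by (intro finite_PiE) auto
  ultimately show "finite ((\<lambda>x. \<lambda>i\<in>{..<n}. G i x) ` space M)" by (rule finite_subset)
  fix y assume "y \<in> (\<lambda>x. \<lambda>i\<in>{..<n}. G i x) ` space M"
  then have y: "y \<in> extensional {..<n}" using restrict_extensional by blast
  have "(\<lambda>x. \<lambda>i\<in>{..<n}. G i x) -` {y} \<inter> space M = {x \<in> space M. \<forall>i\<in>{..<n}. x \<in> G i -` {y i} \<inter> space M}"
    using y by (auto simp: extensional_def restrict_def fun_eq_iff)
  also have "\<dots> \<in> sets M"
  proof (rule sets.sets_Collect_finite_All)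
    fix i assume "i \<in> {..<n}"
    then have "G i -` {y i} \<inter> space M \<in> sets M" using simple_functionD(2)[OF assms] by simp
    then show "{x \<in> space M. x \<in> G i -` {y i} \<inter> space M} \<in> sets M"
      by (simp add: vimage_def Int_def conj_commute)
  qed simp
  finally show "(\<lambda>x. \<lambda>i\<in>{..<n}. G i x) -` {y} \<inter> space M \<in> sets M" .
qed

end

text \<open>The two functions have the same level sets, and \<open>h\<close> matches their
  labels.\<close>

lemma fun_entropy_fibre_cong:
  assumes "\<And>x y. x \<in> space M \<Longrightarrow> y \<in> space M \<Longrightarrow> f x = f y \<longleftrightarrow> g x = g y"
  shows "fun_entropy M f = fun_entropy M g"
proof -
  define h where "h = (\<lambda>y. g (inv_into (space M) f y))"
  have h: "h (f x) = g x" if "x \<in> space M" for x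
  proof -
    have "f (inv_into (space M) f (f x)) = f x" "inv_into (space M) f (f x) \<in> space M"
      using that by (auto intro: f_inv_into_f inv_into_into)
    then show ?thesis unfolding h_def using assms that by blast
  qed
  have "bij_betw h (f ` space M) (g ` space M)"
    unfolding bij_betw_def inj_on_def using assms by (auto simp: h image_iff)
  moreover have "fibre_prob M g (h y) = fibre_prob M f y" if y: "y \<in> f ` space M" for y
  proof -
    obtain x where x: "x \<in> space M" "y = f x" using y by auto
    have "g -` {h y} \<inter> space M = f -` {y} \<inter> space M" using x assms by (auto simp: h)
    then show ?thesis by (simp add: fibre_prob_def)
  qed
  ultimately show ?thesis
    unfolding fun_entropy_def by (simp add: sum.reindex_bij_betw[symmetric])
qed

lemma partition_entropy_fibres:
  assumes "\<xi> - {{}} = (\<lambda>y. f -` {y} \<inter> space M) ` f ` space M" "finite (f ` space M)"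
  shows "partition_entropy M \<xi> = fun_entropy M f"
proof -
  have "finite (\<xi> - {{}})" unfolding assms(1) using assms(2) by simp
  then have fin: "finite \<xi>" by simp
  have inj: "inj_on (\<lambda>y. f -` {y} \<inter> space M) (f ` space M)" by (auto simp: inj_on_def)
  have "(\<Sum>A\<in>\<xi>. measure M A * ln (measure M A)) = (\<Sum>A\<in>\<xi> - {{}}. measure M A * ln (measure M A))"
    using fin by (intro sum.mono_neutral_right) auto
  then show ?thesis
    unfolding assms(1) sum.reindex[OF inj] by (simp add: partition_entropy_def fun_entropy_def fibre_prob_def)
qed

text \<open>\<open>c\<close> sends a point to the member of the partition that contains it, so that the names of
  length \<open>n\<close> label the non-empty members of the join.\<close>

lemma dyn_join_fibres:
  assumes part: "partition_on X \<xi>" and T: "\<And>x. x \<in> X \<Longrightarrow> T x \<in> X"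
    and c: "\<And>x. x \<in> X \<Longrightarrow> c x \<in> \<xi> \<and> x \<in> c x"
  shows "dyn_join X T n \<xi> - {{}}
    = (\<lambda>y. (\<lambda>x. \<lambda>i\<in>{..<n}. c ((T ^^ i) x)) -` {y} \<inter> X) ` (\<lambda>x. \<lambda>i\<in>{..<n}. c ((T ^^ i) x)) ` X"
proof -
  have TX: "(T ^^ i) x \<in> X" if "x \<in> X" for i x using that T by (induction i) auto
  have c_eq: "c x = A" if "x \<in> X" "A \<in> \<xi>" "x \<in> A" for x A
    using part c[OF that(1)] that by (auto simp: partition_on_def disjoint_def)
  let ?N = "\<lambda>x. \<lambda>i\<in>{..<n}. c ((T ^^ i) x)"
  have join: "X \<inter> (\<Inter>i<n. (T ^^ i) -` f i) = ?N -` {?N x} \<inter> X"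
    if f: "\<forall>i<n. f i \<in> \<xi>" and x: "x \<in> X" "\<forall>i<n. (T ^^ i) x \<in> f i" for f x
  proof -
    have cf: "c ((T ^^ i) x) = f i" if "i < n" for i using c_eq TX x f that by blast
    have "?N y = ?N x \<longleftrightarrow> (\<forall>i<n. (T ^^ i) y \<in> f i)" if "y \<in> X" for y
    proof -
      have "?N y = ?N x \<longleftrightarrow> (\<forall>i<n. c ((T ^^ i) y) = c ((T ^^ i) x))"
        by (auto simp: restrict_def fun_eq_iff)
      also have "\<dots> \<longleftrightarrow> (\<forall>i<n. (T ^^ i) y \<in> f i)"
        using cf c c_eq TX that f by metis
      finally show ?thesis .
    qed
    then show ?thesis by auto
  qed
  show ?thesis
  proof (intro equalityI subsetI)
    fix A assume "A \<in> dyn_join X T n \<xi> - {{}}"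
    then obtain f x where f: "\<forall>i<n. f i \<in> \<xi>" "A = X \<inter> (\<Inter>i<n. (T ^^ i) -` f i)" "x \<in> A"
      by (auto simp: dyn_join_def)
    then have "A = ?N -` {?N x} \<inter> X" "x \<in> X" using join[OF f(1), of x] by auto
    then show "A \<in> (\<lambda>y. ?N -` {y} \<inter> X) ` ?N ` X" by blast
  next
    fix A assume "A \<in> (\<lambda>y. ?N -` {y} \<inter> X) ` ?N ` X"
    then obtain x where x: "x \<in> X" "A = ?N -` {?N x} \<inter> X" by auto
    have f: "\<forall>i<n. c ((T ^^ i) x) \<in> \<xi>" "\<forall>i<n. (T ^^ i) x \<in> c ((T ^^ i) x)" using c TX x by auto
    have "X \<inter> (\<Inter>i<n. (T ^^ i) -` c ((T ^^ i) x)) = A" unfolding x(2) by (rule join[OF f(1) x(1) f(2)])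
    then have "A \<in> dyn_join X T n \<xi>"
      unfolding dyn_join_def mem_Collect_eq using f(1) by (intro exI[of _ "\<lambda>i. c ((T ^^ i) x)"] conjI) simp_all
    moreover have "x \<in> A" using x by simp
    ultimately show "A \<in> dyn_join X T n \<xi> - {{}}" by blast
  qed
qed

section \<open>Metric entropy and block entropies of shift-invariant measures\<close>

lemma measurable_shift_map:
  fixes X :: "(int \<Rightarrow> 'a::finite) set"
  assumes X: "shift_map ` X \<subseteq> X"
  shows "shift_map \<in> measurable (shift_borel X) (shift_borel X)"
proof (rule measurable_sigma_sets[where \<Omega> = X and A = "cylinder_algebra X"])
  show "sets (shift_borel X) = sigma_sets X (cylinder_algebra X)" by (rule sets_shift_borel_cylinders)
  show "cylinder_algebra X \<subseteq> Pow X" by (auto simp: cylinder_algebra_def)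
  show c: "shift_map \<in> space (shift_borel X) \<rightarrow> X" using X by auto
  fix A assume "A \<in> cylinder_algebra X"
  then obtain m S where A: "A = X \<inter> {x. window x (- int m) (int m) \<in> S}"
    by (auto simp: cylinder_algebra_def)
  have "shift_map -` A \<inter> space (shift_borel X) = X \<inter> {x. window x (- int m + 1) (int m + 1) \<in> S}"
    using c by (auto simp: A window_shift)
  then show "shift_map -` A \<inter> space (shift_borel X) \<in> sets (shift_borel X)"
    using window_in_shift_borel by simp
qed

locale shift_invariant_prob = prob_space M for M :: "(int \<Rightarrow> 'a::finite) measure" +
  fixes X :: "(int \<Rightarrow> 'a) set"
  assumes invariant: "invariant_prob X M" and shift_image: "shift_map ` X = X"
begin

lemma sets_M: "sets M = sets (shift_borel X)"
  using invariant by (simp add: invariant_prob_def)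

lemma space_M: "space M = X"
  using sets_eq_imp_space_eq[OF sets_M] by simp

lemma shift_closed: "x \<in> X \<Longrightarrow> shift_map x \<in> X"
  using shift_image by blast

lemma shift_pow_closed: "x \<in> X \<Longrightarrow> (shift_map ^^ i) x \<in> X"
  by (induction i) (auto intro: shift_closed)

lemma window_sets: "X \<inter> {x. window x a b \<in> S} \<in> sets M"
  unfolding sets_M by (rule window_in_shift_borel)

lemma measurable_shift: "shift_map \<in> measurable M M"
  using measurable_shift_map[of X] shift_image measurable_cong_sets[OF sets_M sets_M] by simp

lemma distr_shift: "distr M M shift_map = M"
proof (rule measure_eqI)
  fix A assume "A \<in> sets (distr M M shift_map)"
  then have A: "A \<in> sets M" by simp
  show "emeasure (distr M M shift_map) A = emeasure M A"
    using invariant A by (simp add: emeasure_distr[OF measurable_shift A] invariant_prob_def space_M)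
qed simp

lemma measurable_shift_pow: "shift_map ^^ i \<in> measurable M M"
proof (induction i)
  case (Suc i)
  show ?case unfolding funpow.simps(2) by (rule measurable_comp[OF Suc measurable_shift])
qed (simp add: id_def)

lemma distr_shift_pow: "distr M M (shift_map ^^ i) = M"
proof (induction i)
  case 0 then show ?case by (simp add: id_def distr_id)
next
  case (Suc i)
  have "distr M M (shift_map ^^ Suc i) = distr (distr M M (shift_map ^^ i)) M shift_map"
    by (simp add: distr_distr[OF measurable_shift measurable_shift_pow])
  then show ?case using Suc distr_shift by (simp add: comp_def)
qed

lemma simple_function_shift:
  assumes "simple_function M f" shows "simple_function M (\<lambda>x. f ((shift_map ^^ i) x))"
  unfolding simple_function_def
proof (intro conjI ballI)
  have "(\<lambda>x. f ((shift_map ^^ i) x)) ` space M \<subseteq> f ` space M"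
    using shift_pow_closed by (auto simp: space_M)
  then show "finite ((\<lambda>x. f ((shift_map ^^ i) x)) ` space M)"
    using simple_functionD(1)[OF assms] finite_subset by blast
  fix y
  have "(\<lambda>x. f ((shift_map ^^ i) x)) -` {y} \<inter> space M = (shift_map ^^ i) -` (f -` {y} \<inter> space M) \<inter> space M"
    using shift_pow_closed by (auto simp: space_M)
  then show "(\<lambda>x. f ((shift_map ^^ i) x)) -` {y} \<inter> space M \<in> sets M"
    using measurable_sets[OF measurable_shift_pow simple_functionD(2)[OF assms]] by simp
qed

lemma integral_shift:
  fixes h :: "(int \<Rightarrow> 'a) \<Rightarrow> real"
  assumes "h \<in> borel_measurable M"
  shows "(\<integral>x. h ((shift_map ^^ i) x) \<partial>M) = (\<integral>x. h x \<partial>M)"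
  using integral_distr[OF measurable_shift_pow assms, of i] distr_shift_pow[of i] by simp

lemma simple_window: "simple_function M (\<lambda>x. window x a b)"
  unfolding simple_function_def
proof (intro conjI ballI)
  have "(\<lambda>x. window x a b) ` space M \<subseteq> {v. set v \<subseteq> UNIV \<and> length v = nat (b - a + 1)}" by auto
  then show "finite ((\<lambda>x. window x a b) ` space M)"
    by (rule finite_subset) (rule finite_lists_length_eq, simp)
  fix v
  have "(\<lambda>x. window x a b) -` {v} \<inter> space M = X \<inter> {x. window x a b \<in> {v}}" by (auto simp: space_M)
  then show "(\<lambda>x. window x a b) -` {v} \<inter> space M \<in> sets M" using window_sets[of a b "{v}"] by argo
qed

text \<open>The powers of the shift move windows only forward, so for negative \<open>a\<close> the
  window at \<open>a\<close> is carried forward to 0 instead.\<close>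

lemma integral_window:
  fixes h :: "'a list \<Rightarrow> real"
  shows "(\<integral>x. h (window x a (a + k)) \<partial>M) = (\<integral>x. h (window x 0 k) \<partial>M)"
proof -
  have *: "(\<integral>x. h (window x (a + int i) (a + int i + k)) \<partial>M) = (\<integral>x. h (window x a (a + k)) \<partial>M)" for a i
  proof -
    have "(\<lambda>x. h (window x a (a + k))) \<in> borel_measurable M"
      using borel_measurable_integrable integrable_simple simple_window by blast
    from integral_shift[OF this, of i] show ?thesis by (simp add: window_shift_pow algebra_simps)
  qed
  show ?thesis
  proof (cases "a \<ge> 0")
    case True
    then show ?thesis using *[of 0 "nat a"] by simp
  next
    case False
    then show ?thesis using *[of a "nat (- a)"] by simp
  qed
qed

lemma fibre_prob_window:
  "fibre_prob M (\<lambda>x. window x a (a + k)) v = fibre_prob M (\<lambda>x. window x 0 k) v"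
proof -
  have *: "(\<integral>x. (if window x b c = v then 1 else 0) \<partial>M) = fibre_prob M (\<lambda>x. window x b c) v" for b c
  proof -
    have "(\<integral>x. (if window x b c = v then 1 else 0) \<partial>M) = (\<integral>x. indicator ((\<lambda>x. window x b c) -` {v} \<inter> space M) x \<partial>M)"
      by (rule Bochner_Integration.integral_cong) auto
    also have "\<dots> = prob ((\<lambda>x. window x b c) -` {v} \<inter> space M)"
      using integral_indicator simple_functionD(2)[OF simple_window[of b c], of "{v}"] by (simp add: Int_absorb2)
    finally show ?thesis by (simp add: fibre_prob_def)
  qed
  show ?thesis using integral_window[of "\<lambda>u. if u = v then 1 else 0" a k] unfolding * .
qed

section \<open>Block entropies and names with respect to a partition\<close>

definition block_entropy :: "nat \<Rightarrow> real" where
  "block_entropy n = fun_entropy M (\<lambda>x. window x 0 (int n - 1))"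

lemma class_map:
  assumes "\<xi> \<in> finite_measurable_partitions M"
  obtains c where "\<And>x. x \<in> X \<Longrightarrow> c x \<in> \<xi> \<and> x \<in> c x" "simple_function M c"
    "\<And>x A. x \<in> X \<Longrightarrow> A \<in> \<xi> \<Longrightarrow> x \<in> A \<Longrightarrow> c x = A"
proof -
  have part: "finite \<xi>" "\<xi> \<subseteq> sets M" "partition_on X \<xi>"
    using assms by (auto simp: finite_measurable_partitions_def space_M)
  then have "\<forall>x\<in>X. \<exists>A. A \<in> \<xi> \<and> x \<in> A" by (auto simp: partition_on_def)
  then obtain c where c: "\<And>x. x \<in> X \<Longrightarrow> c x \<in> \<xi> \<and> x \<in> c x" by metis
  have uni: "c x = A" if "x \<in> X" "A \<in> \<xi>" "x \<in> A" for x A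
    using part(3) c[OF that(1)] that by (auto simp: partition_on_def disjoint_def)
  have "simple_function M c"
    unfolding simple_function_def
  proof (intro conjI ballI)
    have "c ` space M \<subseteq> \<xi>" using c by (auto simp: space_M)
    then show "finite (c ` space M)" using part(1) finite_subset by blast
    fix A assume "A \<in> c ` space M"
    then have "A \<in> \<xi>" using c by (auto simp: space_M)
    moreover from \<open>A \<in> \<xi>\<close> have "A \<subseteq> X" using part(2) sets.sets_into_space space_M by blast
    ultimately have "c -` {A} \<inter> space M = A" unfolding space_M using c uni by blast
    then show "c -` {A} \<inter> space M \<in> sets M" using part(2) \<open>A \<in> \<xi>\<close> by auto
  qed
  then show ?thesis using that c uni by blast
qed

lemma partition_entropy_dyn_join:
  assumes part: "\<xi> \<in> finite_measurable_partitions M"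
    and c: "\<And>x. x \<in> X \<Longrightarrow> c x \<in> \<xi> \<and> x \<in> c x" "simple_function M c"
  shows "partition_entropy M (dyn_join (space M) shift_map n \<xi>)
    = fun_entropy M (\<lambda>x. \<lambda>i\<in>{..<n}. c ((shift_map ^^ i) x))"
proof (rule partition_entropy_fibres)
  have p: "partition_on X \<xi>" using part by (simp add: finite_measurable_partitions_def space_M)
  show "dyn_join (space M) shift_map n \<xi> - {{}} = (\<lambda>y. (\<lambda>x. \<lambda>i\<in>{..<n}. c ((shift_map ^^ i) x)) -` {y} \<inter> space M)
      ` (\<lambda>x. \<lambda>i\<in>{..<n}. c ((shift_map ^^ i) x)) ` space M"
    unfolding space_M using p shift_closed c(1) by (rule dyn_join_fibres)
  show "finite ((\<lambda>x. \<lambda>i\<in>{..<n}. c ((shift_map ^^ i) x)) ` space M)"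
    by (rule simple_functionD(1)[OF simple_function_restrict]) (rule simple_function_shift[OF c(2)])
qed

text \<open>Each class is approximated by a cylinder set, and \<open>g\<close> guesses a class whose
  cylinder set contains the observed window. If the guess is wrong, the point is missed by the
  approximation of its own class or wrongly accepted by that of the guessed class, so it lies in one
  of the symmetric differences.\<close>

lemma class_map_approx:
  assumes part: "\<xi> \<in> finite_measurable_partitions M"
    and c: "\<And>x. x \<in> X \<Longrightarrow> c x \<in> \<xi> \<and> x \<in> c x"
      "\<And>x A. x \<in> X \<Longrightarrow> A \<in> \<xi> \<Longrightarrow> x \<in> A \<Longrightarrow> c x = A"
    and "e > 0"
  shows "\<exists>m::nat. \<exists>g. (\<forall>v. g v \<in> \<xi>) \<and> prob {x \<in> X. c x \<noteq> g (window x (- int m) (int m))} \<le> e"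
proof -
  have fin: "finite \<xi>" and sets: "\<xi> \<subseteq> sets M"
    using part by (auto simp: finite_measurable_partitions_def)
  have "X \<noteq> {}" using not_empty by (simp add: space_M)
  then have ne: "\<xi> \<noteq> {}" using c(1) by blast
  \<comment> \<open>The error \<open>e\<close> is shared equally among the classes.\<close>
  define d where "d = e / real (card \<xi>)"
  have "card \<xi> > 0" using ne fin by (simp add: card_gt_0_iff)
  then have d: "d > 0" using \<open>e > 0\<close> by (simp add: d_def)
  have "\<forall>A\<in>\<xi>. \<exists>B\<in>cylinder_algebra X. prob ((A - B) \<union> (B - A)) < d"
    using cylinder_algebra_approx[OF sets_M finite_measure_axioms _ d] sets by blast
  then obtain B where B: "\<And>A. A \<in> \<xi> \<Longrightarrow> B A \<in> cylinder_algebra X" "\<And>A. A \<in> \<xi> \<Longrightarrow> prob ((A - B A) \<union> (B A - A)) < d"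
    by metis
  have "\<forall>A\<in>\<xi>. \<exists>m0. \<forall>m\<ge>m0. \<exists>S. B A = X \<inter> {x. window x (- int m) (int m) \<in> S}"
    using cylinder_algebra_mono B(1) by metis
  then obtain m0 where m0: "\<And>A m. A \<in> \<xi> \<Longrightarrow> m \<ge> m0 A \<Longrightarrow> \<exists>S. B A = X \<inter> {x. window x (- int m) (int m) \<in> S}"
    by metis
  define m where "m = Max (m0 ` \<xi>)"
  have "\<forall>A\<in>\<xi>. \<exists>S. B A = X \<inter> {x. window x (- int m) (int m) \<in> S}"
    using m0 fin by (auto simp: m_def)
  then obtain S where S: "\<And>A. A \<in> \<xi> \<Longrightarrow> B A = X \<inter> {x. window x (- int m) (int m) \<in> S A}" by metis
  \<comment> \<open>The default class is harmless: if no \<open>S A\<close> contains the window, the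
    point lies outside the approximation of its own class and is already counted as an
    error.\<close>
  define g where "g = (\<lambda>v. if \<exists>A\<in>\<xi>. v \<in> S A then SOME A. A \<in> \<xi> \<and> v \<in> S A else SOME A. A \<in> \<xi>)"
  have g: "g v \<in> \<xi>" for v
  proof (cases "\<exists>A\<in>\<xi>. v \<in> S A")
    case True
    then show ?thesis using someI_ex[of "\<lambda>A. A \<in> \<xi> \<and> v \<in> S A"] by (auto simp: g_def)
  next
    case False
    then show ?thesis using ne by (auto simp: g_def intro: some_in_eq[THEN iffD2])
  qed
  have gS: "v \<in> S (g v)" if "A \<in> \<xi>" "v \<in> S A" for v A
    using that someI_ex[of "\<lambda>A. A \<in> \<xi> \<and> v \<in> S A"] by (auto simp: g_def)
  have sub: "{x \<in> X. c x \<noteq> g (window x (- int m) (int m))} \<subseteq> (\<Union>A\<in>\<xi>. (A - B A) \<union> (B A - A))"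
  proof
    fix x assume "x \<in> {x \<in> X. c x \<noteq> g (window x (- int m) (int m))}"
    then have x: "x \<in> X" "c x \<noteq> g (window x (- int m) (int m))" by auto
    show "x \<in> (\<Union>A\<in>\<xi>. (A - B A) \<union> (B A - A))"
    proof (cases "x \<in> B (c x)")
      case False
      then show ?thesis using c(1)[OF x(1)] by blast
    next
      case True
      let ?A = "g (window x (- int m) (int m))"
      have "window x (- int m) (int m) \<in> S (c x)" using True S c(1)[OF x(1)] by blast
      then have "window x (- int m) (int m) \<in> S ?A" using gS c(1)[OF x(1)] by blast
      then have "x \<in> B ?A" using S[OF g] x(1) by blast
      moreover have "x \<notin> ?A" using c(2)[OF x(1) g] x(2) by blast
      ultimately show ?thesis using g by blast
    qed
  qed
  have BM: "B A \<in> sets M" if "A \<in> \<xi>" for A using S[OF that] window_sets by simp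
  have sd: "(A - B A) \<union> (B A - A) \<in> sets M" if "A \<in> \<xi>" for A using BM sets that by blast
  have "prob {x \<in> X. c x \<noteq> g (window x (- int m) (int m))} \<le> prob (\<Union>A\<in>\<xi>. (A - B A) \<union> (B A - A))"
    using sub fin sd by (intro finite_measure_mono) auto
  also have "\<dots> \<le> (\<Sum>A\<in>\<xi>. prob ((A - B A) \<union> (B A - A)))"
    using finite_measure_subadditive_finite[of \<xi> "\<lambda>A. (A - B A) \<union> (B A - A)"] fin sd by blast
  also have "\<dots> \<le> (\<Sum>A\<in>\<xi>. d)" using B by (intro sum_mono) (auto intro: less_imp_le)
  also have "\<dots> = e" using \<open>card \<xi> > 0\<close> by (simp add: d_def)
  finally show ?thesis using g by blast
qed

end

section \<open>Metric entropy compared with block entropies\<close>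

context shift_invariant_prob
begin

text \<open>Gibbs' inequality with a subprobability that first draws \<open>r\<close> independent blocks of length
  \<open>n0\<close>, covering the window from \<open>- m\<close> to \<open>n + m - 1\<close>, and then draws each class independently,
  favouring the guess \<open>g\<close> made from the blocks. The penalty for a wrong guess is \<open>\<kappa>\<close>.\<close>

lemma name_entropy_le:
  fixes n0 m n r :: nat and t \<kappa> \<epsilon> :: real and c :: "(int \<Rightarrow> 'a) \<Rightarrow> 'b" and g :: "'a list \<Rightarrow> 'b"
  assumes n0: "n0 \<ge> 1" and r: "r * n0 \<ge> n + 2 * m"
    and c: "simple_function M c" "\<And>x. x \<in> X \<Longrightarrow> c x \<in> \<xi>" and \<xi>: "finite \<xi>"
    and \<kappa>: "\<kappa> \<ge> 0" "1 + real (card \<xi>) * exp (- \<kappa>) \<le> exp t"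
    and \<epsilon>: "prob {x \<in> X. c x \<noteq> g (window x (- int m) (int m))} \<le> \<epsilon>"
  shows "fun_entropy M (\<lambda>x. \<lambda>i\<in>{..<n}. c ((shift_map ^^ i) x))
    \<le> real r * block_entropy n0 + real n * (t + \<kappa> * \<epsilon>)"
proof -
  define P where "P = fibre_prob M (\<lambda>x. window x 0 (int n0 - 1))"
  define wd where "wd = (\<lambda>(x :: int \<Rightarrow> 'a) j. window x (int j * int n0 - int m) (int j * int n0 - int m + (int n0 - 1)))"
  define N where "N = (\<lambda>x. \<lambda>i\<in>{..<n}. c ((shift_map ^^ i) x))"
  define U where "U = (\<lambda>x. \<lambda>j\<in>{..<r}. wd x j)"
  define b where "b = (\<lambda>(x :: int \<Rightarrow> 'a) i. g (window x (int i - int m) (int i + int m)))"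
  \<comment> \<open>The guesses are recovered from the blocks alone: any point with the same blocks
    will do, because all windows that the guesses read lie inside the blocks.\<close>
  define \<beta> where "\<beta> = (\<lambda>u. b (inv_into X U u))"
  \<comment> \<open>The code length of one symbol is \<open>t\<close> for a correct guess and
    \<open>t + \<kappa>\<close> for a wrong one. The assumption on \<open>\<kappa>\<close> is the
    Kraft inequality for these lengths, as \<open>pen_sum\<close> confirms.\<close>
  define pen where "pen = (\<lambda>a (b :: 'b). t + (if a = b then 0 else \<kappa>))"
  define Q where "Q = (\<lambda>(a, u). (\<Prod>j<r. P (u j)) * (\<Prod>i<n. exp (- pen (a i) (\<beta> u i))))"
  define L where "L = (\<lambda>(a, u). (\<Sum>j<r. - ln (P (u j))) + (\<Sum>i<n. pen (a i) (\<beta> u i)))"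
  define W where "W = {v :: 'a list. set v \<subseteq> UNIV \<and> length v = n0}"
  let ?F = "\<lambda>x. (N x, U x)"

  have P0: "P v \<ge> 0" for v by (simp add: P_def fibre_prob_nonneg)
  have finW: "finite W" unfolding W_def by (rule finite_lists_length_eq) simp
  have wdW: "wd x j \<in> W" for x j by (simp add: W_def wd_def)
  have Pwd: "fibre_prob M (\<lambda>x. wd x j) v = P v" for j v
    unfolding wd_def P_def using fibre_prob_window by simp
  have simple_wd: "simple_function M (\<lambda>x. wd x j)" for j
    unfolding wd_def by (rule simple_window)
  have simple_N: "simple_function M N"
    unfolding N_def by (rule simple_function_restrict) (rule simple_function_shift[OF c(1)])
  have simple_U: "simple_function M U"
    unfolding U_def by (rule simple_function_restrict) (rule simple_wd)
  have F: "simple_function M ?F" by (rule simple_function_Pair[OF simple_N simple_U])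

  have \<beta>: "\<beta> (U x) i = b x i" if x: "x \<in> X" and i: "i < n" for x i
  proof -
    define y where "y = inv_into X U (U x)"
    have y: "U y = U x" unfolding y_def using x f_inv_into_f[of "U x" U X] by blast
    have "y p = x p" if p: "p \<in> {int i - int m..int i + int m}" for p
    proof -
      \<comment> \<open>The blocks start at \<open>- m\<close> and have length \<open>n0\<close>, so
        this is the number of the block that contains position \<open>p\<close>.\<close>
      define j where "j = nat ((p + int m) div int n0)"
      have nn: "0 \<le> p + int m" using p by simp
      then have j: "int j = (p + int m) div int n0" using n0 by (simp add: j_def pos_imp_zdiv_nonneg_iff)
      have "int (n + 2 * m) \<le> int (r * n0)" using r by (simp only: of_nat_le_iff)
      then have "p + int m < int (r * n0)" using p i by simp
      then have "(p + int m) div int n0 < int r"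
      proof (rule contrapos_pp)
        assume "\<not> (p + int m) div int n0 < int r"
        then have "int r * int n0 \<le> (p + int m) div int n0 * int n0" by (intro mult_right_mono) auto
        also have "\<dots> \<le> p + int m" using n0 by (simp flip: minus_mod_eq_div_mult)
        finally show "\<not> p + int m < int (r * n0)" by simp
      qed
      then have jr: "j < r" using j by simp
      have "wd y j = wd x j" using y jr unfolding U_def by (metis lessThan_iff restrict_apply)
      moreover have "p \<in> {int j * int n0 - int m..int j * int n0 - int m + (int n0 - 1)}"
      proof -
        have "(p + int m) = int j * int n0 + (p + int m) mod int n0" unfolding j by (simp add: mult.commute)
        moreover have "0 \<le> (p + int m) mod int n0" "(p + int m) mod int n0 < int n0" using n0 by auto
        ultimately show ?thesis by auto
      qed
      ultimately show ?thesis unfolding wd_def window_eq_iff by blast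
    qed
    then have "window y (int i - int m) (int i + int m) = window x (int i - int m) (int i + int m)"
      unfolding window_eq_iff by blast
    then show ?thesis by (simp add: \<beta>_def b_def y_def)
  qed

  have Q0: "Q y \<ge> 0" for y by (auto simp: Q_def P0 intro!: mult_nonneg_nonneg prod_nonneg split: prod.split)
  have pen_sum: "(\<Sum>a\<in>\<xi>. exp (- pen a b)) \<le> 1" for b
  proof -
    have "(\<Sum>a\<in>\<xi>. exp (- pen a b)) \<le> (\<Sum>a\<in>\<xi>. (if a = b then exp (- t) else 0) + exp (- t) * exp (- \<kappa>))"
      unfolding pen_def by (intro sum_mono) (auto simp: exp_add[symmetric] exp_minus[symmetric])
    also have "\<dots> = (if b \<in> \<xi> then exp (- t) else 0) + exp (- t) * (real (card \<xi>) * exp (- \<kappa>))"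
      using \<xi> by (simp add: sum.distrib)
    also have "\<dots> \<le> exp (- t) * (1 + real (card \<xi>) * exp (- \<kappa>))" by (simp add: algebra_simps)
    also have "\<dots> \<le> exp (- t) * exp t" using \<kappa>(2) by (intro mult_left_mono) auto
    also have "\<dots> = 1" by (simp add: exp_minus)
    finally show ?thesis .
  qed
  have sumQ: "(\<Sum>y\<in>?F ` space M. Q y) \<le> 1"
  proof -
    let ?A = "Pi\<^sub>E {..<n} (\<lambda>_. \<xi>)" and ?B = "Pi\<^sub>E {..<r} (\<lambda>_. W)"
    have pen_prod: "(\<Prod>i<n. \<Sum>a\<in>\<xi>. exp (- pen a (v i))) = (\<Sum>a\<in>?A. \<Prod>i<n. exp (- pen (a i) (v i)))" for v
      by (rule prod_sum_PiE) (use \<xi> in simp_all)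
    have fin: "finite ?A" "finite ?B" using \<xi> finW by (auto intro!: finite_PiE)
    have "N x \<in> ?A" if "x \<in> X" for x
      unfolding N_def using that by (simp only: restrict_PiE_iff) (auto intro: c(2) shift_pow_closed)
    moreover have "U x \<in> ?B" for x
      unfolding U_def by (simp only: restrict_PiE_iff) (auto intro: wdW)
    ultimately have sub: "?F ` space M \<subseteq> ?A \<times> ?B" by (auto simp: space_M)
    \<comment> \<open>On the full product of names and blocks the sum factorises: for fixed blocks
      the names contribute a product of Kraft sums, and the blocks then contribute a product of
      total masses.\<close>
    have "(\<Sum>y\<in>?F ` space M. Q y) \<le> (\<Sum>y\<in>?A \<times> ?B. Q y)"
      by (rule sum_mono2) (use fin sub Q0 in auto)
    also have "\<dots> = (\<Sum>u\<in>?B. \<Sum>a\<in>?A. Q (a, u))"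
      by (subst sum.swap) (simp add: sum.cartesian_product)
    also have "\<dots> = (\<Sum>u\<in>?B. (\<Prod>j<r. P (u j)) * (\<Sum>a\<in>?A. \<Prod>i<n. exp (- pen (a i) (\<beta> u i))))"
      by (simp add: Q_def sum_distrib_left)
    also have "\<dots> = (\<Sum>u\<in>?B. (\<Prod>j<r. P (u j)) * (\<Prod>i<n. \<Sum>a\<in>\<xi>. exp (- pen a (\<beta> u i))))"
      by (simp only: pen_prod)
    also have "\<dots> \<le> (\<Sum>u\<in>?B. (\<Prod>j<r. P (u j)) * 1)"
    proof (intro sum_mono mult_left_mono prod_nonneg P0 ballI)
      fix u
      show "(\<Prod>i<n. \<Sum>a\<in>\<xi>. exp (- pen a (\<beta> u i))) \<le> 1"
        by (intro prod_le_1 conjI pen_sum sum_nonneg) simp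
    qed
    also have "\<dots> = (\<Prod>j<r. \<Sum>v\<in>W. P v)"
      using prod_sum_PiE[of "{..<r}" "\<lambda>_. W" "\<lambda>_. P"] finW by simp
    also have "(\<Sum>v\<in>W. P v) = 1"
      unfolding P_def by (rule sum_fibre_prob[OF simple_window finW]) (auto simp: W_def)
    finally show ?thesis by simp
  qed
  have LQ: "exp (- L y) \<le> Q y" if y: "y \<in> ?F ` space M" "fibre_prob M ?F y > 0" for y
  proof -
    obtain x where x: "x \<in> X" "y = (N x, U x)" using y(1) by (auto simp: space_M)
    \<comment> \<open>A pair of positive mass has blocks of positive mass, so that exp cancels every
      logarithm.\<close>
    have "P (U x j) > 0" if j: "j < r" for j
    proof -
      have "fibre_prob M ?F y \<le> fibre_prob M (\<lambda>x. wd x j) ((\<lambda>(a, u). u j) y)"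
        by (rule fibre_prob_le_compose[OF F]) (use j in \<open>auto simp: U_def\<close>)
      then show ?thesis using y(2) by (simp add: Pwd x(2))
    qed
    then have "exp (- L y) = Q y"
      by (simp add: L_def Q_def x(2) exp_diff exp_add exp_sum flip: sum_negf)
    then show ?thesis by simp
  qed
  \<comment> \<open>The code describes names together with blocks; projecting to \<open>fst\<close>
    keeps only the names.\<close>
  have "fun_entropy M N \<le> (\<integral>x. L (?F x) \<partial>M)"
    by (rule gibbs_inequality[where \<phi> = fst, OF F]) (use Q0 sumQ LQ in auto)
  also have "\<dots> = (\<integral>x. (\<Sum>j<r. - ln (P (wd x j))) + (\<Sum>i<n. pen (c ((shift_map ^^ i) x)) (b x i)) \<partial>M)"
    by (rule Bochner_Integration.integral_cong[OF refl])
      (auto simp: L_def space_M \<beta> U_def[symmetric] N_def intro!: arg_cong2[of _ _ _ _ "(+)"] sum.cong, auto simp: U_def)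
  also have "\<dots> = (\<Sum>j<r. \<integral>x. - ln (P (wd x j)) \<partial>M) + (\<Sum>i<n. \<integral>x. pen (c ((shift_map ^^ i) x)) (b x i) \<partial>M)"
  proof -
    have i1: "integrable M (\<lambda>x. - ln (P (wd x j)))" for j by (rule integrable_simple[OF simple_wd])
    have i2: "integrable M (\<lambda>x. pen (c ((shift_map ^^ i) x)) (b x i))" for i
      unfolding b_def using integrable_simple[OF simple_function_Pair[OF simple_function_shift[OF c(1)] simple_window],
        of "\<lambda>(a, v). pen a (g v)"] by simp
    show ?thesis using i1 i2 by (simp add: Bochner_Integration.integral_add Bochner_Integration.integral_sum)
  qed
  also have "(\<Sum>j<r. \<integral>x. - ln (P (wd x j)) \<partial>M) = real r * block_entropy n0"
  proof -
    have "(\<integral>x. - ln (P (wd x j)) \<partial>M) = block_entropy n0" for j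
      using integral_window[of "\<lambda>v. - ln (P v)" "int j * int n0 - int m" "int n0 - 1"]
        fun_entropy_integral[OF simple_window, of 0 "int n0 - 1"]
      by (simp add: wd_def block_entropy_def P_def)
    then show ?thesis by simp
  qed
  also have "(\<Sum>i<n. \<integral>x. pen (c ((shift_map ^^ i) x)) (b x i) \<partial>M) \<le> real n * (t + \<kappa> * \<epsilon>)"
  proof -
    define D where "D = {x \<in> X. c x \<noteq> g (window x (- int m) (int m))}"
    have simple: "simple_function M (\<lambda>x. (c x, window x (- int m) (int m)))"
      by (rule simple_function_Pair[OF c(1) simple_window])
    have D: "D \<in> sets M"
    proof -
      have "simple_function M (\<lambda>x. c x \<noteq> g (window x (- int m) (int m)))"
        using simple_function_compose[OF simple, of "\<lambda>(a, v). a \<noteq> g v"] by (simp add: comp_def)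
      from simple_functionD(2)[OF this, of "{True}"] show ?thesis
        by (simp add: D_def space_M vimage_def Int_def conj_commute)
    qed
    have "(\<integral>x. pen (c ((shift_map ^^ i) x)) (b x i) \<partial>M) \<le> t + \<kappa> * \<epsilon>" for i
    proof -
      \<comment> \<open>The guess for symbol \<open>i\<close> reads the window around 0 of the point
        shifted \<open>i\<close> times, so by invariance every symbol costs as much on average as
        symbol 0.\<close>
      have "(\<integral>x. pen (c ((shift_map ^^ i) x)) (b x i) \<partial>M) = (\<integral>x. pen (c x) (g (window x (- int m) (int m))) \<partial>M)"
        using integral_shift[of "\<lambda>x. pen (c x) (g (window x (- int m) (int m)))" i]
          borel_measurable_integrable[OF integrable_simple[OF simple, of "\<lambda>(a, v). pen a (g v)"]]
        by (simp add: window_shift_pow b_def algebra_simps)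
      also have "\<dots> = (\<integral>x. t + \<kappa> * indicator D x \<partial>M)"
        by (rule Bochner_Integration.integral_cong) (auto simp: pen_def D_def space_M)
      also have "\<dots> = t + \<kappa> * prob D"
        using D by (subst Bochner_Integration.integral_add)
          (auto simp: prob_space emeasure_eq_measure intro!: integrable_mult_right integrable_real_indicator)
      also have "\<dots> \<le> t + \<kappa> * \<epsilon>" using \<kappa>(1) \<epsilon> by (auto simp: D_def intro: mult_left_mono)
      finally show ?thesis .
    qed
    then have "(\<Sum>i<n. \<integral>x. pen (c ((shift_map ^^ i) x)) (b x i) \<partial>M) \<le> (\<Sum>i<n. t + \<kappa> * \<epsilon>)"
      by (intro sum_mono)
    then show ?thesis by simp
  qed
  finally have "fun_entropy M N \<le> real r * block_entropy n0 + real n * (t + \<kappa> * \<epsilon>)" by simp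
  then show ?thesis unfolding N_def .
qed

text \<open>Names of length \<open>n\<close> cost about \<open>n / n0\<close> block entropies plus
  \<open>n * (t + \<kappa> * \<epsilon>)\<close>. For a given partition the parameters are fixed in
  the order \<open>t\<close>, \<open>\<kappa>\<close>, \<open>\<epsilon>\<close>, \<open>m\<close>;
  only then does \<open>n\<close> tend to infinity, which removes the cost of the boundary of width
  \<open>m\<close>. The block length \<open>n0\<close> stays fixed throughout.\<close>

theorem metric_entropy_le:
  assumes n0: "n0 \<ge> 1"
  shows "metric_entropy M shift_map \<le> ereal (block_entropy n0 / real n0)"
  unfolding metric_entropy_def
proof (rule SUP_least)
  fix \<xi> assume \<xi>: "\<xi> \<in> finite_measurable_partitions M"
  obtain c where c: "\<And>x. x \<in> X \<Longrightarrow> c x \<in> \<xi> \<and> x \<in> c x" "simple_function M c"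
    "\<And>x A. x \<in> X \<Longrightarrow> A \<in> \<xi> \<Longrightarrow> x \<in> A \<Longrightarrow> c x = A"
    using class_map[OF \<xi>] by blast
  have fin: "finite \<xi>" using \<xi> by (simp add: finite_measurable_partitions_def)
  let ?H = "\<lambda>n. partition_entropy M (dyn_join (space M) shift_map n \<xi>)"
  show "limsup (\<lambda>n. ereal (?H n / real n)) \<le> ereal (block_entropy n0 / real n0)"
  proof (rule ereal_le_epsilon2)
    fix e :: real assume e: "e > 0"
    define t where "t = e / 2"
    have t: "exp t > 1" using e by (simp add: t_def)
    define k where "k = real (card \<xi>)"
    \<comment> \<open>With this choice \<open>k * exp (- \<kappa>)\<close> is
      \<open>exp t - 1\<close> times a fraction that is at most 1, which gives the Kraft
      condition.\<close>
    define \<kappa> where "\<kappa> = ln (1 + k / (exp t - 1))"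
    have q: "0 \<le> k / (exp t - 1)" using t by (simp add: k_def)
    then have \<kappa>0: "\<kappa> \<ge> 0" by (simp add: \<kappa>_def)
    have "exp (- \<kappa>) = 1 / (1 + k / (exp t - 1))" using q by (simp add: \<kappa>_def exp_minus inverse_eq_divide)
    then have "k * exp (- \<kappa>) = (exp t - 1) * (k / (exp t - 1 + k))"
      using t by (simp add: field_simps)
    also have "\<dots> \<le> (exp t - 1) * 1"
    proof (intro mult_left_mono)
      have "exp t - 1 + k > 0" "k \<le> exp t - 1 + k" using t unfolding k_def by linarith+
      then show "k / (exp t - 1 + k) \<le> 1" by (subst divide_le_eq_1_pos)
    qed (use t in simp)
    finally have \<kappa>1: "1 + k * exp (- \<kappa>) \<le> exp t" by simp
    \<comment> \<open>Wrong guesses then cost at most \<open>e / 2\<close> per symbol, the other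
      half of \<open>e\<close> being \<open>t\<close>; the added 1 keeps the denominator
      positive.\<close>
    define \<epsilon> where "\<epsilon> = e / (2 * (\<kappa> + 1))"
    have \<epsilon>: "\<epsilon> > 0" using e \<kappa>0 by (simp add: \<epsilon>_def)
    obtain m g where mg: "prob {x \<in> X. c x \<noteq> g (window x (- int m) (int m))} \<le> \<epsilon>"
      using class_map_approx[OF \<xi> c(1,3) \<epsilon>] by blast
    have \<kappa>\<epsilon>: "\<kappa> * \<epsilon> \<le> e / 2" using e \<kappa>0 by (simp add: \<epsilon>_def field_simps)
    let ?h = "block_entropy n0"
    have h0: "?h \<ge> 0" unfolding block_entropy_def
      by (rule fun_entropy_ge[OF simple_window]) (simp add: fibre_prob_def)
    have bound: "?H n / real n \<le> ?h / real n0 + e + (2 * real m / real n0 + 1) * ?h / real n" if n: "n \<ge> 1" for n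
    proof -
      \<comment> \<open>The extra block covers the remainder of the division, so that the blocks
        reach from \<open>- m\<close> at least to \<open>n + m - 1\<close>.\<close>
      define r where "r = (n + 2 * m) div n0 + 1"
      have "n + 2 * m < n0 + (n + 2 * m) div n0 * n0" using n0 by (intro dividend_less_div_times) simp
      then have r: "n + 2 * m \<le> r * n0" unfolding r_def add_mult_distrib by simp
      have "real ((n + 2 * m) div n0) \<le> real (n + 2 * m) / real n0"         using of_nat_mono[OF div_times_less_eq_dividend[of "n + 2 * m" n0], where 'a = real] n0
        by (simp add: pos_le_divide_eq)
      then have r': "real r \<le> real n / real n0 + (2 * real m / real n0 + 1)" by (simp add: r_def add_divide_distrib)
      have "?H n = fun_entropy M (\<lambda>x. \<lambda>i\<in>{..<n}. c ((shift_map ^^ i) x))"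
        using c(1,2) by (rule partition_entropy_dyn_join[OF \<xi>])
      also have "\<dots> \<le> real r * ?h + real n * (t + \<kappa> * \<epsilon>)"
        by (rule name_entropy_le[OF n0 r c(2) _ fin \<kappa>0 _ mg]) (use c(1) \<kappa>1 in \<open>auto simp: k_def\<close>)
      also have "\<dots> \<le> (real n / real n0 + (2 * real m / real n0 + 1)) * ?h + real n * e"
        using r' h0 \<kappa>\<epsilon> by (intro add_mono mult_right_mono mult_left_mono) (auto simp: t_def)
      finally have "?H n / real n \<le> ((real n / real n0 + (2 * real m / real n0 + 1)) * ?h + real n * e) / real n"
        by (intro divide_right_mono) auto
      also have "\<dots> = ?h / real n0 + e + (2 * real m / real n0 + 1) * ?h / real n"
        using n n0 by (simp add: field_simps)
      finally show ?thesis .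
    qed
    have "(\<lambda>n. (2 * real m / real n0 + 1) * ?h / real n) \<longlonglongrightarrow> 0"
      by (rule lim_const_over_n)
    then have "(\<lambda>n. ?h / real n0 + e + (2 * real m / real n0 + 1) * ?h / real n) \<longlonglongrightarrow> ?h / real n0 + e + 0"
      by (intro tendsto_add tendsto_const)
    then have "(\<lambda>n. ereal (?h / real n0 + e + (2 * real m / real n0 + 1) * ?h / real n)) \<longlonglongrightarrow> ereal (?h / real n0 + e)"
      by simp
    then have "limsup (\<lambda>n. ereal (?h / real n0 + e + (2 * real m / real n0 + 1) * ?h / real n)) = ereal (?h / real n0 + e)"
      by (intro lim_imp_Limsup) auto
    moreover have "limsup (\<lambda>n. ereal (?H n / real n))
        \<le> limsup (\<lambda>n. ereal (?h / real n0 + e + (2 * real m / real n0 + 1) * ?h / real n))"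
      by (rule Limsup_mono) (use bound in \<open>auto simp: eventually_sequentially intro!: exI[of _ 1]\<close>)
    ultimately show "limsup (\<lambda>n. ereal (?H n / real n)) \<le> ereal (?h / real n0) + ereal e" by simp
  qed
qed

text \<open>For the partition by the coordinate at 0, names of length \<open>n\<close> and windows
  of length \<open>n\<close> determine each other, so the entropies of its joins are the block
  entropies.\<close>

lemma metric_entropy_ge:
  assumes b: "\<And>n. n \<ge> 1 \<Longrightarrow> block_entropy n \<ge> real n * h - c"
  shows "metric_entropy M shift_map \<ge> ereal h"
proof -
  \<comment> \<open>Only letters that occur at 0 are used, since a partition must not contain the
    empty set.\<close>
  define \<alpha> where "\<alpha> = (\<lambda>y. (\<lambda>x. x 0) -` {y} \<inter> X) ` (\<lambda>x. x 0) ` X"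
  define cl where "cl = (\<lambda>x::int \<Rightarrow> 'a. (\<lambda>x. x 0) -` {x 0} \<inter> X)"
  have ev: "(\<lambda>x. x 0) -` {y} \<inter> X = X \<inter> {x. window x 0 0 \<in> {[y]}}" for y :: 'a
    by (auto simp: window_def)
  have \<alpha>: "\<alpha> \<in> finite_measurable_partitions M"
    unfolding finite_measurable_partitions_def mem_Collect_eq
  proof (intro conjI)
    show "finite \<alpha>" by (simp add: \<alpha>_def)
    show "\<alpha> \<subseteq> sets M" unfolding \<alpha>_def ev using window_sets by blast
    show "partition_on (space M) \<alpha>"
      unfolding partition_on_def disjoint_def space_M \<alpha>_def by auto
  qed
  have cl: "cl x \<in> \<alpha> \<and> x \<in> cl x" if "x \<in> X" for x using that by (auto simp: cl_def \<alpha>_def)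
  have cl_eq: "cl x = cl y \<longleftrightarrow> x 0 = y 0" if "x \<in> X" "y \<in> X" for x y using that by (auto simp: cl_def)
  have "simple_function M cl"
  proof -
    have "simple_function M (\<lambda>x. (\<lambda>v. (\<lambda>x. x 0) -` {hd v} \<inter> X) (window x 0 0))"
      using simple_function_compose[OF simple_window, of "\<lambda>v. (\<lambda>x. x 0) -` {hd v} \<inter> X" 0 0] by (simp add: comp_def)
    then show ?thesis by (simp add: cl_def window_def)
  qed
  have eq: "partition_entropy M (dyn_join (space M) shift_map n \<alpha>) = block_entropy n" for n
    unfolding block_entropy_def
  proof (rule trans[OF partition_entropy_dyn_join[where c = cl] fun_entropy_fibre_cong])
    show "\<alpha> \<in> finite_measurable_partitions M" "simple_function M cl" by fact+
    show "x \<in> X \<Longrightarrow> cl x \<in> \<alpha> \<and> x \<in> cl x" for x by (rule cl)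
    fix x y assume xy: "x \<in> space M" "y \<in> space M"
    have "(\<lambda>i\<in>{..<n}. cl ((shift_map ^^ i) x)) = (\<lambda>i\<in>{..<n}. cl ((shift_map ^^ i) y))
        \<longleftrightarrow> (\<forall>i<n. cl ((shift_map ^^ i) x) = cl ((shift_map ^^ i) y))"
      by (auto simp: restrict_def fun_eq_iff)
    also have "\<dots> \<longleftrightarrow> (\<forall>i<n. x (int i) = y (int i))"
      using xy cl_eq[OF shift_pow_closed shift_pow_closed] by (simp add: space_M) (simp add: shift_pow_apply)
    also have "\<dots> \<longleftrightarrow> window x 0 (int n - 1) = window y 0 (int n - 1)"
      unfolding window_eq_iff
    proof safe
      fix i assume *: "\<forall>i<n. x (int i) = y (int i)" and i: "i \<in> {0..int n - 1}"
      then show "x i = y i" using *[rule_format, of "nat i"] by auto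
    qed auto
    finally show "((\<lambda>i\<in>{..<n}. cl ((shift_map ^^ i) x)) = (\<lambda>i\<in>{..<n}. cl ((shift_map ^^ i) y)))
      = (window x 0 (int n - 1) = window y 0 (int n - 1))" .
  qed
  have "(\<lambda>n. h - c / real n) \<longlonglongrightarrow> h - 0" by (intro tendsto_diff tendsto_const lim_const_over_n)
  then have "limsup (\<lambda>n. ereal (h - c / real n)) = ereal h" by (intro lim_imp_Limsup) auto
  moreover have "limsup (\<lambda>n. ereal (h - c / real n)) \<le> limsup (\<lambda>n. ereal (partition_entropy M (dyn_join (space M) shift_map n \<alpha>) / real n))"
    unfolding eq
  proof (rule Limsup_mono, unfold eventually_sequentially, intro exI allI impI)
    fix n :: nat assume n: "1 \<le> n"
    have "h - c / real n = (real n * h - c) / real n" using n by (simp add: field_simps)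
    also have "\<dots> \<le> block_entropy n / real n" using b[OF n] by (intro divide_right_mono) auto
    finally show "ereal (h - c / real n) \<le> ereal (block_entropy n / real n)" by simp
  qed
  moreover have "\<dots> \<le> metric_entropy M shift_map"
    unfolding metric_entropy_def by (rule SUP_upper[OF \<alpha>])
  ultimately show ?thesis by simp
qed

end

section \<open>Topological entropy of subshifts\<close>

text \<open>Points with the same value of \<open>K\<close> visit the same members of the cover up to
  time \<open>n\<close>, so one member of the join for each value of \<open>K\<close> is
  enough.\<close>

lemma dyn_join_subcover:
  assumes T: "\<And>x. x \<in> X \<Longrightarrow> T x \<in> X" and c: "\<And>x. x \<in> X \<Longrightarrow> c x \<in> \<U> \<and> x \<in> c x"
    and K: "finite (K ` X)"
      "\<And>x y i. x \<in> X \<Longrightarrow> y \<in> X \<Longrightarrow> K x = K y \<Longrightarrow> i < n \<Longrightarrow> c ((T ^^ i) x) = c ((T ^^ i) y)"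
  obtains \<V> where "\<V> \<subseteq> dyn_join X T n \<U>" "finite \<V>" "card \<V> \<le> card (K ` X)" "X \<subseteq> \<Union>\<V>"
proof -
  have TX: "(T ^^ i) x \<in> X" if "x \<in> X" for i x using that T by (induction i) auto
  define V where "V = (\<lambda>x. X \<inter> (\<Inter>i<n. (T ^^ i) -` c ((T ^^ i) x)))"
  have V_K: "V x = V y" if "x \<in> X" "y \<in> X" "K x = K y" for x y
    unfolding V_def using K(2)[OF that] by auto
  have V_eq: "V ` X = (\<lambda>k. V (inv_into X K k)) ` K ` X"
  proof -
    have "V (inv_into X K (K x)) = V x" if "x \<in> X" for x
      by (rule V_K) (use that in \<open>auto intro: inv_into_into f_inv_into_f\<close>)
    then show ?thesis by (auto simp: image_image)
  qed
  show ?thesis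
  proof (rule that[of "V ` X"])
    show "V ` X \<subseteq> dyn_join X T n \<U>"
    proof
      fix A assume "A \<in> V ` X"
      then obtain x where x: "x \<in> X" "A = V x" by auto
      show "A \<in> dyn_join X T n \<U>"
        unfolding dyn_join_def mem_Collect_eq x(2) V_def
        by (rule exI[of _ "\<lambda>i. c ((T ^^ i) x)"]) (use c TX x in auto)
    qed
    show "finite (V ` X)" unfolding V_eq by (intro finite_imageI K(1))
    show "card (V ` X) \<le> card (K ` X)" unfolding V_eq by (intro card_image_le K(1))
    show "X \<subseteq> \<Union>(V ` X)"
    proof
      fix x assume x: "x \<in> X"
      then have "x \<in> V x" unfolding V_def using c TX by blast
      then show "x \<in> \<Union>(V ` X)" using x by blast
    qed
  qed
qed

definition word_count :: "(int \<Rightarrow> 'a) set \<Rightarrow> nat \<Rightarrow> nat" where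
  "word_count X n = card ((\<lambda>x. window x 0 (int n - 1)) ` X)"

lemma finite_windows: "finite ((\<lambda>x. window x a b) ` (X :: (int \<Rightarrow> 'a::finite) set))"
proof (rule finite_subset)
  show "(\<lambda>x. window x a b) ` X \<subseteq> {v. set v \<subseteq> UNIV \<and> length v = nat (b - a + 1)}" by auto
qed (rule finite_lists_length_eq, simp)

lemma windows_shift:
  assumes "shift_map ` X = X"
  shows "(\<lambda>x. window x a (a + k)) ` X = (\<lambda>x. window x 0 k) ` X"
proof -
  have T: "(shift_map ^^ i) ` X = X" for i
  proof (induction i)
    case (Suc i)
    have "(shift_map ^^ Suc i) ` X = shift_map ` (shift_map ^^ i) ` X" by (simp add: image_image)
    then show ?case using Suc assms by simp
  qed simp
  have *: "(\<lambda>x. window x (a + int i) (a + int i + k)) ` X = (\<lambda>x. window x a (a + k)) ` X" for a i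
  proof -
    have "(\<lambda>x. window x a (a + k)) ` X = (\<lambda>x. window x a (a + k)) ` (shift_map ^^ i) ` X" by (simp only: T)
    also have "\<dots> = (\<lambda>x. window x (a + int i) (a + int i + k)) ` X"
      unfolding image_image window_shift_pow by (simp add: algebra_simps)
    finally show ?thesis by simp
  qed
  show ?thesis
  proof (cases "a \<ge> 0")
    case True then show ?thesis using *[of 0 "nat a"] by simp
  next
    case False then show ?thesis using *[of a "nat (- a)"] by simp
  qed
qed

text \<open>Lebesgue's number lemma for cylinders: by compactness finitely many cylinders, each
  inside a member of the cover, cover \<open>X\<close>. Their largest radius works for all points,
  and a member can be chosen as a function of the window alone.\<close>

lemma open_cover_lebesgue:
  fixes X :: "(int \<Rightarrow> 'a::finite) set"
  assumes X: "closedin fullshift_topology X" and U: "\<U> \<in> open_covers (subtopology fullshift_topology X)"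
  obtains m :: nat and \<phi> where "\<And>x. x \<in> X \<Longrightarrow> \<phi> (window x (- int m) (int m)) \<in> \<U> \<and> x \<in> \<phi> (window x (- int m) (int m))"
proof -
  have Uo: "\<And>U. U \<in> \<U> \<Longrightarrow> openin (subtopology fullshift_topology X) U" and UX: "\<Union>\<U> = X"
    using U by (auto simp: open_covers_def)
  define C where "C = {A. \<exists>m v. A = X \<inter> {y. window y (- int m) (int m) = v} \<and> (\<exists>U\<in>\<U>. A \<subseteq> U)}"
  have "openin (subtopology fullshift_topology X) A" if "A \<in> C" for A
  proof -
    obtain m v where "A = X \<inter> {y. window y (- int m) (int m) \<in> {v}}" using \<open>A \<in> C\<close> by (auto simp: C_def)
    then show ?thesis unfolding openin_subtopology using openin_window by blast
  qed
  moreover have "X \<subseteq> \<Union>C"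
  proof
    fix x assume x: "x \<in> X"
    then obtain U where U: "U \<in> \<U>" "x \<in> U" using UX by blast
    then obtain V where V: "openin fullshift_topology V" "U = V \<inter> X" using Uo unfolding openin_subtopology by blast
    then obtain m where "{y. window y (- int m) (int m) = window x (- int m) (int m)} \<subseteq> V"
      using openin_fullshift_nhd U by blast
    then have "X \<inter> {y. window y (- int m) (int m) = window x (- int m) (int m)} \<in> C"
      unfolding C_def using V U by blast
    then show "x \<in> \<Union>C" using x by blast
  qed
  moreover have "(\<forall>U\<in>C. openin (subtopology fullshift_topology X) U) \<and> X \<subseteq> \<Union>C
      \<longrightarrow> (\<exists>F. finite F \<and> F \<subseteq> C \<and> X \<subseteq> \<Union>F)"
    using compact_subshift[OF X] unfolding compact_space_alt topspace_subtopology topspace_fullshift Int_UNIV_left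
    by (rule spec)
  ultimately obtain F where F: "finite F" "F \<subseteq> C" "X \<subseteq> \<Union>F" by auto
  have "\<forall>A\<in>F. \<exists>m U. U \<in> \<U> \<and> (\<exists>v. A = X \<inter> {y. window y (- int m) (int m) = v}) \<and> A \<subseteq> U"
  proof
    fix A assume "A \<in> F"
    then have "A \<in> C" using F(2) by blast
    then show "\<exists>m U. U \<in> \<U> \<and> (\<exists>v. A = X \<inter> {y. window y (- int m) (int m) = v}) \<and> A \<subseteq> U"
      unfolding C_def by blast
  qed
  then obtain mm W where mW: "\<And>A. A \<in> F \<Longrightarrow> W A \<in> \<U> \<and> (\<exists>v. A = X \<inter> {y. window y (- int (mm A)) (int (mm A)) = v}) \<and> A \<subseteq> W A"
    by metis
  define m where "m = Max (insert 0 (mm ` F))"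
  have mm: "mm A \<le> m" if "A \<in> F" for A using that F(1) by (auto simp: m_def)
  have "\<exists>U\<in>\<U>. \<forall>y\<in>X. window y (- int m) (int m) = window x (- int m) (int m) \<longrightarrow> y \<in> U" if x: "x \<in> X" for x
  proof -
    obtain A where A: "A \<in> F" "x \<in> A" using F x by blast
    then obtain v where v: "A = X \<inter> {y. window y (- int (mm A)) (int (mm A)) = v}" using mW by blast
    have "y \<in> A" if "y \<in> X" "window y (- int m) (int m) = window x (- int m) (int m)" for y
    proof -
      have "window y (- int (mm A)) (int (mm A)) = window x (- int (mm A)) (int (mm A))"
        using that(2) mm[OF A(1)] unfolding window_eq_iff by auto
      moreover have "x \<in> X \<inter> {y. window y (- int (mm A)) (int (mm A)) = v}"
        using equalityD1[OF v] A(2) by (rule subsetD)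
      ultimately have "y \<in> X \<inter> {y. window y (- int (mm A)) (int (mm A)) = v}" using that(1) by simp
      with equalityD2[OF v] show ?thesis by (rule subsetD)
    qed
    then show ?thesis using mW[OF A(1)] by blast
  qed
  then obtain u where u: "\<And>x. x \<in> X \<Longrightarrow> u x \<in> \<U>"
    "\<And>x y. x \<in> X \<Longrightarrow> y \<in> X \<Longrightarrow> window y (- int m) (int m) = window x (- int m) (int m) \<Longrightarrow> y \<in> u x"
    by metis
  \<comment> \<open>\<open>inv_into\<close> picks some point with the given window; the member
    chosen for it contains every point with that window.\<close>
  define \<phi> where "\<phi> = (\<lambda>v. u (inv_into X (\<lambda>x. window x (- int m) (int m)) v))"
  show ?thesis
  proof (rule that[of \<phi> m])
    fix x assume x: "x \<in> X"
    let ?w = "\<lambda>x::int \<Rightarrow> 'a. window x (- int m) (int m)"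
    have "?w (inv_into X ?w (?w x)) = ?w x" "inv_into X ?w (?w x) \<in> X"
      using x f_inv_into_f[of "?w x" ?w X] inv_into_into[of "?w x" ?w X] by blast+
    then show "\<phi> (?w x) \<in> \<U> \<and> x \<in> \<phi> (?w x)" unfolding \<phi>_def using u x by simp
  qed
qed

text \<open>The itinerary up to time \<open>n\<close> is determined by the window from
  \<open>- m\<close> to \<open>n + m - 1\<close>, so the subcover number is at most the number of
  words of length \<open>n + 2 * m\<close>. The \<open>2 * m\<close> extra letters disappear in the
  limit.\<close>

lemma topological_entropy_le:
  fixes X :: "(int \<Rightarrow> 'a::finite) set"
  assumes X: "is_subshift X" and b: "\<And>n. n \<ge> 1 \<Longrightarrow> ln (real (word_count X n)) \<le> real n * h + c"
  shows "topological_entropy (subtopology fullshift_topology X) shift_map \<le> ereal h"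
  unfolding topological_entropy_def
proof (rule SUP_least)
  fix \<U> assume U: "\<U> \<in> open_covers (subtopology fullshift_topology X)"
  have X': "X \<noteq> {}" "closedin fullshift_topology X" "shift_map ` X = X"
    using X by (auto simp: is_subshift_def)
  have shX: "shift_map x \<in> X" if "x \<in> X" for x using that X'(3) by blast
  obtain m \<phi> where \<phi>: "\<And>x. x \<in> X \<Longrightarrow> \<phi> (window x (- int m) (int m)) \<in> \<U> \<and> x \<in> \<phi> (window x (- int m) (int m))"
    using open_cover_lebesgue[OF X'(2) U] by blast
  let ?N = "\<lambda>n. subcover_number X (dyn_join X shift_map n \<U>)"
  have N: "?N n \<le> word_count X (n + 2 * m)" for n
  proof -
    let ?K = "\<lambda>x::int \<Rightarrow> 'a. window x (- int m) (- int m + (int (n + 2 * m) - 1))"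
    obtain \<V> where V: "\<V> \<subseteq> dyn_join X shift_map n \<U>" "finite \<V>" "card \<V> \<le> card (?K ` X)" "X \<subseteq> \<Union>\<V>"
    proof (rule dyn_join_subcover[where X = X and T = shift_map and n = n and K = ?K
          and c = "\<lambda>x. \<phi> (window x (- int m) (int m))", OF shX \<phi>])
      show "finite (?K ` X)" by (rule finite_windows)
      fix x y :: "int \<Rightarrow> 'a" and i assume K: "?K x = ?K y" and i: "i < n"
      have "window ((shift_map ^^ i) x) (- int m) (int m) = window ((shift_map ^^ i) y) (- int m) (int m)"
        using K i unfolding window_shift_pow window_eq_iff by auto
      then show "\<phi> (window ((shift_map ^^ i) x) (- int m) (int m)) = \<phi> (window ((shift_map ^^ i) y) (- int m) (int m))"
        by simp
    qed auto
    have "?N n \<le> card \<V>" unfolding subcover_number_def by (rule Least_le) (use V in blast)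
    also have "\<dots> \<le> word_count X (n + 2 * m)"
      using V(3) windows_shift[OF X'(3), of "- int m" "int (n + 2 * m) - 1"] by (simp add: word_count_def)
    finally show ?thesis .
  qed
  have bound: "ln (real (?N n)) / real n \<le> h + (2 * real m * h + c) / real n" if n: "n \<ge> 1" for n
  proof -
    have "word_count X (n + 2 * m) \<noteq> 0"
      unfolding word_count_def using X'(1) finite_windows by (simp add: card_eq_0_iff)
    \<comment> \<open>If \<open>?N n\<close> is 0, the left side is \<open>ln 0\<close>, which is 0,
      and the word count is at least 1.\<close>
    then have "ln (real (?N n)) \<le> ln (real (word_count X (n + 2 * m)))"
      using N[of n] by (cases "?N n = 0") auto
    also have "\<dots> \<le> real (n + 2 * m) * h + c" using b[of "n + 2 * m"] n by linarith
    finally have "ln (real (?N n)) / real n \<le> (real (n + 2 * m) * h + c) / real n" by (intro divide_right_mono) auto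
    also have "\<dots> = h + (2 * real m * h + c) / real n" using n by (simp add: field_simps)
    finally show ?thesis .
  qed
  have "(\<lambda>n. h + (2 * real m * h + c) / real n) \<longlonglongrightarrow> h + 0" by (intro tendsto_add tendsto_const lim_const_over_n)
  then have "limsup (\<lambda>n. ereal (h + (2 * real m * h + c) / real n)) = ereal h" by (intro lim_imp_Limsup) auto
  moreover have "limsup (\<lambda>n. ereal (ln (real (?N n)) / real n)) \<le> limsup (\<lambda>n. ereal (h + (2 * real m * h + c) / real n))"
    by (rule Limsup_mono) (use bound in \<open>auto simp: eventually_sequentially intro!: exI[of _ 1]\<close>)
  ultimately show "limsup (\<lambda>n. ereal (ln (real (subcover_number (topspace (subtopology fullshift_topology X))
      (dyn_join (topspace (subtopology fullshift_topology X)) shift_map n \<U>))) / real n)) \<le> ereal h"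
    by simp
qed

text \<open>For the cover by the letter at 0, all points in one member of the join share their
  window of length \<open>n\<close>. A subcover therefore needs at least as many members as there
  are words.\<close>

lemma topological_entropy_ge:
  fixes X :: "(int \<Rightarrow> 'a::finite) set"
  assumes X: "is_subshift X" and b: "\<And>n. n \<ge> 1 \<Longrightarrow> real n * h - c \<le> ln (real (word_count X n))"
  shows "topological_entropy (subtopology fullshift_topology X) shift_map \<ge> ereal h"
proof -
  have X': "X \<noteq> {}" "shift_map ` X = X" using X by (auto simp: is_subshift_def)
  have shX: "shift_map x \<in> X" if "x \<in> X" for x using that X'(2) by blast
  have shpX: "(shift_map ^^ i) x \<in> X" if "x \<in> X" for x i using that shX by (induction i) auto
  define cl where "cl = (\<lambda>x::int \<Rightarrow> 'a. X \<inter> {y. window y 0 0 \<in> {window x 0 0}})"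
  define \<U> where "\<U> = cl ` X"
  have "openin (subtopology fullshift_topology X) (cl x)" for x
    unfolding cl_def openin_subtopology using openin_window by blast
  then have U: "\<U> \<in> open_covers (subtopology fullshift_topology X)"
    by (auto simp: open_covers_def \<U>_def cl_def)
  let ?N = "\<lambda>n. subcover_number X (dyn_join X shift_map n \<U>)"
  have N: "word_count X n \<le> ?N n" for n
  proof -
    let ?P = "\<lambda>k. \<exists>\<V>\<subseteq>dyn_join X shift_map n \<U>. finite \<V> \<and> card \<V> = k \<and> X \<subseteq> \<Union>\<V>"
    let ?K = "\<lambda>x::int \<Rightarrow> 'a. window x 0 (int n - 1)"
    \<comment> \<open>Some finite subcover must exist before the \<open>LEAST\<close> in
      \<open>subcover_number\<close> says anything.\<close>
    obtain \<V> where V: "\<V> \<subseteq> dyn_join X shift_map n \<U>" "finite \<V>" "X \<subseteq> \<Union>\<V>"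
    proof (rule dyn_join_subcover[where X = X and T = shift_map and n = n and K = ?K and c = cl and \<U> = \<U>, OF shX])
      show "finite (?K ` X)" by (rule finite_windows)
      show "x \<in> X \<Longrightarrow> cl x \<in> \<U> \<and> x \<in> cl x" for x by (auto simp: \<U>_def cl_def)
      fix x y :: "int \<Rightarrow> 'a" and i assume K: "?K x = ?K y" and i: "i < n"
      have "window ((shift_map ^^ i) x) 0 0 = window ((shift_map ^^ i) y) 0 0"
        using K i unfolding window_shift_pow window_eq_iff by auto
      then show "cl ((shift_map ^^ i) x) = cl ((shift_map ^^ i) y)" by (simp add: cl_def)
    qed auto
    then have "\<exists>k. ?P k" by blast
    then have "?P (?N n)" unfolding subcover_number_def by (rule LeastI_ex)
    then obtain \<W> where W: "\<W> \<subseteq> dyn_join X shift_map n \<U>" "finite \<W>" "card \<W> = ?N n" "X \<subseteq> \<Union>\<W>" by blast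
    have same: "?K x = ?K y" if A: "A \<in> dyn_join X shift_map n \<U>" "x \<in> A" "y \<in> A" for A x y
    proof -
      obtain f where f: "\<forall>i<n. f i \<in> \<U>" "A = X \<inter> (\<Inter>i<n. (shift_map ^^ i) -` f i)"
        using A(1) by (auto simp: dyn_join_def)
      have "x (int i) = y (int i)" if i: "i < n" for i
      proof -
        have "(shift_map ^^ i) x \<in> f i" "(shift_map ^^ i) y \<in> f i" using f(2) A i by auto
        moreover obtain z where "f i = cl z" using f(1) i by (auto simp: \<U>_def)
        ultimately have "window ((shift_map ^^ i) x) 0 0 = window ((shift_map ^^ i) y) 0 0" by (simp add: cl_def)
        then show ?thesis by (simp add: window_shift_pow window_eq_iff)
      qed
      then have "x p = y p" if "p \<in> {0..int n - 1}" for p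
        using that by (metis atLeastAtMost_iff nonneg_int_cases zle_diff1_eq of_nat_less_iff)
      then show ?thesis unfolding window_eq_iff by blast
    qed
    \<comment> \<open>Each member is sent to the window shared by its points; since
      \<open>\<W>\<close> covers \<open>X\<close>, every window is reached.\<close>
    have "?K ` X \<subseteq> (\<lambda>A. ?K (SOME x. x \<in> A)) ` \<W>"
    proof
      fix u assume "u \<in> ?K ` X"
      then obtain x where x: "x \<in> X" "u = ?K x" by auto
      then obtain A where A: "A \<in> \<W>" "x \<in> A" using W(4) by blast
      have "(SOME x. x \<in> A) \<in> A" using A(2) by (rule someI[of "\<lambda>x. x \<in> A"])
      then have "u = ?K (SOME x. x \<in> A)" using same A W(1) x(2) by blast
      then show "u \<in> (\<lambda>A. ?K (SOME x. x \<in> A)) ` \<W>" using A by blast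
    qed
    then have "card (?K ` X) \<le> card \<W>" by (rule surj_card_le[OF W(2)])
    then show ?thesis using W(3) by (simp add: word_count_def)
  qed
  have bound: "h - c / real n \<le> ln (real (?N n)) / real n" if n: "n \<ge> 1" for n
  proof -
    have "word_count X n \<noteq> 0"
      unfolding word_count_def using X'(1) finite_windows by (simp add: card_eq_0_iff)
    then have "ln (real (word_count X n)) \<le> ln (real (?N n))" using N[of n] by simp
    then have "real n * h - c \<le> ln (real (?N n))" using b[OF n] by linarith
    then have "(real n * h - c) / real n \<le> ln (real (?N n)) / real n" by (intro divide_right_mono) auto
    moreover have "(real n * h - c) / real n = h - c / real n" using n by (simp add: field_simps)
    ultimately show ?thesis by simp
  qed
  have "(\<lambda>n. h - c / real n) \<longlonglongrightarrow> h - 0" by (intro tendsto_diff tendsto_const lim_const_over_n)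
  then have "limsup (\<lambda>n. ereal (h - c / real n)) = ereal h" by (intro lim_imp_Limsup) auto
  moreover have "limsup (\<lambda>n. ereal (h - c / real n)) \<le> limsup (\<lambda>n. ereal (ln (real (?N n)) / real n))"
    by (rule Limsup_mono) (use bound in \<open>auto simp: eventually_sequentially intro!: exI[of _ 1]\<close>)
  moreover have "\<dots> \<le> topological_entropy (subtopology fullshift_topology X) shift_map"
    unfolding topological_entropy_def by (rule SUP_upper2[OF U]) simp
  ultimately show ?thesis by simp
qed

section \<open>Uniqueness of the measure of maximal entropy\<close>

context shift_invariant_prob
begin

lemma integral_window_word_sum:
  fixes h :: "'a list \<Rightarrow> real"
  assumes "b = a + int k - 1"
  shows "(\<integral>x. h (window x a b) \<partial>M) = (\<Sum>v\<in>{v. length v = k}. fibre_prob M (\<lambda>x. window x 0 (int k - 1)) v * h v)"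
proof -
  have "(\<integral>x. h (window x a b) \<partial>M) = (\<integral>x. h (window x 0 (int k - 1)) \<partial>M)"
    using integral_window[of h a "int k - 1"] assms by (simp add: add_diff_eq)
  also have "\<dots> = (\<Sum>v\<in>{v. length v = k}. fibre_prob M (\<lambda>x. window x 0 (int k - 1)) v * h v)"
    by (rule integral_simple[OF simple_window]) (use finite_lists_length_eq[of "UNIV :: 'a set" k] in auto)
  finally show ?thesis .
qed

lemma prob_window_integral: "prob {x \<in> X. window x a b \<in> S} = (\<integral>x. indicator S (window x a b) \<partial>M)"
proof -
  have "{x \<in> X. window x a b \<in> S} \<in> sets M" using window_sets[of a b S] by (simp add: Int_def)
  then have "prob {x \<in> X. window x a b \<in> S} = (\<integral>x. indicator {x \<in> X. window x a b \<in> S} x \<partial>M)"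
    using sets.sets_into_space by (simp add: Int_absorb2)
  also have "\<dots> = (\<integral>x. indicator S (window x a b) \<partial>M)"
    by (rule Bochner_Integration.integral_cong) (auto simp: space_M indicator_def)
  finally show ?thesis .
qed

end

text \<open>By invariance the symmetric windows that generate the Borel sets can be moved so that
  they start at 0.\<close>

lemma shift_invariant_eqI:
  assumes "shift_invariant_prob M X" "shift_invariant_prob M' X"
    and eq: "\<And>k v. k \<ge> 1 \<Longrightarrow> length v = k \<Longrightarrow>
      fibre_prob M (\<lambda>x. window x 0 (int k - 1)) v = fibre_prob M' (\<lambda>x. window x 0 (int k - 1)) v"
  shows "M = M'"
proof -
  interpret M: shift_invariant_prob M X by fact
  interpret M': shift_invariant_prob M' X by fact
  show ?thesis
  proof (rule shift_borel_measure_eqI[OF M.sets_M M'.sets_M M.finite_measure_axioms])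
    fix A assume "A \<in> cylinder_algebra X"
    then obtain m S where A: "A = {x \<in> X. window x (- int m) (int m) \<in> S}"
      by (auto simp: cylinder_algebra_def)
    have *: "int m = - int m + int (2 * m + 1) - 1" by simp
    have "measure M A = measure M' A"
      unfolding A M.prob_window_integral M'.prob_window_integral
        M.integral_window_word_sum[OF *] M'.integral_window_word_sum[OF *]
      using eq[of "2 * m + 1"] by simp
    then show "emeasure M A = emeasure M' A" by (simp add: M.emeasure_eq_measure M'.emeasure_eq_measure)
  qed
qed

section \<open>Measures with Gibbs bounds: entropy and uniqueness\<close>

definition word_avg :: "'a list \<Rightarrow> nat \<Rightarrow> (int \<Rightarrow> 'a) \<Rightarrow> real" where
  "word_avg v n x = (\<Sum>i<n. if window x (int i) (int i + int (length v) - 1) = v then 1 else 0) / real n"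

text \<open>The Gibbs property for the zero potential: words of equal length have comparable mass,
  with constants independent of the length. The lower bound concerns only words that occur in
  \<open>X\<close>, the upper bound all lists. The weak law supplies one suitable \<open>n\<close>
  for each tolerance.\<close>

locale gibbs_measure = shift_invariant_prob M X for M :: "(int \<Rightarrow> 'a::finite) measure" and X +
  fixes h c C :: real
  assumes subshift: "is_subshift X" and c_pos: "c > 0" and C_pos: "C > 0"
    and lower: "\<And>n x. n \<ge> 1 \<Longrightarrow> x \<in> X \<Longrightarrow>
      c * exp (- h * real n) \<le> fibre_prob M (\<lambda>x. window x 0 (int n - 1)) (window x 0 (int n - 1))"
    and upper: "\<And>n v. n \<ge> 1 \<Longrightarrow> fibre_prob M (\<lambda>x. window x 0 (int n - 1)) v \<le> C * exp (- h * real n)"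
    and weak_lln: "\<And>v \<delta> \<eta>. length v \<ge> 1 \<Longrightarrow> \<delta> > 0 \<Longrightarrow> \<eta> > 0 \<Longrightarrow> \<exists>n\<ge>1.
      prob {x \<in> X. \<bar>word_avg v n x - fibre_prob M (\<lambda>x. window x 0 (int (length v) - 1)) v\<bar> > \<delta>} \<le> \<eta>"
begin

lemma block_entropy_ge: "n \<ge> 1 \<Longrightarrow> block_entropy n \<ge> real n * h - ln C"
  unfolding block_entropy_def
proof (rule fun_entropy_ge[OF simple_window])
  fix v assume n: "n \<ge> 1"
  show "fibre_prob M (\<lambda>x. window x 0 (int n - 1)) v \<le> exp (- (real n * h - ln C))"
    using upper[OF n, of v] C_pos by (simp add: exp_diff exp_minus field_simps)
qed

lemma block_entropy_le: "n \<ge> 1 \<Longrightarrow> block_entropy n \<le> real n * h - ln c"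
  unfolding block_entropy_def
proof (rule fun_entropy_le[OF simple_window])
  fix v assume n: "n \<ge> 1" and v: "v \<in> (\<lambda>x. window x 0 (int n - 1)) ` space M"
  then show "exp (- (real n * h - ln c)) \<le> fibre_prob M (\<lambda>x. window x 0 (int n - 1)) v"
    using lower[OF n] c_pos by (auto simp: space_M exp_diff exp_minus field_simps)
qed

text \<open>The upper bound by block entropies holds for every block length, so the error
  \<open>- ln c / n\<close> is removed by letting the length grow.\<close>

lemma metric_entropy_eq: "metric_entropy M shift_map = ereal h"
proof (rule antisym)
  show "ereal h \<le> metric_entropy M shift_map" using block_entropy_ge by (rule metric_entropy_ge)
  show "metric_entropy M shift_map \<le> ereal h"
  proof (rule tendsto_lowerbound)
    have "(\<lambda>n. h + (- ln c) / real n) \<longlonglongrightarrow> h + 0" by (intro tendsto_add tendsto_const lim_const_over_n)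
    then show "(\<lambda>n. ereal (h + (- ln c) / real n)) \<longlonglongrightarrow> ereal h" by simp
    have "metric_entropy M shift_map \<le> ereal (h + (- ln c) / real n)" if n: "n \<ge> 1" for n
    proof -
      have "block_entropy n / real n \<le> (real n * h - ln c) / real n"
        using block_entropy_le[OF n] by (intro divide_right_mono) auto
      also have "\<dots> = h + (- ln c) / real n" using n by (simp add: field_simps)
      finally show ?thesis using metric_entropy_le[OF n] by (meson ereal_less_eq(3) order_trans)
    qed
    then show "\<forall>\<^sub>F n in sequentially. metric_entropy M shift_map \<le> ereal (h + (- ln c) / real n)"
      unfolding eventually_sequentially by blast
  qed simp
qed

text \<open>The masses of the words of length \<open>n\<close> add up to 1, and each of them lies
  between the two Gibbs bounds.\<close>

lemma word_count_bounds:
  assumes n: "n \<ge> 1"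
  shows "real n * h - ln C \<le> ln (real (word_count X n))" "ln (real (word_count X n)) \<le> real n * h + (- ln c)"
proof -
  let ?K = "\<lambda>x::int \<Rightarrow> 'a. window x 0 (int n - 1)"
  let ?N = "real (word_count X n)"
  have fin: "finite (?K ` X)" by (rule finite_windows)
  have sum1: "(\<Sum>v\<in>?K ` X. fibre_prob M ?K v) = 1"
    by (rule sum_fibre_prob[OF simple_window fin]) (simp add: space_M)
  have "?N * (c * exp (- h * real n)) = (\<Sum>v\<in>?K ` X. c * exp (- h * real n))"
    by (simp add: word_count_def)
  also have "\<dots> \<le> 1" unfolding sum1[symmetric] using lower[OF n] by (intro sum_mono) auto
  finally have 1: "?N * (c * exp (- h * real n)) \<le> 1" .
  have "1 \<le> (\<Sum>v\<in>?K ` X. C * exp (- h * real n))"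
    unfolding sum1[symmetric] using upper[OF n] by (intro sum_mono) auto
  also have "\<dots> = ?N * (C * exp (- h * real n))" by (simp add: word_count_def)
  finally have 2: "1 \<le> ?N * (C * exp (- h * real n))" .
  have N: "?N > 0" using 2 by (cases "word_count X n = 0") auto
  have "ln (?N * (c * exp (- h * real n))) \<le> ln 1" using 1 N c_pos by (intro ln_mono) auto
  then show "ln ?N \<le> real n * h + (- ln c)" using N c_pos by (simp add: ln_mult mult.commute)
  have "ln 1 \<le> ln (?N * (C * exp (- h * real n)))" using 2 by (intro ln_mono) auto
  then show "real n * h - ln C \<le> ln ?N" using N C_pos by (simp add: ln_mult mult.commute)
qed

lemma topological_entropy_eq: "topological_entropy (subtopology fullshift_topology X) shift_map = ereal h"
  using topological_entropy_le[OF subshift word_count_bounds(2)] topological_entropy_ge[OF subshift word_count_bounds(1)]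
  by (rule antisym)

lemma maximal_entropy: "measure_of_maximal_entropy X M"
  unfolding measure_of_maximal_entropy_def metric_entropy_eq topological_entropy_eq using invariant by simp

text \<open>Gibbs' inequality for \<open>M'\<close> against half of \<open>M\<close> plus half of \<open>M\<close> conditioned on the rare event:
  if \<open>M'\<close> charged the event, its block entropy would drop below \<open>n h\<close>.\<close>

lemma rare_event:
  assumes M': "measure_of_maximal_entropy X M'" and n: "n \<ge> 1" and \<eta>: "0 < \<eta>" "\<eta> < 1"
    and rare: "prob {x \<in> X. window x 0 (int n - 1) \<in> S} \<le> \<eta>"
  shows "measure M' {x \<in> X. window x 0 (int n - 1) \<in> S} * ln (1 / \<eta>) \<le> ln 2 - ln c"
proof -
  interpret M': shift_invariant_prob M' X
    using M' shift_image by (auto simp: shift_invariant_prob_def shift_invariant_prob_axioms_def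
        measure_of_maximal_entropy_def invariant_prob_def)
  let ?K = "\<lambda>x::int \<Rightarrow> 'a. window x 0 (int n - 1)"
  define P where "P = fibre_prob M ?K"
  \<comment> \<open>Dividing by the bound \<open>\<eta>\<close> instead of the actual probability of
    the event keeps the total at most 1 and also makes sense if the event is null.\<close>
  define Q where "Q = (\<lambda>v. P v / 2 * (1 + indicator S v / \<eta>))"
  \<comment> \<open>The negative logarithm of the Gibbs lower bound for \<open>Q\<close>: words in
    \<open>S\<close> are shorter to describe by \<open>ln (1 / \<eta>)\<close>.\<close>
  define L where "L = (\<lambda>v. (ln 2 - ln c + real n * h) - indicator S v * ln (1 / \<eta>))"
  have P0: "P v \<ge> 0" for v by (simp add: P_def fibre_prob_nonneg)
  \<comment> \<open>Maximality enters here: \<open>M'\<close> has entropy \<open>h\<close>, and this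
    is at most its block entropy per letter at every length.\<close>
  have "ereal h \<le> ereal (M'.block_entropy n / real n)"
    using M'.metric_entropy_le[OF n] M' topological_entropy_eq by (simp add: measure_of_maximal_entropy_def)
  then have "real n * h \<le> M'.block_entropy n" using n by (simp add: field_simps)
  also have "M'.block_entropy n \<le> (\<integral>x. L (?K x) \<partial>M')"
    unfolding M'.block_entropy_def
  proof (rule M'.gibbs_inequality[where \<phi> = id and Q = Q, OF M'.simple_window])
    show "0 \<le> Q v" for v using P0[of v] \<eta> by (simp add: Q_def)
    have "(\<Sum>v\<in>?K ` X. Q v) = ((\<Sum>v\<in>?K ` X. P v) + (\<Sum>v\<in>?K ` X. P v * indicator S v) / \<eta>) / 2"
      by (simp add: Q_def sum.distrib distrib_left add_divide_distrib flip: sum_divide_distrib)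
    also have "(\<Sum>v\<in>?K ` X. P v) = 1"
      unfolding P_def by (rule sum_fibre_prob[OF simple_window finite_windows]) (simp add: space_M)
    also have "(\<Sum>v\<in>?K ` X. P v * indicator S v) = prob {x \<in> X. ?K x \<in> S}"
      unfolding prob_window_integral P_def
      by (rule integral_simple[OF simple_window finite_windows, symmetric]) (simp add: space_M)
    also have "(1 + prob {x \<in> X. ?K x \<in> S} / \<eta>) / 2 \<le> 1"
      using rare \<eta> by (simp add: field_simps)
    finally show "(\<Sum>v\<in>?K ` space M'. Q v) \<le> 1" by (simp add: M'.space_M)
    fix v assume "v \<in> ?K ` space M'"
    then have "c * exp (- h * real n) \<le> P v" using lower[OF n] by (auto simp: M'.space_M P_def)
    then have "c * exp (- h * real n) / 2 * (1 + indicator S v / \<eta>) \<le> Q v"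
      unfolding Q_def using \<eta> by (intro mult_right_mono divide_right_mono) auto
    moreover have "exp (- L v) = c * exp (- h * real n) / 2 * exp (indicator S v * ln (1 / \<eta>))"
      using c_pos by (simp add: L_def exp_diff exp_add exp_minus field_simps)
    moreover have "exp (indicator S v * ln (1 / \<eta>)) \<le> 1 + indicator S v / \<eta>"
      using \<eta> by (auto simp: indicator_def)
    then have "c * exp (- h * real n) / 2 * exp (indicator S v * ln (1 / \<eta>)) \<le> c * exp (- h * real n) / 2 * (1 + indicator S v / \<eta>)"
      using c_pos by (intro mult_left_mono) auto
    ultimately show "exp (- L v) \<le> Q v" by linarith
  qed simp
  also have "\<dots> = (ln 2 - ln c + real n * h) - measure M' {x \<in> X. ?K x \<in> S} * ln (1 / \<eta>)"
    unfolding M'.prob_window_integral L_def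
    using M'.integrable_simple[OF M'.simple_window, of "indicator S" 0 "int n - 1"]
    by (subst Bochner_Integration.integral_diff) (auto simp: M'.prob_space)
  finally show ?thesis by simp
qed

text \<open>By invariance the mean of \<open>word_avg v n\<close> under \<open>M'\<close> is exactly
  \<open>p'\<close>. Under \<open>M\<close> the average is close to \<open>p\<close> outside a rare
  set \<open>B\<close>, and \<open>rare_event\<close> keeps \<open>B\<close> small for
  \<open>M'\<close> too. Hence \<open>p'\<close> is close to \<open>p\<close>.\<close>

lemma maximal_entropy_unique:
  assumes M': "measure_of_maximal_entropy X M'"
  shows "M' = M"
proof -
  have inv': "shift_invariant_prob M' X"
    using M' shift_image by (auto simp: shift_invariant_prob_def shift_invariant_prob_axioms_def
        measure_of_maximal_entropy_def invariant_prob_def)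
  interpret M': shift_invariant_prob M' X by fact
  show ?thesis
  proof (rule shift_invariant_eqI[OF inv' shift_invariant_prob_axioms])
    fix k and v :: "'a list" assume k: "k \<ge> 1" and v: "length v = k"
    define p where "p = fibre_prob M (\<lambda>x. window x 0 (int k - 1)) v"
    define p' where "p' = fibre_prob M' (\<lambda>x. window x 0 (int k - 1)) v"
    have "\<bar>p' - p\<bar> \<le> 0 + e" if e: "e > 0" for e
    proof -
      define \<delta> where "\<delta> = e / 2"
      define A where "A = \<bar>ln 2 - ln c\<bar>"
      \<comment> \<open>Then \<open>ln (1 / \<eta>) = 2 * (A + 1) / e\<close>, so the mass of
        \<open>B\<close> under \<open>M'\<close> is at most \<open>e / 2\<close>. The added 1 keeps
        \<open>\<eta>\<close> below 1 when \<open>A\<close> is 0.\<close>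
      define \<eta> where "\<eta> = exp (- (2 * (A + 1) / e))"
      have A: "A \<ge> 0" by (simp add: A_def)
      have \<eta>: "0 < \<eta>" "\<eta> < 1" using e A by (auto simp: \<eta>_def intro: divide_pos_pos add_nonneg_pos)
      have \<delta>: "\<delta> > 0" using e by (simp add: \<delta>_def)
      obtain n where n: "n \<ge> 1" "prob {x \<in> X. \<bar>word_avg v n x - p\<bar> > \<delta>} \<le> \<eta>"
        using weak_lln[of v \<delta> \<eta>] k v \<delta> \<eta> unfolding p_def by auto
      \<comment> \<open>Occurrences of a word of length \<open>k\<close> at \<open>n\<close>
        consecutive starting positions are read off \<open>n + k - 1\<close> letters.\<close>
      define n' where "n' = n + k - 1"
      define B where "B = {x \<in> X. \<bar>word_avg v n x - p\<bar> > \<delta>}"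
      define S where "S = (\<lambda>x. window x 0 (int n' - 1)) ` B"
      have avg_cong: "word_avg v n x = word_avg v n y" if "window x 0 (int n' - 1) = window y 0 (int n' - 1)" for x y
      proof -
        have "window x (int i) (int i + int (length v) - 1) = window y (int i) (int i + int (length v) - 1)" if "i < n" for i
          using \<open>window x 0 (int n' - 1) = window y 0 (int n' - 1)\<close> that k v
          unfolding window_eq_iff n'_def by auto
        then show ?thesis by (simp add: word_avg_def)
      qed
      have B: "B = {x \<in> X. window x 0 (int n' - 1) \<in> S}"
      proof (intro equalityI subsetI)
        fix x assume "x \<in> {x \<in> X. window x 0 (int n' - 1) \<in> S}"
        then obtain y where "x \<in> X" "y \<in> B" "window x 0 (int n' - 1) = window y 0 (int n' - 1)"
          by (auto simp: S_def)
        then show "x \<in> B" using avg_cong[of x y] by (simp add: B_def)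
      qed (auto simp: B_def S_def)
      have "n' \<ge> 1" using n k by (simp add: n'_def)
      from rare_event[OF M' this \<eta>, of S] n(2)
      have "measure M' B * ln (1 / \<eta>) \<le> ln 2 - ln c" unfolding B B_def[symmetric] by simp
      moreover have "ln (1 / \<eta>) = 2 * (A + 1) / e" by (simp add: \<eta>_def ln_div)
      moreover have "ln 2 - ln c \<le> A" by (simp add: A_def)
      ultimately have "measure M' B * (2 * (A + 1) / e) \<le> A" by simp
      then have "measure M' B * (A + 1) \<le> A * (e / 2)" using e by (simp add: field_simps)
      also have "\<dots> \<le> (A + 1) * (e / 2)" using e by (simp add: algebra_simps)
      finally have mB: "measure M' B \<le> e / 2" using A by (simp add: mult.commute)
      have intw: "integrable M' (\<lambda>x. f (window x a b))" for f :: "'a list \<Rightarrow> real" and a b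
        by (rule M'.integrable_simple[OF M'.simple_window])
      have BM: "B \<in> sets M'" using M'.window_sets[of 0 "int n' - 1" S] unfolding B by (simp add: Int_def)
      have int_avg: "integrable M' (\<lambda>x. word_avg v n x)"
        unfolding word_avg_def
        using intw[of "\<lambda>u. if u = v then 1 else 0"]
        by (intro integrable_divide Bochner_Integration.integrable_sum) auto
      have "(\<integral>x. word_avg v n x \<partial>M') = (\<Sum>i<n. (\<integral>x. (if window x (int i) (int i + int (length v) - 1) = v then 1 else 0) \<partial>M')) / real n"
        unfolding word_avg_def
        using intw[of "\<lambda>u. if u = v then 1 else 0"] by (simp add: Bochner_Integration.integral_sum)
      also have "\<dots> = (\<Sum>i<n. p') / real n"
      proof -
        have "(\<integral>x. (if window x (int i) (int i + int (length v) - 1) = v then 1 else 0) \<partial>M') = p'" for i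
        proof -
          have "(\<integral>x. (if window x (int i) (int i + int (length v) - 1) = v then 1 else 0) \<partial>M')
              = (\<Sum>u\<in>{u. length u = k}. fibre_prob M' (\<lambda>x. window x 0 (int k - 1)) u * (if u = v then 1 else 0))"
            using M'.integral_window_word_sum[of "int i + int (length v) - 1" "int i" k "\<lambda>u. if u = v then 1 else 0"] v
            by simp
          also have "\<dots> = (\<Sum>u\<in>{u. length u = k}. if u = v then p' else 0)"
            by (rule sum.cong) (auto simp: p'_def)
          also have "\<dots> = p'" using v finite_lists_length_eq[of "UNIV :: 'a set" k] by (subst sum.delta) auto
          finally show ?thesis .
        qed
        then show ?thesis by simp
      qed
      also have "\<dots> = p'" using n by simp
      finally have "p' - p = (\<integral>x. word_avg v n x - p \<partial>M')"
        using int_avg by (subst Bochner_Integration.integral_diff) (auto simp: M'.prob_space)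
      then have "\<bar>p' - p\<bar> \<le> (\<integral>x. \<bar>word_avg v n x - p\<bar> \<partial>M')" using integral_abs_bound by metis
      \<comment> \<open>Both the average and \<open>p\<close> lie between 0 and 1, so on
        \<open>B\<close> the deviation is at most 1.\<close>
      also have "\<dots> \<le> (\<integral>x. \<delta> + indicator B x \<partial>M')"
      proof (rule integral_mono)
        show "integrable M' (\<lambda>x. \<bar>word_avg v n x - p\<bar>)"
          using int_avg by (intro integrable_abs Bochner_Integration.integrable_diff) auto
        show "integrable M' (\<lambda>x. \<delta> + indicator B x)"
          using BM by (intro Bochner_Integration.integrable_add) (auto simp: M'.emeasure_eq_measure intro!: integrable_real_indicator)
        fix x assume x: "x \<in> space M'"
        have "0 \<le> p" "p \<le> 1" by (auto simp: p_def fibre_prob_def)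
        moreover have "0 \<le> word_avg v n x" by (auto simp: word_avg_def intro!: divide_nonneg_nonneg sum_nonneg)
        moreover have "word_avg v n x \<le> 1"
        proof -
          have "(\<Sum>i<n. if window x (int i) (int i + int (length v) - 1) = v then 1 else 0) \<le> (\<Sum>i<n. 1::real)"
            by (intro sum_mono) auto
          then show ?thesis using n by (simp add: word_avg_def)
        qed
        ultimately show "\<bar>word_avg v n x - p\<bar> \<le> \<delta> + indicator B x"
          using x \<delta> by (auto simp: indicator_def B_def M'.space_M)
      qed
      also have "\<dots> = \<delta> + measure M' B"
        using BM by (subst Bochner_Integration.integral_add)
          (auto simp: M'.emeasure_eq_measure M'.prob_space intro!: integrable_real_indicator)
      finally show ?thesis using mB by (simp add: \<delta>_def)
    qed
    then have "\<bar>p' - p\<bar> \<le> 0" by (rule field_le_epsilon)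
    then show "fibre_prob M' (\<lambda>x. window x 0 (int k - 1)) v = fibre_prob M (\<lambda>x. window x 0 (int k - 1)) v"
      by (simp add: p_def p'_def)
  qed
qed

theorem intrinsically_ergodic: "intrinsically_ergodic X"
  unfolding intrinsically_ergodic_def using subshift maximal_entropy maximal_entropy_unique by blast

end

section \<open>Independent uniform digits\<close>

locale uniform_digits =
  fixes l :: nat
  assumes l_ge_1: "l \<ge> 1"
begin

definition digit_seqs :: "(int \<Rightarrow> nat) set" where
  "digit_seqs = {\<omega>. \<forall>j. \<omega> j \<in> {1..l}}"

definition digit_measure :: "(int \<Rightarrow> nat) measure" where
  "digit_measure = Pi\<^sub>M UNIV (\<lambda>_. uniform_count_measure {1..l})"

text \<open>Agreement is required only on \<open>digit_seqs\<close>, the space of the product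
  measure. For finite \<open>J\<close> this combinatorial condition already gives measurability and
  integrability, and independence for disjoint index sets.\<close>

definition depends_on :: "int set \<Rightarrow> ((int \<Rightarrow> nat) \<Rightarrow> 'b) \<Rightarrow> bool" where
  "depends_on J f \<longleftrightarrow> (\<forall>\<omega>\<in>digit_seqs. \<forall>\<omega>'\<in>digit_seqs. (\<forall>j\<in>J. \<omega> j = \<omega>' j) \<longrightarrow> f \<omega> = f \<omega>')"

lemma depends_onD:
  assumes "depends_on J f" "\<omega> \<in> digit_seqs" "\<omega>' \<in> digit_seqs" "\<And>j. j \<in> J \<Longrightarrow> \<omega> j = \<omega>' j"
  shows "f \<omega> = f \<omega>'"
  using assms unfolding depends_on_def by blast

lemma depends_on_compose: "depends_on J f \<Longrightarrow> depends_on J (\<lambda>\<omega>. g (f \<omega>))"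
  unfolding depends_on_def by (intro ballI impI arg_cong[of _ _ g]) blast

lemma product_prob_space_digits: "product_prob_space (\<lambda>_::int. uniform_count_measure {1..l})"
proof -
  have "prob_space (uniform_count_measure {1..l})"
    using l_ge_1 by (intro prob_space_uniform_count_measure) auto
  then show ?thesis
    by (auto simp: product_prob_space_def product_prob_space_axioms_def product_sigma_finite_def
        intro: prob_space_imp_sigma_finite)
qed

sublocale digit: prob_space digit_measure
proof -
  interpret product_prob_space "\<lambda>_::int. uniform_count_measure {1..l}" UNIV
    by (rule product_prob_space_digits)
  show "prob_space digit_measure" unfolding digit_measure_def by (rule P.prob_space_axioms)
qed

lemma space_digit: "space digit_measure = digit_seqs"
  by (auto simp: digit_measure_def space_PiM space_uniform_count_measure digit_seqs_def PiE_iff)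

lemma digit_cylinder:
  assumes "finite J" "\<And>j. j \<in> J \<Longrightarrow> a j \<in> {1..l}"
  shows "{\<omega> \<in> digit_seqs. \<forall>j\<in>J. \<omega> j = a j} \<in> sets digit_measure"
    and "measure digit_measure {\<omega> \<in> digit_seqs. \<forall>j\<in>J. \<omega> j = a j} = (1 / real l) ^ card J"
proof -
  interpret product_prob_space "\<lambda>_::int. uniform_count_measure {1..l}" UNIV
    by (rule product_prob_space_digits)
  have eq: "{\<omega> \<in> digit_seqs. \<forall>j\<in>J. \<omega> j = a j} = {\<omega> \<in> space digit_measure. \<forall>j\<in>J. \<omega> j \<in> {a j}}"
    by (simp add: space_digit)
  have emb: "{\<omega> \<in> space digit_measure. \<forall>j\<in>J. \<omega> j \<in> {a j}}
      = prod_emb UNIV (\<lambda>_. uniform_count_measure {1..l}) J (Pi\<^sub>E J (\<lambda>j. {a j}))"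
    unfolding prod_emb_def digit_measure_def by (auto simp: space_PiM)
  have s: "{a j} \<in> sets (uniform_count_measure {1..l})" if "j \<in> J" for j
    using assms(2)[OF that] by (simp add: sets_uniform_count_measure)
  show "{\<omega> \<in> digit_seqs. \<forall>j\<in>J. \<omega> j = a j} \<in> sets digit_measure"
    unfolding eq emb unfolding digit_measure_def
    by (rule sets_PiM_I) (use assms(1) s in auto)
  have "measure digit_measure {\<omega> \<in> digit_seqs. \<forall>j\<in>J. \<omega> j = a j} = (\<Prod>j\<in>J. measure (uniform_count_measure {1..l}) {a j})"
    unfolding eq emb unfolding digit_measure_def by (rule measure_PiM_emb) (use assms(1) s in auto)
  also have "\<dots> = (\<Prod>j\<in>J. 1 / real l)"
    using assms(2) by (intro prod.cong) (auto simp: measure_uniform_count_measure)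
  finally show "measure digit_measure {\<omega> \<in> digit_seqs. \<forall>j\<in>J. \<omega> j = a j} = (1 / real l) ^ card J" by simp
qed

lemma restrict_digits:
  assumes J: "finite J"
  shows "simple_function digit_measure (\<lambda>\<omega>. restrict \<omega> J)"
    and "a \<in> Pi\<^sub>E J (\<lambda>_. {1..l}) \<Longrightarrow> fibre_prob digit_measure (\<lambda>\<omega>. restrict \<omega> J) a = (1 / real l) ^ card J"
proof -
  have sub: "(\<lambda>\<omega>. restrict \<omega> J) ` space digit_measure \<subseteq> Pi\<^sub>E J (\<lambda>_. {1..l})"
    by (intro image_subsetI) (auto simp only: restrict_PiE_iff space_digit digit_seqs_def)
  have fib: "(\<lambda>\<omega>. restrict \<omega> J) -` {a} \<inter> space digit_measure = {\<omega> \<in> digit_seqs. \<forall>j\<in>J. \<omega> j = a j}"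
    if "a \<in> Pi\<^sub>E J (\<lambda>_. {1..l})" for a
    using that by (auto simp: space_digit fun_eq_iff restrict_def PiE_iff extensional_def)
  show "simple_function digit_measure (\<lambda>\<omega>. restrict \<omega> J)"
    unfolding simple_function_def
  proof (intro conjI ballI)
    show "finite ((\<lambda>\<omega>. restrict \<omega> J) ` space digit_measure)"
      by (rule finite_subset[OF sub]) (use J in \<open>auto intro: finite_PiE\<close>)
    fix a assume "a \<in> (\<lambda>\<omega>. restrict \<omega> J) ` space digit_measure"
    then have a: "a \<in> Pi\<^sub>E J (\<lambda>_. {1..l})" using sub by blast
    show "(\<lambda>\<omega>. restrict \<omega> J) -` {a} \<inter> space digit_measure \<in> sets digit_measure"
      unfolding fib[OF a] using digit_cylinder(1)[OF J, of a] a by (auto simp: PiE_iff)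
  qed
  show "a \<in> Pi\<^sub>E J (\<lambda>_. {1..l}) \<Longrightarrow> fibre_prob digit_measure (\<lambda>\<omega>. restrict \<omega> J) a = (1 / real l) ^ card J"
    unfolding fibre_prob_def using fib digit_cylinder(2)[OF J, of a] by (auto simp: PiE_iff)
qed

text \<open>Filling the coordinates outside \<open>J\<close> with the digit 1 yields a sequence in
  \<open>digit_seqs\<close> with the same digits on \<open>J\<close>.\<close>

lemma depends_on_factor:
  assumes "depends_on J f"
  obtains F where "\<And>\<omega>. \<omega> \<in> digit_seqs \<Longrightarrow> f \<omega> = F (restrict \<omega> J)"
proof (rule that[of "\<lambda>a. f (\<lambda>j. if j \<in> J then a j else 1)"])
  fix \<omega> assume \<omega>: "\<omega> \<in> digit_seqs"
  then have "(\<lambda>j. if j \<in> J then restrict \<omega> J j else 1) \<in> digit_seqs"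
    using l_ge_1 by (auto simp: digit_seqs_def)
  then show "f \<omega> = f (\<lambda>j. if j \<in> J then restrict \<omega> J j else 1)"
    by (intro depends_onD[OF assms \<omega>]) auto
qed

lemma simple_depends_on:
  assumes "finite J" "depends_on J f"
  shows "simple_function digit_measure f"
proof -
  obtain F where F: "\<And>\<omega>. \<omega> \<in> digit_seqs \<Longrightarrow> f \<omega> = F (restrict \<omega> J)" using depends_on_factor[OF assms(2)] by blast
  have "simple_function digit_measure (\<lambda>\<omega>. F (restrict \<omega> J))"
    using simple_function_compose[OF restrict_digits(1)[OF assms(1)], of F] by (simp add: comp_def)
  then show ?thesis using F simple_function_cong[of digit_measure f "\<lambda>\<omega>. F (restrict \<omega> J)"] by (simp add: space_digit)
qed

lemma depends_on_sets:
  assumes "finite J" "depends_on J P"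
  shows "{\<omega> \<in> digit_seqs. P \<omega>} \<in> sets digit_measure"
  using simple_functionD(2)[OF simple_depends_on[OF assms], of "{True}"]
  by (simp add: space_digit vimage_def Int_def conj_commute)

lemma integrable_depends_on:
  fixes f :: "(int \<Rightarrow> nat) \<Rightarrow> real"
  assumes "finite J" "depends_on J f"
  shows "integrable digit_measure f"
  using digit.integrable_simple[OF simple_depends_on[OF assms], of "\<lambda>x. x"] .

text \<open>Independence, computed as a finite sum: the pair of restrictions to \<open>J\<close> and
  \<open>K\<close> has a product law, and both functions factor through their restrictions.\<close>

lemma integral_mult_disjoint:
  fixes f g :: "(int \<Rightarrow> nat) \<Rightarrow> real"
  assumes J: "finite J" "depends_on J f" and K: "finite K" "depends_on K g" and disj: "J \<inter> K = {}"
  shows "(\<integral>\<omega>. f \<omega> * g \<omega> \<partial>digit_measure) = (\<integral>\<omega>. f \<omega> \<partial>digit_measure) * (\<integral>\<omega>. g \<omega> \<partial>digit_measure)"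
proof -
  obtain F where F: "\<And>\<omega>. \<omega> \<in> digit_seqs \<Longrightarrow> f \<omega> = F (restrict \<omega> J)" using depends_on_factor[OF J(2)] by blast
  obtain G where G: "\<And>\<omega>. \<omega> \<in> digit_seqs \<Longrightarrow> g \<omega> = G (restrict \<omega> K)" using depends_on_factor[OF K(2)] by blast
  let ?A = "\<lambda>J::int set. Pi\<^sub>E J (\<lambda>_. {1..l})"
  let ?q = "1 / real l"
  have fin: "finite (?A J)" if "finite J" for J using that by (auto intro: finite_PiE)
  have sub: "restrict \<omega> J \<in> ?A J" if "\<omega> \<in> digit_seqs" for \<omega> J
    using that by (auto simp only: restrict_PiE_iff digit_seqs_def)
  have one: "(\<integral>\<omega>. h \<omega> \<partial>digit_measure) = (\<Sum>a\<in>?A J. ?q ^ card J * H a)"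
    if "finite J" "\<And>\<omega>. \<omega> \<in> digit_seqs \<Longrightarrow> h \<omega> = H (restrict \<omega> J)" for h :: "(int \<Rightarrow> nat) \<Rightarrow> real" and H J
  proof -
    have "(\<integral>\<omega>. h \<omega> \<partial>digit_measure) = (\<integral>\<omega>. H (restrict \<omega> J) \<partial>digit_measure)"
      by (rule Bochner_Integration.integral_cong) (use that in \<open>auto simp: space_digit\<close>)
    also have "\<dots> = (\<Sum>a\<in>?A J. fibre_prob digit_measure (\<lambda>\<omega>. restrict \<omega> J) a * H a)"
      by (rule digit.integral_simple[OF restrict_digits(1)[OF that(1)] fin[OF that(1)]])
        (intro image_subsetI, simp only: space_digit sub)
    also have "\<dots> = (\<Sum>a\<in>?A J. ?q ^ card J * H a)"
      using restrict_digits(2)[OF that(1)] by (intro sum.cong) auto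
    finally show ?thesis .
  qed
  let ?R = "\<lambda>\<omega>. (restrict \<omega> J, restrict \<omega> K)"
  have fib: "fibre_prob digit_measure ?R (a, b) = ?q ^ card J * ?q ^ card K" if ab: "a \<in> ?A J" "b \<in> ?A K" for a b
  proof -
    \<comment> \<open>Since \<open>J\<close> and \<open>K\<close> are disjoint, the two
      prescriptions never conflict and merge into a single cylinder.\<close>
    have "?R -` {(a, b)} \<inter> space digit_measure = {\<omega> \<in> digit_seqs. \<forall>j\<in>J \<union> K. \<omega> j = (if j \<in> J then a j else b j)}"
    proof -
      have "restrict \<omega> J = a \<longleftrightarrow> (\<forall>j\<in>J. \<omega> j = a j)" "restrict \<omega> K = b \<longleftrightarrow> (\<forall>j\<in>K. \<omega> j = b j)" for \<omega>
        using ab by (auto simp: fun_eq_iff restrict_def PiE_iff extensional_def)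
      moreover have "j \<notin> J" if "j \<in> K" for j using that disj by blast
      ultimately have "?R \<omega> = (a, b) \<longleftrightarrow> (\<forall>j\<in>J \<union> K. \<omega> j = (if j \<in> J then a j else b j))" for \<omega>
        unfolding ball_Un by simp
      then show ?thesis unfolding space_digit by blast
    qed
    moreover have "measure digit_measure {\<omega> \<in> digit_seqs. \<forall>j\<in>J \<union> K. \<omega> j = (if j \<in> J then a j else b j)} = ?q ^ card (J \<union> K)"
      by (rule digit_cylinder(2)) (use J K ab in \<open>auto simp: PiE_iff\<close>)
    ultimately show ?thesis
      unfolding fibre_prob_def using J(1) K(1) disj by (simp add: card_Un_disjoint power_add)
  qed
  have "(\<integral>\<omega>. f \<omega> * g \<omega> \<partial>digit_measure) = (\<integral>\<omega>. (\<lambda>(a, b). F a * G b) (?R \<omega>) \<partial>digit_measure)"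
    by (rule Bochner_Integration.integral_cong) (use F G in \<open>auto simp: space_digit\<close>)
  also have "\<dots> = (\<Sum>y\<in>?A J \<times> ?A K. fibre_prob digit_measure ?R y * (\<lambda>(a, b). F a * G b) y)"
    by (rule digit.integral_simple[OF simple_function_Pair[OF restrict_digits(1)[OF J(1)] restrict_digits(1)[OF K(1)]]
          finite_cartesian_product[OF fin[OF J(1)] fin[OF K(1)]]])
      (intro image_subsetI, simp only: space_digit sub mem_Sigma_iff simp_thms)
  also have "\<dots> = (\<Sum>(a, b)\<in>?A J \<times> ?A K. (?q ^ card J * F a) * (?q ^ card K * G b))"
    by (rule sum.cong) (auto simp: fib)
  also have "\<dots> = (\<Sum>a\<in>?A J. ?q ^ card J * F a) * (\<Sum>b\<in>?A K. ?q ^ card K * G b)"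
    by (simp add: sum_product sum.cartesian_product)
  also have "\<dots> = (\<integral>\<omega>. f \<omega> \<partial>digit_measure) * (\<integral>\<omega>. g \<omega> \<partial>digit_measure)"
    using one[of J f F, OF J(1)] one[of K g G, OF K(1)] F G by simp
  finally show ?thesis .
qed

section \<open>Shifting the digits and second moments\<close>

definition digit_shift :: "nat \<Rightarrow> (int \<Rightarrow> nat) \<Rightarrow> int \<Rightarrow> nat" where
  "digit_shift i \<omega> = (\<lambda>j. \<omega> (j + int i))"

lemma digit_shift_closed: "\<omega> \<in> digit_seqs \<Longrightarrow> digit_shift i \<omega> \<in> digit_seqs"
  by (auto simp: digit_seqs_def digit_shift_def)

text \<open>All coordinates have the same law, and the shift merely reindexes them along an
  injective map.\<close>

lemma distr_digit_shift: "distr digit_measure digit_measure (digit_shift i) = digit_measure"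
proof -
  have "prob_space (uniform_count_measure {1..l})"
    using l_ge_1 by (intro prob_space_uniform_count_measure) auto
  from distr_PiM_reindex[of UNIV "\<lambda>_. uniform_count_measure {1..l}" "\<lambda>j. j + int i" UNIV] this
  show ?thesis by (simp add: digit_measure_def digit_shift_def[abs_def] restrict_UNIV)
qed

lemma measurable_digit_shift: "digit_shift i \<in> measurable digit_measure digit_measure"
  unfolding digit_measure_def digit_shift_def[abs_def]
  by (rule measurable_PiM_single') (auto simp: space_PiM intro: measurable_component_singleton)

lemma integral_digit_shift:
  fixes f :: "(int \<Rightarrow> nat) \<Rightarrow> real"
  assumes "f \<in> borel_measurable digit_measure"
  shows "(\<integral>\<omega>. f (digit_shift i \<omega>) \<partial>digit_measure) = (\<integral>\<omega>. f \<omega> \<partial>digit_measure)"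
  using integral_distr[OF measurable_digit_shift assms, of i] distr_digit_shift[of i] by simp

lemma measure_digit_shift:
  assumes "A \<in> sets digit_measure"
  shows "measure digit_measure {\<omega> \<in> digit_seqs. digit_shift i \<omega> \<in> A} = measure digit_measure A"
proof -
  have "measure digit_measure A = measure (distr digit_measure digit_measure (digit_shift i)) A"
    by (simp add: distr_digit_shift)
  also have "\<dots> = measure digit_measure (digit_shift i -` A \<inter> space digit_measure)"
    by (rule measure_distr[OF measurable_digit_shift assms])
  also have "digit_shift i -` A \<inter> space digit_measure = {\<omega> \<in> digit_seqs. digit_shift i \<omega> \<in> A}"
    by (auto simp: space_digit)
  finally show ?thesis by simp
qed

text \<open>Shifts of \<open>Y\<close> by \<open>i\<close> and \<open>j\<close> read disjoint sets
  of digits once \<open>i\<close> and \<open>j\<close> differ by at least \<open>D\<close>, and then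
  their product has mean 0. Each row of the double sum thus keeps at most \<open>2 * D\<close>
  terms, each at most the square of \<open>B\<close>.\<close>

lemma second_moment:
  fixes Y :: "(int \<Rightarrow> nat) \<Rightarrow> real"
  assumes Y: "depends_on {0..<int D} Y" and b: "\<And>\<omega>. \<omega> \<in> digit_seqs \<Longrightarrow> \<bar>Y \<omega>\<bar> \<le> B"
    and mean: "(\<integral>\<omega>. Y \<omega> \<partial>digit_measure) = 0"
  shows "(\<integral>\<omega>. (\<Sum>j<s. Y (digit_shift j \<omega>))\<^sup>2 \<partial>digit_measure) \<le> 2 * real D * B\<^sup>2 * real s"
proof -
  have dep: "depends_on {int i..<int i + int D} (\<lambda>\<omega>. Y (digit_shift i \<omega>))" for i
    unfolding depends_on_def
  proof (intro ballI impI)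
    fix \<omega> \<omega>' assume w: "\<omega> \<in> digit_seqs" "\<omega>' \<in> digit_seqs" "\<forall>j\<in>{int i..<int i + int D}. \<omega> j = \<omega>' j"
    then have "\<forall>j\<in>{0..<int D}. digit_shift i \<omega> j = digit_shift i \<omega>' j" by (auto simp: digit_shift_def)
    then show "Y (digit_shift i \<omega>) = Y (digit_shift i \<omega>')"
      using Y digit_shift_closed w unfolding depends_on_def by blast
  qed
  have Ym: "Y \<in> borel_measurable digit_measure" using integrable_depends_on[OF _ Y] by auto
  let ?I = "\<lambda>i j. \<integral>\<omega>. Y (digit_shift i \<omega>) * Y (digit_shift j \<omega>) \<partial>digit_measure"
  have int: "integrable digit_measure (\<lambda>\<omega>. Y (digit_shift i \<omega>) * Y (digit_shift j \<omega>))" for i j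
  proof (rule integrable_depends_on)
    show "depends_on ({int i..<int i + int D} \<union> {int j..<int j + int D}) (\<lambda>\<omega>. Y (digit_shift i \<omega>) * Y (digit_shift j \<omega>))"
      using dep[of i] dep[of j] unfolding depends_on_def
      by (intro ballI impI arg_cong2[of _ _ _ _ "(*)"]) (meson UnI1 UnI2)+
  qed simp
  have B0: "B \<ge> 0" using b[of "\<lambda>_. 1"] l_ge_1 by (force simp: digit_seqs_def)
  have zero: "?I i j = 0" if "{int i..<int i + int D} \<inter> {int j..<int j + int D} = {}" for i j
    using integral_mult_disjoint[OF _ dep _ dep that] integral_digit_shift[OF Ym] mean by simp
  have bnd: "?I i j \<le> B\<^sup>2" for i j
  proof -
    have "?I i j \<le> (\<integral>\<omega>. B\<^sup>2 \<partial>digit_measure)"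
    proof (rule integral_mono[OF int])
      fix \<omega> assume "\<omega> \<in> space digit_measure"
      then have "\<bar>Y (digit_shift i \<omega>)\<bar> \<le> B" "\<bar>Y (digit_shift j \<omega>)\<bar> \<le> B"
        using b digit_shift_closed by (auto simp: space_digit)
      then have "\<bar>Y (digit_shift i \<omega>)\<bar> * \<bar>Y (digit_shift j \<omega>)\<bar> \<le> B * B" by (intro mult_mono) auto
      then show "Y (digit_shift i \<omega>) * Y (digit_shift j \<omega>) \<le> B\<^sup>2"
        unfolding power2_eq_square by (metis abs_ge_self abs_mult order_trans)
    qed simp
    then show ?thesis by (simp add: digit.prob_space)
  qed
  have row: "(\<Sum>j<s. ?I i j) \<le> 2 * real D * B\<^sup>2" for i
  proof -
    let ?S = "{j \<in> {..<s}. i < j + D \<and> j < i + D}"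
    have "(\<Sum>j<s. ?I i j) = (\<Sum>j\<in>?S. ?I i j)"
      by (rule sum.mono_neutral_right) (auto intro!: zero)
    also have "\<dots> \<le> (\<Sum>j\<in>?S. B\<^sup>2)" by (intro sum_mono bnd)
    also have "\<dots> = real (card ?S) * B\<^sup>2" by simp
    also have "\<dots> \<le> real (2 * D) * B\<^sup>2"
    proof -
      have "card ?S \<le> card {i + 1 - D..<i + D}" by (rule card_mono) auto
      also have "\<dots> \<le> 2 * D" by simp
      finally show ?thesis by (intro mult_right_mono) auto
    qed
    finally show ?thesis by simp
  qed
  have "(\<integral>\<omega>. (\<Sum>j<s. Y (digit_shift j \<omega>))\<^sup>2 \<partial>digit_measure) = (\<Sum>i<s. \<Sum>j<s. ?I i j)"
    unfolding power2_eq_square sum_product using int by (simp add: Bochner_Integration.integral_sum)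
  also have "\<dots> \<le> (\<Sum>i<s. 2 * real D * B\<^sup>2)" by (intro sum_mono row)
  finally show ?thesis by (simp add: mult_ac)
qed

lemma chebyshev:
  fixes Y :: "(int \<Rightarrow> nat) \<Rightarrow> real"
  assumes Y: "depends_on {0..<int D} Y" and b: "\<And>\<omega>. \<omega> \<in> digit_seqs \<Longrightarrow> \<bar>Y \<omega>\<bar> \<le> B"
    and mean: "(\<integral>\<omega>. Y \<omega> \<partial>digit_measure) = 0" and t: "t > 0"
  shows "measure digit_measure {\<omega> \<in> digit_seqs. \<bar>\<Sum>j<s. Y (digit_shift j \<omega>)\<bar> > t} \<le> 2 * real D * B\<^sup>2 * real s / t\<^sup>2"
proof -
  let ?Z = "\<lambda>\<omega>. \<Sum>j<s. Y (digit_shift j \<omega>)"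
  have dep: "depends_on {0..<int (s + D)} ?Z"
    unfolding depends_on_def
  proof (intro ballI impI sum.cong refl)
    fix \<omega> \<omega>' i assume w: "\<omega> \<in> digit_seqs" "\<omega>' \<in> digit_seqs" "\<forall>j\<in>{0..<int (s + D)}. \<omega> j = \<omega>' j" and i: "i \<in> {..<s}"
    then have "\<forall>j\<in>{0..<int D}. digit_shift i \<omega> j = digit_shift i \<omega>' j" by (auto simp: digit_shift_def)
    then show "Y (digit_shift i \<omega>) = Y (digit_shift i \<omega>')"
      using Y digit_shift_closed w unfolding depends_on_def by blast
  qed
  let ?A = "{\<omega> \<in> digit_seqs. \<bar>?Z \<omega>\<bar> > t}"
  have A: "?A \<in> sets digit_measure"
    by (rule depends_on_sets[OF _ depends_on_compose[OF dep, of "\<lambda>z. \<bar>z\<bar> > t"]]) simp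
  have intZ: "integrable digit_measure (\<lambda>\<omega>. (?Z \<omega>)\<^sup>2)"
    by (rule integrable_depends_on[OF _ depends_on_compose[OF dep, of "\<lambda>z. z\<^sup>2"]]) simp
  have "measure digit_measure ?A * t\<^sup>2 = (\<integral>\<omega>. indicator ?A \<omega> * t\<^sup>2 \<partial>digit_measure)"
    using A sets.sets_into_space[OF A] by (simp add: Int_absorb2)
  also have "\<dots> \<le> (\<integral>\<omega>. (?Z \<omega>)\<^sup>2 \<partial>digit_measure)"
  proof (rule integral_mono[OF _ intZ])
    show "integrable digit_measure (\<lambda>\<omega>. indicator ?A \<omega> * t\<^sup>2)"
      using A by (intro integrable_mult_left integrable_real_indicator) (auto simp: digit.emeasure_eq_measure)
    fix \<omega>
    have "t\<^sup>2 \<le> \<bar>?Z \<omega>\<bar>\<^sup>2" if "\<bar>?Z \<omega>\<bar> > t" using that t by (intro power_mono) auto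
    then show "indicator ?A \<omega> * t\<^sup>2 \<le> (?Z \<omega>)\<^sup>2" by (auto simp: indicator_def)
  qed
  also have "\<dots> \<le> 2 * real D * B\<^sup>2 * real s" using Y b mean by (rule second_moment)
  finally show ?thesis using t by (simp add: pos_le_divide_eq)
qed

end

section \<open>Concatenations of words of equal length\<close>

lemma length_concat_uniform:
  "\<forall>u\<in>set us. length u = N \<Longrightarrow> length (concat us) = length us * N"
  by (induction us) auto

lemma nth_concat_uniform:
  assumes "\<forall>u\<in>set us. length u = N" "p < length us * N"
  shows "concat us ! p = us ! (p div N) ! (p mod N)"
  using assms
proof (induction us arbitrary: p)
  case (Cons u us)
  show ?case
  proof (cases "p < N")
    case True
    then show ?thesis using Cons.prems by (simp add: nth_append)
  next
    case False
    then have N: "N > 0" "p \<ge> N" using Cons.prems by (auto intro: Nat.gr0I)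
    have "concat (u # us) ! p = us ! ((p - N) div N) ! ((p - N) mod N)"
      using Cons N by (simp add: nth_append)
    also have "(p - N) mod N = p mod N" using N by (simp add: le_mod_geq)
    also have "us ! ((p - N) div N) = (u # us) ! (p div N)" using N by (simp add: le_div_geq)
    finally show ?thesis .
  qed
qed simp

lemma take_drop_sublist: "sublist (take n (drop k xs)) xs"
  by (metis append_take_drop_id sublist_def append.assoc)

locale uniform_code = uniform_digits l for l :: nat +
  fixes N :: nat and w :: "nat \<Rightarrow> 'a::finite list"
  assumes N_pos: "N \<ge> 1" and inj_w: "inj_on w {1..l}"
    and length_w: "\<And>j. j \<in> {1..l} \<Longrightarrow> length (w j) = N"
begin

definition code_words :: "'a list set" where
  "code_words = {u. u \<noteq> [] \<and> (\<exists>js. set js \<subseteq> {1..l} \<and> sublist u (concat (map w js)))}"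

definition code_shift :: "(int \<Rightarrow> 'a) set" where
  "code_shift = {x. \<forall>k m. k \<le> m \<longrightarrow> window x k m \<in> code_words}"

text \<open>The bi-infinite concatenation of the words \<open>w (\<omega> j)\<close>; the phase \<open>k\<close> is the position of the origin in block \<open>0\<close>.\<close>

definition decode :: "nat \<Rightarrow> (int \<Rightarrow> nat) \<Rightarrow> int \<Rightarrow> 'a" where
  "decode k \<omega> i = w (\<omega> ((i + int k) div int N)) ! nat ((i + int k) mod int N)"

text \<open>Phases are not restricted to values below \<open>N\<close>, because shifting raises the
  phase by one; here a surplus of whole blocks is traded for a shift of the digits.\<close>

lemma decode_add_mult: "decode (k + s * N) \<omega> = decode k (digit_shift s \<omega>)"
proof
  fix i
  have 1: "i + int (k + s * N) = (i + int k) + int s * int N" by simp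
  have 2: "((i + int k) + int s * int N) div int N = (i + int k) div int N + int s" using N_pos by simp
  show "decode (k + s * N) \<omega> i = decode k (digit_shift s \<omega>) i"
    unfolding decode_def digit_shift_def 1 2 by simp
qed

lemma decode_add_N: "decode (k + N) \<omega> = decode k (digit_shift 1 \<omega>)"
  using decode_add_mult[of k 1] by simp

lemma shift_decode: "shift_map (decode k \<omega>) = decode (Suc k) \<omega>"
  by (simp add: shift_map_def decode_def fun_eq_iff algebra_simps)

lemma window_shift_decode: "window (decode k \<omega>) (int i) (int i + m) = window (decode (k + i) \<omega>) 0 m"
proof -
  have "(shift_map ^^ i) (decode k \<omega>) = decode (k + i) \<omega>"
    by (induction i) (auto simp: shift_decode)
  then show ?thesis using window_shift_pow[of i "decode k \<omega>" 0 m] by (simp add: add.commute)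
qed

lemma window_decode_cong:
  assumes "\<And>j. j \<in> {(a + int k) div int N..(b + int k) div int N} \<Longrightarrow> \<omega> j = \<omega>' j"
  shows "window (decode k \<omega>) a b = window (decode k \<omega>') a b"
  unfolding window_eq_iff
proof
  fix i assume "i \<in> {a..b}"
  then have "(i + int k) div int N \<in> {(a + int k) div int N..(b + int k) div int N}"
    using N_pos by (auto intro: zdiv_mono1)
  then show "decode k \<omega> i = decode k \<omega>' i" using assms by (simp add: decode_def)
qed

lemma window_decode_concat:
  assumes "set js \<subseteq> {1..l}" "k + n \<le> length js * N" "\<And>j. j < length js \<Longrightarrow> \<omega> (int j) = js ! j"
  shows "window (decode k \<omega>) 0 (int n - 1) = take n (drop k (concat (map w js)))"
proof (rule nth_equalityI)
  have uni: "\<forall>u\<in>set (map w js). length u = N" using assms(1) length_w by auto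
  have len: "length (concat (map w js)) = length js * N" using length_concat_uniform[OF uni] by simp
  then show "length (window (decode k \<omega>) 0 (int n - 1)) = length (take n (drop k (concat (map w js))))"
    using assms(2) by simp
  fix i assume "i < length (window (decode k \<omega>) 0 (int n - 1))"
  then have i: "i < n" by simp
  have lt: "(i + k) div N < length js"
    using i assms(2) N_pos by (simp add: div_less_iff_less_mult)
  have "window (decode k \<omega>) 0 (int n - 1) ! i = decode k \<omega> (int i)"
    using i by (simp add: window_nth)
  also have "\<dots> = w (\<omega> (int ((i + k) div N))) ! ((i + k) mod N)"
    by (simp add: decode_def zdiv_int nat_mod_as_int flip: of_nat_add)
  also have "\<dots> = map w js ! ((i + k) div N) ! ((i + k) mod N)" using assms(3)[OF lt] lt by simp
  also have "\<dots> = concat (map w js) ! (i + k)"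
    using nth_concat_uniform[OF uni, of "i + k"] i assms(2) by simp
  also have "\<dots> = take n (drop k (concat (map w js))) ! i" using i len assms(2) by (simp add: add.commute)
  finally show "window (decode k \<omega>) 0 (int n - 1) ! i = take n (drop k (concat (map w js))) ! i" .
qed

lemma decode_in_code_shift:
  assumes \<omega>: "\<omega> \<in> digit_seqs"
  shows "decode k \<omega> \<in> code_shift"
  unfolding code_shift_def
proof (intro CollectI allI impI)
  fix a b :: int assume ab: "a \<le> b"
  define n where "n = nat (b - a + 1)"
  have n: "n \<ge> 1" "b = a + (int n - 1)" using ab by (auto simp: n_def)
  \<comment> \<open>Coordinates are re-based at the block \<open>q\<close> that contains position
    \<open>a\<close>, so that the window starts at 0 in phase \<open>k'\<close>.\<close>
  define k' where "k' = nat ((a + int k) mod int N)"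
  define q where "q = (a + int k) div int N"
  define \<omega>' where "\<omega>' = (\<lambda>j. \<omega> (j + q))"
  have k': "int k' = (a + int k) mod int N" using N_pos by (simp add: k'_def)
  have eq: "a + int k = q * int N + int k'" unfolding q_def k' by simp
  have dec: "decode k \<omega> (a + i) = decode k' \<omega>' i" for i
  proof -
    have 1: "a + i + int k = (i + int k') + q * int N" using eq by simp
    have 2: "((i + int k') + q * int N) div int N = (i + int k') div int N + q" using N_pos by simp
    show ?thesis unfolding decode_def \<omega>'_def 1 2 by simp
  qed
  \<comment> \<open>As every block has at least one letter, \<open>k' + n\<close> blocks surely
    cover the window.\<close>
  define js where "js = map (\<lambda>j. \<omega>' (int j)) [0..<k' + n]"
  have js: "set js \<subseteq> {1..l}" using \<omega> by (auto simp: js_def \<omega>'_def digit_seqs_def)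
  have "window (decode k \<omega>) a b = window (decode k' \<omega>') 0 (int n - 1)"
    by (rule nth_equalityI) (use n dec in \<open>auto simp: window_nth\<close>)
  also have "\<dots> = take n (drop k' (concat (map w js)))"
    by (rule window_decode_concat[OF js]) (use N_pos in \<open>auto simp: js_def\<close>)
  finally have "sublist (window (decode k \<omega>) a b) (concat (map w js))"
    using take_drop_sublist by metis
  moreover have "window (decode k \<omega>) a b \<noteq> []" using ab by (simp add: window_def)
  ultimately show "window (decode k \<omega>) a b \<in> code_words" unfolding code_words_def using js by blast
qed

text \<open>The length of the part before \<open>u\<close> in the concatenation serves as the phase
  and is then reduced modulo \<open>N\<close>; digits outside the list are set to 1.\<close>

lemma code_words_decode:
  assumes u: "u \<in> code_words"
  obtains k \<omega> where "k < N" "\<omega> \<in> digit_seqs" "u = window (decode k \<omega>) 0 (int (length u) - 1)"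
proof -
  obtain js ps ss where js: "set js \<subseteq> {1..l}" "concat (map w js) = ps @ u @ ss"
    using u by (auto simp: code_words_def sublist_def)
  define n where "n = length u"
  have len: "length (concat (map w js)) = length js * N"
    using length_concat_uniform[of "map w js" N] js(1) length_w by (simp add: subset_iff)
  have u_eq: "u = take n (drop (length ps) (concat (map w js)))" by (simp add: js(2) n_def)
  have bd: "length ps + n \<le> length js * N" using len by (simp add: js(2) n_def)
  define \<omega> where "\<omega> = (\<lambda>j. if 0 \<le> j \<and> nat j < length js then js ! nat j else 1)"
  have \<omega>: "\<omega> \<in> digit_seqs"
  proof -
    have "\<omega> j \<in> {1..l}" for j
      using subsetD[OF js(1) nth_mem[of "nat j" js]] l_ge_1 unfolding \<omega>_def by auto
    then show ?thesis by (simp add: digit_seqs_def)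
  qed
  have "u = window (decode (length ps) \<omega>) 0 (int n - 1)"
    unfolding u_eq by (subst window_decode_concat[OF js(1) bd]) (auto simp: \<omega>_def)
  also have "length ps = length ps mod N + length ps div N * N" by simp
  then have "decode (length ps) \<omega> = decode (length ps mod N) (digit_shift (length ps div N) \<omega>)"
    using decode_add_mult by metis
  finally show ?thesis
    using that[of "length ps mod N" "digit_shift (length ps div N) \<omega>"] N_pos digit_shift_closed[OF \<omega>]
    by (simp add: n_def)
qed

lemma code_shift_subshift: "is_subshift code_shift"
  unfolding is_subshift_def
proof (intro conjI)
  have "(\<lambda>_. 1) \<in> digit_seqs" using l_ge_1 by (simp add: digit_seqs_def)
  then show "code_shift \<noteq> {}" using decode_in_code_shift by blast
  have "openin fullshift_topology (- code_shift)"
  proof -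
    have "- code_shift = (\<Union>(k, m)\<in>{(k, m). k \<le> m}. {x. window x k m \<in> - code_words})"
      by (auto simp: code_shift_def)
    moreover have "openin fullshift_topology (\<Union>(k, m)\<in>{(k, m). k \<le> m}. {x. window x k m \<in> - code_words})"
      by (intro openin_Union ballI) (clarsimp simp only: image_iff openin_window)
    ultimately show ?thesis by simp
  qed
  then show "closedin fullshift_topology code_shift"
    by (simp add: closedin_def Compl_eq_Diff_UNIV)
  show "shift_map ` code_shift = code_shift"
  proof (intro equalityI subsetI)
    fix x assume "x \<in> shift_map ` code_shift"
    then show "x \<in> code_shift" by (auto simp: code_shift_def window_shift)
  next
    fix x assume x: "x \<in> code_shift"
    define y where "y = (\<lambda>i. x (i - 1))"
    have "window y k m = window x (k - 1) (m - 1)" for k m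
      by (rule nth_equalityI) (auto simp: window_nth y_def algebra_simps)
    then have "y \<in> code_shift" using x by (auto simp: code_shift_def)
    moreover have "x = shift_map y" by (simp add: shift_map_def y_def)
    ultimately show "x \<in> shift_map ` code_shift" by blast
  qed
qed

text \<open>Concatenating from a fixed phase gives a law that is invariant under the
  \<open>N\<close>-th power of the shift; drawing the phase uniformly averages over the residues and
  makes it invariant under the shift itself.\<close>

definition code_measure :: "(int \<Rightarrow> 'a) measure" where
  "code_measure = distr (measure_pmf (pmf_of_set {..<N}) \<Otimes>\<^sub>M digit_measure) (shift_borel code_shift)
    (\<lambda>(k, \<omega>). decode k \<omega>)"

lemma decode_window_depends:
  "depends_on {(a + int k) div int N..(b + int k) div int N} (\<lambda>\<omega>. window (decode k \<omega>) a b)"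
  unfolding depends_on_def using window_decode_cong by blast

lemma measurable_decode: "decode k \<in> measurable digit_measure (shift_borel code_shift)"
proof (rule measurable_sigma_sets[where \<Omega> = code_shift and A = "cylinder_algebra code_shift"])
  show "sets (shift_borel code_shift) = sigma_sets code_shift (cylinder_algebra code_shift)"
    by (rule sets_shift_borel_cylinders)
  show "cylinder_algebra code_shift \<subseteq> Pow code_shift" by (auto simp: cylinder_algebra_def)
  show "decode k \<in> space digit_measure \<rightarrow> code_shift" by (auto simp: space_digit decode_in_code_shift)
  fix A assume "A \<in> cylinder_algebra code_shift"
  then obtain m S where A: "A = code_shift \<inter> {x. window x (- int m) (int m) \<in> S}"
    by (auto simp: cylinder_algebra_def)
  have "decode k -` A \<inter> space digit_measure = {\<omega> \<in> digit_seqs. window (decode k \<omega>) (- int m) (int m) \<in> S}"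
    by (auto simp: A space_digit decode_in_code_shift)
  then show "decode k -` A \<inter> space digit_measure \<in> sets digit_measure"
    using depends_on_sets[OF _ depends_on_compose[OF decode_window_depends, where g = "\<lambda>u. u \<in> S"]] by simp
qed

lemma measurable_decode_pair:
  "(\<lambda>(k, \<omega>). decode k \<omega>) \<in> measurable (measure_pmf (pmf_of_set {..<N}) \<Otimes>\<^sub>M digit_measure) (shift_borel code_shift)"
proof -
  have "(\<lambda>(k, \<omega>). decode k \<omega>) \<in> measurable (count_space UNIV \<Otimes>\<^sub>M digit_measure) (shift_borel code_shift)"
    by (rule measurable_pair_measure_countable1) (auto simp: measurable_decode)
  moreover have "sets (measure_pmf (pmf_of_set {..<N}) \<Otimes>\<^sub>M digit_measure) = sets (count_space UNIV \<Otimes>\<^sub>M digit_measure)"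
    by (rule sets_pair_measure_cong) auto
  ultimately show ?thesis using measurable_cong_sets by blast
qed

lemma decode_vimage_sets: "A \<in> sets (shift_borel code_shift) \<Longrightarrow> {\<omega> \<in> digit_seqs. decode k \<omega> \<in> A} \<in> sets digit_measure"
  using measurable_sets[OF measurable_decode, of A k] by (simp add: space_digit vimage_def Int_def conj_commute)

lemma prob_space_code: "prob_space code_measure"
proof -
  interpret pair_prob_space "measure_pmf (pmf_of_set {..<N})" digit_measure
    by (simp add: pair_prob_space_def pair_sigma_finite_def measure_pmf.prob_space_axioms digit.prob_space_axioms
        measure_pmf.sigma_finite_measure_axioms digit.sigma_finite_measure_axioms)
  show ?thesis unfolding code_measure_def by (rule prob_space_distr[OF measurable_decode_pair])
qed

lemma sets_code_measure: "sets code_measure = sets (shift_borel code_shift)"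
  by (simp add: code_measure_def)

lemma measure_code:
  assumes A: "A \<in> sets (shift_borel code_shift)"
  shows "measure code_measure A = (\<Sum>k<N. measure digit_measure {\<omega> \<in> digit_seqs. decode k \<omega> \<in> A}) / real N"
proof -
  interpret prob_space code_measure by (rule prob_space_code)
  let ?P = "measure_pmf (pmf_of_set {..<N}) \<Otimes>\<^sub>M digit_measure"
  let ?f = "\<lambda>(k, \<omega>). decode k \<omega>"
  have "emeasure code_measure A = emeasure ?P (?f -` A \<inter> space ?P)"
    unfolding code_measure_def by (rule emeasure_distr[OF measurable_decode_pair A])
  also have "\<dots> = (\<integral>\<^sup>+k. emeasure digit_measure (Pair k -` (?f -` A \<inter> space ?P)) \<partial>measure_pmf (pmf_of_set {..<N}))"
    by (rule digit.emeasure_pair_measure_alt) (rule measurable_sets[OF measurable_decode_pair A])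
  also have "\<dots> = (\<integral>\<^sup>+k. ennreal (measure digit_measure {\<omega> \<in> digit_seqs. decode k \<omega> \<in> A}) \<partial>measure_pmf (pmf_of_set {..<N}))"
  proof (rule nn_integral_cong)
    fix k
    have "Pair k -` (?f -` A \<inter> space ?P) = {\<omega> \<in> digit_seqs. decode k \<omega> \<in> A}"
      by (auto simp: space_pair_measure space_digit)
    then show "emeasure digit_measure (Pair k -` (?f -` A \<inter> space ?P)) = ennreal (measure digit_measure {\<omega> \<in> digit_seqs. decode k \<omega> \<in> A})"
      by (simp add: digit.emeasure_eq_measure)
  qed
  also have "\<dots> = (\<Sum>k<N. ennreal (measure digit_measure {\<omega> \<in> digit_seqs. decode k \<omega> \<in> A})) / real N"
    using N_pos by (subst nn_integral_pmf_of_set) (auto simp: ennreal_of_nat_eq_real_of_nat lessThan_empty_iff)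
  also have "\<dots> = ennreal ((\<Sum>k<N. measure digit_measure {\<omega> \<in> digit_seqs. decode k \<omega> \<in> A}) / real N)"
    using N_pos by (simp add: divide_ennreal ennreal_of_nat_eq_real_of_nat sum_nonneg)
  finally show ?thesis
    by (simp add: emeasure_eq_measure sum_nonneg)
qed

text \<open>Shifting turns the phases 0, ..., N - 1 into 1, ..., N. Phase \<open>N\<close> is phase
  0 with the digits shifted by one, which has the same law.\<close>

lemma invariant_code: "invariant_prob code_shift code_measure"
  unfolding invariant_prob_def
proof (intro conjI ballI)
  interpret prob_space code_measure by (rule prob_space_code)
  show "sets code_measure = sets (shift_borel code_shift)" by (rule sets_code_measure)
  show "prob_space code_measure" by (rule prob_space_code)
  fix A assume "A \<in> sets code_measure"
  then have A: "A \<in> sets (shift_borel code_shift)" by (simp add: sets_code_measure)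
  let ?g = "\<lambda>k. measure digit_measure {\<omega> \<in> digit_seqs. decode k \<omega> \<in> A}"
  have A': "shift_map -` A \<inter> code_shift \<in> sets (shift_borel code_shift)"
    using measurable_sets[OF measurable_shift_map A] code_shift_subshift by (simp add: is_subshift_def)
  have gS: "measure digit_measure {\<omega> \<in> digit_seqs. decode k \<omega> \<in> shift_map -` A \<inter> code_shift} = ?g (Suc k)" for k
    by (rule arg_cong[where f = "measure digit_measure"]) (auto simp: shift_decode decode_in_code_shift)
  have "{\<omega> \<in> digit_seqs. decode N \<omega> \<in> A} = {\<omega> \<in> digit_seqs. digit_shift 1 \<omega> \<in> {\<omega> \<in> digit_seqs. decode 0 \<omega> \<in> A}}"
    using decode_add_N[of 0] digit_shift_closed by auto
  then have gN: "?g N = ?g 0" using measure_digit_shift[OF decode_vimage_sets[OF A], of 1 0] by simp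
  have "(\<Sum>k<N. ?g (Suc k)) = (\<Sum>k<N. ?g k)"
    using sum.lessThan_Suc_shift[of ?g N] gN by simp
  then have "measure code_measure (shift_map -` A \<inter> code_shift) = measure code_measure A"
    unfolding measure_code[OF A'] measure_code[OF A] gS by simp
  then show "emeasure code_measure (shift_map -` A \<inter> code_shift) = emeasure code_measure A"
    by (simp add: emeasure_eq_measure)
qed

sublocale code: shift_invariant_prob code_measure code_shift
proof -
  have "shift_map ` code_shift = code_shift" using code_shift_subshift by (simp add: is_subshift_def)
  then show "shift_invariant_prob code_measure code_shift"
    by (simp add: shift_invariant_prob_def shift_invariant_prob_axioms_def prob_space_code invariant_code)
qed

section \<open>Two-sided bounds for word probabilities\<close>

abbreviation word_prob :: "nat \<Rightarrow> 'a list \<Rightarrow> real" where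
  "word_prob n \<equiv> fibre_prob code_measure (\<lambda>x. window x 0 (int n - 1))"

lemma word_prob_eq:
  "word_prob n v = (\<Sum>k<N. measure digit_measure {\<omega> \<in> digit_seqs. window (decode k \<omega>) 0 (int n - 1) = v}) / real N"
proof -
  have "(\<lambda>x. window x 0 (int n - 1)) -` {v} \<inter> space code_measure = code_shift \<inter> {x. window x 0 (int n - 1) \<in> {v}}"
    by (auto simp: code.space_M)
  moreover have "measure code_measure (code_shift \<inter> {x. window x 0 (int n - 1) \<in> {v}})
    = (\<Sum>k<N. measure digit_measure {\<omega> \<in> digit_seqs. decode k \<omega> \<in> code_shift \<inter> {x. window x 0 (int n - 1) \<in> {v}}}) / real N"
    by (rule measure_code[OF window_in_shift_borel])
  moreover have "{\<omega> \<in> digit_seqs. decode k \<omega> \<in> code_shift \<inter> {x. window x 0 (int n - 1) \<in> {v}}}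
      = {\<omega> \<in> digit_seqs. window (decode k \<omega>) 0 (int n - 1) = v}" for k
    by (auto simp: decode_in_code_shift)
  ultimately show ?thesis by (simp add: fibre_prob_def)
qed

text \<open>A code word is read in some phase \<open>k\<close> below \<open>N\<close>. Fixing the
  digits 0, ..., r of the blocks that it meets forces the word, and \<open>r + 1\<close> is at most
  \<open>n / N + 2\<close>. The factor \<open>1 / N\<close> is the probability of the phase.\<close>

lemma word_prob_lower:
  assumes u: "u \<in> code_words"
  shows "exp (- 2 * ln (real l)) / real N * exp (- (ln (real l) / real N) * real (length u)) \<le> word_prob (length u) u"
proof -
  obtain k \<omega> where k: "k < N" "\<omega> \<in> digit_seqs" and ueq: "u = window (decode k \<omega>) 0 (int (length u) - 1)"
    using code_words_decode[OF u] by blast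
  define n where "n = length u"
  have u': "u = window (decode k \<omega>) 0 (int n - 1)" using ueq by (simp add: n_def)
  have n: "n \<ge> 1" using u by (cases u) (auto simp: code_words_def n_def)
  define r where "r = (n - 1 + k) div N"
  have rint: "(int n - 1 + int k) div int N = int r"
    using n by (simp add: r_def zdiv_int of_nat_diff algebra_simps)
  have l0: "real l > 0" "ln (real l) \<ge> 0" using l_ge_1 by auto
  have "real r \<le> (real n + real N) / real N"
  proof -
    have "r * N \<le> n - 1 + k" unfolding r_def by (rule div_times_less_eq_dividend)
    then have "r * N \<le> n + N" using k(1) by linarith
    then have "real r * real N \<le> real n + real N" by (metis of_nat_add of_nat_le_iff of_nat_mult)
    then show ?thesis using N_pos by (simp add: pos_le_divide_eq)
  qed
  then have r: "real (r + 1) \<le> real n / real N + 2" using N_pos by (simp add: add_divide_distrib)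
  have "exp (- 2 * ln (real l)) * exp (- (ln (real l) / real N) * real n) = exp (- ((real n / real N + 2) * ln (real l)))"
    unfolding exp_add[symmetric] by (simp add: algebra_simps)
  also have "\<dots> \<le> exp (- (real (r + 1) * ln (real l)))"
    using mult_right_mono[OF r l0(2)] by simp
  also have "\<dots> = (1 / real l) ^ (r + 1)"
    using l0(1) by (simp add: exp_minus exp_of_nat_mult[of "r + 1"] exp_of_nat_mult power_one_over inverse_eq_divide del: power_Suc of_nat_Suc of_nat_add)
  also have "\<dots> = measure digit_measure {\<omega>' \<in> digit_seqs. \<forall>j\<in>{0..int r}. \<omega>' j = \<omega> j}"
    using digit_cylinder(2)[of "{0..int r}" \<omega>] k(2) by (simp add: digit_seqs_def nat_add_distrib)
  also have "\<dots> \<le> measure digit_measure {\<omega>' \<in> digit_seqs. window (decode k \<omega>') 0 (int n - 1) = u}"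
  proof (rule digit.finite_measure_mono)
    show "{\<omega>' \<in> digit_seqs. \<forall>j\<in>{0..int r}. \<omega>' j = \<omega> j} \<subseteq> {\<omega>' \<in> digit_seqs. window (decode k \<omega>') 0 (int n - 1) = u}"
    proof clarify
      fix \<omega>' assume *: "\<forall>j\<in>{0..int r}. \<omega>' j = \<omega> j"
      have "window (decode k \<omega>') 0 (int n - 1) = window (decode k \<omega>) 0 (int n - 1)"
        by (rule window_decode_cong) (use * rint k(1) in simp)
      then show "window (decode k \<omega>') 0 (int n - 1) = u" using u' by simp
    qed
    show "{\<omega>' \<in> digit_seqs. window (decode k \<omega>') 0 (int n - 1) = u} \<in> digit.events"
      by (rule depends_on_sets[OF _ depends_on_compose[OF decode_window_depends, where g = "\<lambda>v. v = u"]]) simp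
  qed
  also have "\<dots> \<le> (\<Sum>k<N. measure digit_measure {\<omega>' \<in> digit_seqs. window (decode k \<omega>') 0 (int n - 1) = u})"
    by (rule member_le_sum) (use k(1) in auto)
  finally have "exp (- 2 * ln (real l)) * exp (- (ln (real l) / real N) * real n) / real N \<le> word_prob n u"
    unfolding word_prob_eq by (rule divide_right_mono) simp
  then show ?thesis by (simp add: n_def)
qed

text \<open>In a fixed phase the window shows all letters of its complete blocks, and injectivity of
  \<open>w\<close> recovers their digits. There are at least \<open>n / N - 2\<close> of them, in
  every phase, so the average over the phases obeys the same bound.\<close>

lemma word_prob_upper:
  assumes n: "n \<ge> 1"
  shows "word_prob n v \<le> exp (2 * ln (real l)) * exp (- (ln (real l) / real N) * real n)"
proof -
  have l0: "real l > 0" "ln (real l) \<ge> 0" using l_ge_1 by auto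
  have "measure digit_measure {\<omega> \<in> digit_seqs. window (decode k \<omega>) 0 (int n - 1) = v}
      \<le> exp (2 * ln (real l)) * exp (- (ln (real l) / real N) * real n)" (is "?m \<le> ?b") if k: "k < N" for k
  proof (cases "{\<omega> \<in> digit_seqs. window (decode k \<omega>) 0 (int n - 1) = v} = {}")
    case True
    show ?thesis unfolding True by simp
  next
    case False
    then obtain \<omega> where \<omega>: "\<omega> \<in> digit_seqs" "window (decode k \<omega>) 0 (int n - 1) = v" by blast
    \<comment> \<open>Blocks 1, ..., s are complete: block 0 may be cut on the left and block
      \<open>(n + k) div N\<close> on the right. For short windows the truncated subtraction gives 0
      and no digit is claimed.\<close>
    define s where "s = (n + k) div N - 1"
    have s: "real n / real N - 2 \<le> real s"
    proof -
      have "n + k < N + (n + k) div N * N" by (rule dividend_less_div_times) (use N_pos in simp)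
      then have "n < (s + 2) * N" unfolding s_def by (cases "(n + k) div N") auto
      then have "real n < real ((s + 2) * N)" by (simp only: of_nat_less_iff)
      then have "real n / real N < real (s + 2)" using N_pos by (simp add: pos_divide_less_eq distrib_right)
      then show ?thesis by simp
    qed
    have det: "\<omega>' j = \<omega> j" if \<omega>': "\<omega>' \<in> digit_seqs" "window (decode k \<omega>') 0 (int n - 1) = v" and j: "j \<in> {1..int s}" for \<omega>' j
    proof -
      have "w (\<omega>' j) = w (\<omega> j)"
      proof (rule nth_equalityI)
        have len: "length (w (\<omega>' j)) = N" "length (w (\<omega> j)) = N" using \<omega>' \<omega> length_w by (auto simp: digit_seqs_def)
        then show "length (w (\<omega>' j)) = length (w (\<omega> j))" by simp
        fix t assume "t < length (w (\<omega>' j))"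
        then have t: "t < N" using len by simp
        \<comment> \<open>The position in the window of letter \<open>t\<close> of block
          \<open>j\<close>.\<close>
        define i where "i = j * int N + int t - int k"
        have ik: "i + int k = int t + j * int N" by (simp add: i_def)
        have "1 * int N \<le> j * int N" using j by (intro mult_right_mono) auto
        then have i0: "i \<ge> 0" using k unfolding i_def by linarith
        have "int s + 1 \<le> int ((n + k) div N)" using j unfolding s_def by auto
        then have "(int s + 1) * int N \<le> int ((n + k) div N) * int N" by (rule mult_right_mono) simp
        also have "\<dots> \<le> int (n + k)" by (metis div_times_less_eq_dividend of_nat_le_iff of_nat_mult)
        finally have "(int s + 1) * int N \<le> int n + int k" by simp
        moreover have "(j + 1) * int N \<le> (int s + 1) * int N" using j by (intro mult_right_mono) auto
        moreover have "i + int k < (j + 1) * int N" using t by (simp add: ik algebra_simps)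
        ultimately have "i \<in> {0..int n - 1}" using i0 by simp
        then have "decode k \<omega>' i = decode k \<omega> i" using \<omega>(2) \<omega>'(2) unfolding window_eq_iff[symmetric] by (metis window_eq_iff)
        then show "w (\<omega>' j) ! t = w (\<omega> j) ! t" unfolding decode_def ik using t by simp
      qed
      then show ?thesis using inj_w \<omega>' \<omega> by (auto simp: digit_seqs_def dest: inj_onD)
    qed
    have "?m \<le> measure digit_measure {\<omega>' \<in> digit_seqs. \<forall>j\<in>{1..int s}. \<omega>' j = \<omega> j}"
      by (rule digit.finite_measure_mono) (use det digit_cylinder(1)[of "{1..int s}" \<omega>] \<omega>(1) in \<open>auto simp: digit_seqs_def\<close>)
    also have "\<dots> = (1 / real l) ^ s"
      using digit_cylinder(2)[of "{1..int s}" \<omega>] \<omega>(1) by (simp add: digit_seqs_def)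
    also have "\<dots> = exp (- (real s * ln (real l)))"
      using l0(1) by (simp add: exp_minus exp_of_nat_mult power_one_over inverse_eq_divide)
    also have "\<dots> \<le> exp (- ((real n / real N - 2) * ln (real l)))" using mult_right_mono[OF s l0(2)] by simp
    also have "\<dots> = ?b" unfolding exp_add[symmetric] by (simp add: algebra_simps)
    finally show ?thesis .
  qed
  then have "(\<Sum>k<N. measure digit_measure {\<omega> \<in> digit_seqs. window (decode k \<omega>) 0 (int n - 1) = v})
      \<le> (\<Sum>k<N. exp (2 * ln (real l)) * exp (- (ln (real l) / real N) * real n))" by (intro sum_mono) auto
  then have "(\<Sum>k<N. measure digit_measure {\<omega> \<in> digit_seqs. window (decode k \<omega>) 0 (int n - 1) = v})
      \<le> (exp (2 * ln (real l)) * exp (- (ln (real l) / real N) * real n)) * real N" by (simp add: mult.commute)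
  then show ?thesis unfolding word_prob_eq using N_pos by (subst pos_divide_le_eq) auto
qed

end

section \<open>The uniform block measure is a Gibbs measure\<close>

context uniform_code
begin

lemma sum_decode_period:
  fixes g :: "nat \<Rightarrow> real"
  assumes "\<And>k. g (k + N) = g k"
  shows "(\<Sum>i<N. g (k + i)) = (\<Sum>i<N. g i)"
proof (induction k)
  case (Suc k)
  have "(\<Sum>i<N. g (Suc k + i)) = (\<Sum>i<N. g (k + Suc i))" by simp
  also have "\<dots> = (\<Sum>i<Suc N. g (k + i)) - g (k + 0)" by (subst sum.lessThan_Suc_shift) simp
  also have "\<dots> = (\<Sum>i<N. g (k + i))" using assms[of k] by simp
  finally show ?case using Suc by simp
qed simp

text \<open>The starting positions are grouped into \<open>s\<close> runs of length
  \<open>N\<close>. The count in one run depends on boundedly many digits, and its mean is exactly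
  \<open>N * p\<close>, because a run passes through every phase once. The centred counts are shifts
  of one function, to which \<open>chebyshev\<close> applies.\<close>

lemma code_weak_lln:
  assumes v: "length v \<ge> 1" and \<delta>: "\<delta> > 0" and \<eta>: "\<eta> > 0"
  shows "\<exists>n\<ge>1. measure code_measure {x \<in> code_shift. \<bar>word_avg v n x - word_prob (length v) v\<bar> > \<delta>} \<le> \<eta>"
proof -
  define m where "m = length v"
  define p where "p = word_prob m v"
  define hit where "hit = (\<lambda>k \<omega>. if window (decode k \<omega>) 0 (int m - 1) = v then 1 else 0 :: real)"
  define Y where "Y = (\<lambda>k \<omega>. (\<Sum>i<N. hit (k + i) \<omega>) - real N * p)"
  \<comment> \<open>The phase of a window in the first run is below \<open>2 * N\<close>, so its
    last letter lies before position \<open>(m + 2) * N\<close> of the concatenation.\<close>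
  define D where "D = m + 2"
  \<comment> \<open>Chosen so that the resulting bound \<open>2 * D / (\<delta>\<^sup>2 * s)\<close>
    is at most \<open>\<eta>\<close>; the added 1 keeps \<open>s\<close> positive.\<close>
  define s where "s = nat \<lceil>2 * real D / (\<delta>\<^sup>2 * \<eta>)\<rceil> + 1"
  have p01: "0 \<le> p" "p \<le> 1" by (auto simp: p_def fibre_prob_def)
  have hit_int: "(\<integral>\<omega>. hit k \<omega> \<partial>digit_measure) = measure digit_measure {\<omega> \<in> digit_seqs. window (decode k \<omega>) 0 (int m - 1) = v}" (is "_ = ?g k") for k
  proof -
    let ?A = "{\<omega> \<in> digit_seqs. window (decode k \<omega>) 0 (int m - 1) = v}"
    have "?A \<in> sets digit_measure"
      by (rule depends_on_sets[OF _ depends_on_compose[OF decode_window_depends, where g = "\<lambda>u. u = v"]]) simp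
    then have "?g k = (\<integral>\<omega>. indicator ?A \<omega> \<partial>digit_measure)" using sets.sets_into_space by (simp add: Int_absorb2)
    also have "\<dots> = (\<integral>\<omega>. hit k \<omega> \<partial>digit_measure)"
      by (rule Bochner_Integration.integral_cong) (auto simp: hit_def space_digit indicator_def)
    finally show ?thesis by simp
  qed
  have hit_dep: "depends_on {(0 + int k) div int N..((int m - 1) + int k) div int N} (hit k)" for k
    unfolding hit_def using depends_on_compose[OF decode_window_depends, where g = "\<lambda>u. if u = v then 1 else 0"] .
  have hit_shift: "hit (k + j * N) \<omega> = hit k (digit_shift j \<omega>)" for k j \<omega>
    by (simp add: hit_def decode_add_mult)
  have Y_dep: "depends_on {0..<int D} (Y k)" if k: "k < N" for k
    unfolding depends_on_def
  proof (intro ballI impI)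
    fix \<omega> \<omega>' assume w: "\<omega> \<in> digit_seqs" "\<omega>' \<in> digit_seqs" "\<forall>j\<in>{0..<int D}. \<omega> j = \<omega>' j"
    have "hit (k + i) \<omega> = hit (k + i) \<omega>'" if i: "i < N" for i
    proof (rule depends_onD[OF hit_dep w(1,2)])
      fix j assume j: "j \<in> {(0 + int (k + i)) div int N..((int m - 1) + int (k + i)) div int N}"
      have "(int m - 1) + int (k + i) < int m * 1 + 2 * int N" using i k by simp
      also have "\<dots> \<le> int m * int N + 2 * int N" using N_pos by (intro add_right_mono mult_left_mono) auto
      finally have lt: "(int m - 1) + int (k + i) < int D * int N" by (simp add: D_def algebra_simps)
      have "j < int D"
      proof (rule ccontr)
        assume "\<not> j < int D"
        then have "int D * int N \<le> j * int N" by (intro mult_right_mono) auto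
        also have "\<dots> \<le> ((int m - 1) + int (k + i)) div int N * int N" using j by (intro mult_right_mono) auto
        also have "\<dots> \<le> (int m - 1) + int (k + i)"
          using N_pos pos_mod_sign[of "int N" "(int m - 1) + int (k + i)"]
            div_mult_mod_eq[of "(int m - 1) + int (k + i)" "int N"] by linarith
        finally show False using lt by simp
      qed
      moreover have "0 \<le> (0 + int (k + i)) div int N" using N_pos by (intro pos_imp_zdiv_nonneg_iff[THEN iffD2]) auto
      ultimately show "\<omega> j = \<omega>' j" using j w(3) by simp
    qed
    then show "Y k \<omega> = Y k \<omega>'" by (simp add: Y_def)
  qed
  have Y_bound: "\<bar>Y k \<omega>\<bar> \<le> real N" for k \<omega>
  proof -
    have "0 \<le> (\<Sum>i<N. hit (k + i) \<omega>)" by (intro sum_nonneg) (simp add: hit_def)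
    moreover have "(\<Sum>i<N. hit (k + i) \<omega>) \<le> (\<Sum>i<N. 1)" by (intro sum_mono) (simp add: hit_def)
    moreover have "0 \<le> real N * p" "real N * p \<le> real N" using p01 by (auto intro: mult_left_le)
    ultimately show ?thesis unfolding Y_def by (simp add: abs_le_iff)
  qed
  have Y_mean: "(\<integral>\<omega>. Y k \<omega> \<partial>digit_measure) = 0" for k
  proof -
    have hi: "integrable digit_measure (hit k)" for k by (rule integrable_depends_on[OF _ hit_dep]) simp
    have "(\<integral>\<omega>. Y k \<omega> \<partial>digit_measure) = (\<Sum>i<N. ?g (k + i)) - real N * p"
      unfolding Y_def using hi
      by (simp add: Bochner_Integration.integral_diff Bochner_Integration.integral_sum hit_int digit.prob_space)
    also have "(\<Sum>i<N. ?g (k + i)) = (\<Sum>i<N. ?g i)"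
    proof (rule sum_decode_period)
      fix k
      have "?g (k + N) = (\<integral>\<omega>. hit k (digit_shift 1 \<omega>) \<partial>digit_measure)"
        using hit_shift[of k 1] by (simp flip: hit_int)
      also have "\<dots> = ?g k" unfolding hit_int[symmetric]
        by (rule integral_digit_shift) (rule borel_measurable_integrable[OF hi])
      finally show "?g (k + N) = ?g k" .
    qed
    also have "\<dots> = real N * p" using N_pos by (simp add: p_def word_prob_eq)
    finally show ?thesis by simp
  qed
  have s: "s \<ge> 1" "2 * real D / (\<delta>\<^sup>2 * \<eta>) \<le> real s" unfolding s_def by linarith+
  define n where "n = s * N"
  have n: "n \<ge> 1" using s N_pos by (simp add: n_def)
  have avg: "word_avg v n (decode k \<omega>) - p = (\<Sum>j<s. Y k (digit_shift j \<omega>)) / real n" for k \<omega>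
  proof -
    have h: "(if window (decode k \<omega>) (int i) (int i + int (length v) - 1) = v then 1 else 0) = hit (k + i) \<omega>" for i
      using window_shift_decode[of k \<omega> i "int m - 1"] by (simp add: hit_def m_def add_diff_eq)
    have "(\<Sum>i<n. hit (k + i) \<omega>) = (\<Sum>j<s. \<Sum>i\<in>{j * N..<j * N + N}. hit (k + i) \<omega>)"
      unfolding n_def by (rule sum.nat_group[symmetric])
    also have "\<dots> = (\<Sum>j<s. \<Sum>i<N. hit (k + i) (digit_shift j \<omega>))"
    proof (rule sum.cong[OF refl])
      fix j
      have "(\<Sum>i\<in>{j * N..<j * N + N}. hit (k + i) \<omega>) = (\<Sum>i\<in>{0..<N}. hit (k + (i + j * N)) \<omega>)"
        using sum.shift_bounds_nat_ivl[of "\<lambda>i. hit (k + i) \<omega>" 0 "j * N" N] by (simp add: add.commute)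
      also have "\<dots> = (\<Sum>i<N. hit (k + i) (digit_shift j \<omega>))"
        by (simp add: add.assoc[symmetric] hit_shift atLeast0LessThan)
      finally show "(\<Sum>i\<in>{j * N..<j * N + N}. hit (k + i) \<omega>) = (\<Sum>i<N. hit (k + i) (digit_shift j \<omega>))" .
    qed
    also have "\<dots> = (\<Sum>j<s. Y k (digit_shift j \<omega>)) + real n * p"
      by (simp add: Y_def sum_subtractf n_def)
    finally show ?thesis unfolding word_avg_def h using n by (simp add: field_simps)
  qed
  let ?A = "{x \<in> code_shift. \<bar>word_avg v n x - p\<bar> > \<delta>}"
  have A: "?A \<in> sets code_measure"
  proof -
    have "integrable code_measure (\<lambda>x. if window x a b = v then 1 else 0 :: real)" for a b
      by (rule code.integrable_simple[OF code.simple_window])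
    then have "(\<lambda>x. word_avg v n x) \<in> borel_measurable code_measure"
      unfolding word_avg_def by (intro borel_measurable_divide borel_measurable_sum borel_measurable_const) auto
    then have "{x \<in> space code_measure. \<bar>word_avg v n x - p\<bar> > \<delta>} \<in> sets code_measure" by measurable
    then show ?thesis by (simp add: code.space_M)
  qed
  have "measure digit_measure {\<omega> \<in> digit_seqs. decode k \<omega> \<in> ?A} \<le> \<eta>" if k: "k < N" for k
  proof -
    have "{\<omega> \<in> digit_seqs. decode k \<omega> \<in> ?A} = {\<omega> \<in> digit_seqs. \<bar>\<Sum>j<s. Y k (digit_shift j \<omega>)\<bar> > \<delta> * real n}"
      using n by (auto simp: decode_in_code_shift avg pos_less_divide_eq)
    also have "measure digit_measure \<dots> \<le> 2 * real D * (real N)\<^sup>2 * real s / (\<delta> * real n)\<^sup>2"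
      by (rule chebyshev[OF Y_dep[OF k] Y_bound Y_mean]) (use \<delta> n in simp)
    also have "\<dots> = 2 * real D / (\<delta>\<^sup>2 * real s)"
      using N_pos s(1) by (simp add: n_def power2_eq_square field_simps)
    also have "\<dots> \<le> \<eta>"
      using s \<delta> \<eta> by (simp add: field_simps)
    finally show ?thesis .
  qed
  then have "(\<Sum>k<N. measure digit_measure {\<omega> \<in> digit_seqs. decode k \<omega> \<in> ?A}) \<le> (\<Sum>k<N. \<eta>)"
    by (intro sum_mono) auto
  then have "measure code_measure ?A \<le> \<eta>"
    unfolding measure_code[OF A[unfolded sets_code_measure]] using N_pos by (simp add: pos_divide_le_eq mult.commute)
  then show ?thesis using n unfolding p_def m_def by blast
qed

lemma gibbs_code:
  "gibbs_measure code_measure code_shift (ln (real l) / real N) (exp (- 2 * ln (real l)) / real N) (exp (2 * ln (real l)))"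
proof
  show "is_subshift code_shift" by (rule code_shift_subshift)
  show "exp (- 2 * ln (real l)) / real N > 0" using N_pos by simp
  show "exp (2 * ln (real l)) > 0" by simp
  show "exp (- 2 * ln (real l)) / real N * exp (- (ln (real l) / real N) * real n) \<le> word_prob n (window x 0 (int n - 1))"
    if "n \<ge> 1" "x \<in> code_shift" for n x
  proof -
    have "window x 0 (int n - 1) \<in> code_words" using that by (auto simp: code_shift_def)
    from word_prob_lower[OF this] show ?thesis by simp
  qed
  show "word_prob n v \<le> exp (2 * ln (real l)) * exp (- (ln (real l) / real N) * real n)" if "n \<ge> 1" for n v
    by (rule word_prob_upper[OF that])
  show "\<exists>n\<ge>1. measure code_measure {x \<in> code_shift. \<delta> < \<bar>word_avg v n x - word_prob (length v) v\<bar>} \<le> \<eta>"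
    if "1 \<le> length v" "0 < \<delta>" "0 < \<eta>" for v \<delta> \<eta>
    using code_weak_lln[OF that] .
qed

end

section \<open>The frequency measure\<close>

text \<open>The matrix has rank one and sends \<open>R\<close> to the sum of \<open>R\<close> times
  \<open>a\<close>. Summing the eigenvalue equation over \<open>S\<close> shows that an eigenvalue
  is \<open>s\<close> or, if the entries of the eigenvector add up to 0, equal to 0. For a
  normalised eigenvector the same summation forces the eigenvalue \<open>s\<close>, which gives the
  uniqueness that \<open>THE\<close> requires.\<close>

lemma PF_eigenvector_equal_columns:
  fixes a :: "'i \<Rightarrow> real"
  assumes S: "finite S" and a: "\<And>i. i \<in> S \<Longrightarrow> a i > 0" and s: "(\<Sum>i\<in>S. a i) = s" "s > 0"
    and M: "\<And>i j. i \<in> S \<Longrightarrow> j \<in> S \<Longrightarrow> M i j = a i"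
  shows "PF_eigenvector S M = (\<lambda>i. if i \<in> S then a i / s else 0)"
proof -
  have S_ne: "S \<noteq> {}" using s by auto
  have MR: "(\<Sum>j\<in>S. M i j * R j) = a i * (\<Sum>j\<in>S. R j)" if "i \<in> S" for i and R :: "'i \<Rightarrow> real"
    using M[OF that] by (simp add: sum_distrib_left)
  have PF: "is_PF_eigenvalue S M s"
    unfolding is_PF_eigenvalue_def
  proof (intro conjI allI impI)
    show "is_eigenvalue_on S M (complex_of_real s)"
      unfolding is_eigenvalue_on_def
    proof (intro exI[of _ "\<lambda>i. complex_of_real (a i)"] conjI ballI)
      show "\<exists>i\<in>S. complex_of_real (a i) \<noteq> 0" using S_ne a by fastforce
      fix i assume i: "i \<in> S"
      have "(\<Sum>j\<in>S. complex_of_real (M i j) * complex_of_real (a j)) = complex_of_real (\<Sum>j\<in>S. M i j * a j)" by simp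
      also have "\<dots> = complex_of_real s * complex_of_real (a i)" unfolding MR[OF i] s(1) by simp
      finally show "(\<Sum>j\<in>S. complex_of_real (M i j) * complex_of_real (a j)) = complex_of_real s * complex_of_real (a i)" .
    qed
    fix z assume "is_eigenvalue_on S M z"
    then obtain x where x: "\<exists>i\<in>S. x i \<noteq> 0" "\<And>i. i \<in> S \<Longrightarrow> (\<Sum>j\<in>S. complex_of_real (M i j) * x j) = z * x i"
      unfolding is_eigenvalue_on_def by blast
    have e: "complex_of_real (a i) * (\<Sum>j\<in>S. x j) = z * x i" if "i \<in> S" for i
      using x(2)[OF that] M[OF that] by (simp add: sum_distrib_left)
    have "(\<Sum>i\<in>S. complex_of_real (a i) * (\<Sum>j\<in>S. x j)) = (\<Sum>i\<in>S. z * x i)" using e by (rule sum.cong[OF refl])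
    then have sz: "complex_of_real s * (\<Sum>j\<in>S. x j) = z * (\<Sum>j\<in>S. x j)"
      by (simp add: s(1)[symmetric] flip: sum_distrib_left sum_distrib_right)
    show "cmod z \<le> s"
    proof (cases "(\<Sum>j\<in>S. x j) = 0")
      case True
      then have "z = 0" using e x(1) by auto
      then show ?thesis using s by simp
    next
      case False
      then have "z = complex_of_real s" using sz by simp
      then show ?thesis using s by simp
    qed
  qed
  show ?thesis
    unfolding PF_eigenvector_def
  proof (rule the_equality)
    let ?R = "\<lambda>i. if i \<in> S then a i / s else 0"
    have sumR: "(\<Sum>i\<in>S. ?R i) = 1" using s by (simp flip: sum_divide_distrib)
    show "(\<forall>i. i \<notin> S \<longrightarrow> ?R i = 0) \<and> (\<forall>i\<in>S. 0 < ?R i) \<and> (\<Sum>i\<in>S. ?R i) = 1 \<and>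
        (\<exists>r. is_PF_eigenvalue S M r \<and> (\<forall>i\<in>S. (\<Sum>j\<in>S. M i j * ?R j) = r * ?R i))"
      using a s sumR PF by (intro conjI exI[of _ s]) (auto simp only: MR, auto)
  next
    fix R assume R: "(\<forall>i. i \<notin> S \<longrightarrow> R i = 0) \<and> (\<forall>i\<in>S. 0 < R i) \<and> (\<Sum>i\<in>S. R i) = 1 \<and>
        (\<exists>r. is_PF_eigenvalue S M r \<and> (\<forall>i\<in>S. (\<Sum>j\<in>S. M i j * R j) = r * R i))"
    then obtain r where r: "\<And>i. i \<in> S \<Longrightarrow> (\<Sum>j\<in>S. M i j * R j) = r * R i" by blast
    have e: "a i = r * R i" if "i \<in> S" for i using r[OF that] R by (simp add: MR[OF that])
    have "s = r * (\<Sum>i\<in>S. R i)" unfolding s(1)[symmetric] sum_distrib_left using e by (rule sum.cong[OF refl])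
    then have "s = r" using R by simp
    then show "R = (\<lambda>i. if i \<in> S then a i / s else 0)" using e R s(2) by auto
  qed
qed

lemma count_list_map_upt: "count_list (map g [0..<N]) u = (\<Sum>k<N. if g k = u then 1 else 0)"
  by (induction N) auto

lemma uniform_common_subst:
  assumes "l \<ge> 1"
  shows "positive_prob_vector l (\<lambda>j. 1 / real l)"
    and "common_subst l w (\<lambda>j. 1 / real l) a = map_pmf w (pmf_of_set {1..l})"
proof -
  show pv: "positive_prob_vector l (\<lambda>j. 1 / real l)" using assms by (simp add: positive_prob_vector_def)
  have "embed_pmf (\<lambda>j. if j \<in> {1..l} then 1 / real l else 0) = pmf_of_set {1..l}"
  proof (rule pmf_eqI)
    fix j
    show "pmf (embed_pmf (\<lambda>j. if j \<in> {1..l} then 1 / real l else 0)) j = pmf (pmf_of_set {1..l}) j"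
      unfolding pmf_index[OF pv] using assms by (simp add: indicator_def)
  qed
  then show "common_subst l w (\<lambda>j. 1 / real l) a = map_pmf w (pmf_of_set {1..l})"
    by (simp add: common_subst_def)
qed

lemma pmf_replicate_uniform:
  assumes "l \<ge> 1" "set js \<subseteq> {1..l}"
  shows "pmf (replicate_pmf (length js) (pmf_of_set {1..l})) js = (1 / real l) ^ length js"
  using assms(2)
proof (induction js)
  case (Cons j js)
  let ?U = "pmf_of_set {1..l}"
  have "replicate_pmf (length (j # js)) ?U = map_pmf (\<lambda>(x, xs). x # xs) (pair_pmf ?U (replicate_pmf (length js) ?U))"
    by (simp add: pair_pmf_def map_pmf_def bind_assoc_pmf bind_return_pmf)
  moreover have "pmf (map_pmf (\<lambda>(x, xs). x # xs) (pair_pmf ?U (replicate_pmf (length js) ?U))) ((\<lambda>(x, xs). x # xs) (j, js))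
      = pmf (pair_pmf ?U (replicate_pmf (length js) ?U)) (j, js)"
    by (rule pmf_map_inj') (auto simp: inj_def)
  ultimately show ?case using Cons assms(1) by (simp add: pmf_pair)
qed simp

section \<open>Language, induced matrices and frequency measure of the substitution\<close>

context uniform_code
begin

text \<open>Only the supports of the \<open>\<theta> a\<close> enter, which is why the language does
  not depend on the probability vector.\<close>

lemma set_subst_kernel:
  assumes "\<And>a. set_pmf (\<theta> a) = w ` {1..l}"
  shows "set_pmf (subst_kernel \<theta> u) = {concat (map w js) | js. set js \<subseteq> {1..l} \<and> length js = length u}"
proof (induction u)
  case (Cons a u)
  show ?case
  proof (intro equalityI subsetI)
    fix v assume "v \<in> set_pmf (subst_kernel \<theta> (a # u))"
    then obtain j js where "j \<in> {1..l}" "set js \<subseteq> {1..l}" "length js = length u" "v = w j @ concat (map w js)"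
      using Cons assms by auto
    then show "v \<in> {concat (map w js) | js. set js \<subseteq> {1..l} \<and> length js = length (a # u)}"
      by (intro CollectI exI[of _ "j # js"]) auto
  next
    fix v assume "v \<in> {concat (map w js) | js. set js \<subseteq> {1..l} \<and> length js = length (a # u)}"
    then obtain j js where "j \<in> {1..l}" "set js \<subseteq> {1..l}" "length js = length u" "v = w j @ concat (map w js)"
      by (auto simp: length_Suc_conv)
    then have "concat (map w js) \<in> set_pmf (subst_kernel \<theta> u)" "w j \<in> set_pmf (\<theta> a)"
      unfolding Cons assms by auto
    then show "v \<in> set_pmf (subst_kernel \<theta> (a # u))" using \<open>v = _\<close> by auto
  qed
qed simp

text \<open>The last step forgets the letters of the previous word and keeps only its length, which
  is \<open>N ^ n\<close> with certainty.\<close>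

lemma set_subst_iter:
  assumes "\<And>a. set_pmf (\<theta> a) = w ` {1..l}"
  shows "set_pmf (subst_iter \<theta> (Suc n) [a]) = {concat (map w js) | js. set js \<subseteq> {1..l} \<and> length js = N ^ n}"
proof (induction n)
  case 0
  show ?case using set_subst_kernel[of \<theta> "[a]", OF assms] by (simp add: bind_return_pmf)
next
  case (Suc n)
  have len: "length (concat (map w js)) = length js * N" if "set js \<subseteq> {1..l}" for js
    using length_concat_uniform[of "map w js" N] that length_w by (simp add: subset_iff)
  have "set_pmf (subst_iter \<theta> (Suc (Suc n)) [a])
      = (\<Union>u\<in>{concat (map w js) | js. set js \<subseteq> {1..l} \<and> length js = N ^ n}. set_pmf (subst_kernel \<theta> u))"
    unfolding subst_iter.simps(2)[of \<theta> "Suc n"] set_bind_pmf Suc by simp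
  also have "\<dots> = (\<Union>js\<in>{js. set js \<subseteq> {1..l} \<and> length js = N ^ n}.
      {concat (map w js') | js'. set js' \<subseteq> {1..l} \<and> length js' = length js * N})"
    unfolding set_subst_kernel[OF assms] using len by fastforce
  also have "\<dots> = {concat (map w js) | js. set js \<subseteq> {1..l} \<and> length js = N ^ Suc n}"
  proof -
    \<comment> \<open>The sets in the union are all equal, so the union is that set provided the
      index set is not empty.\<close>
    have "replicate (N ^ n) 1 \<in> {js. set js \<subseteq> {1..l} \<and> length js = N ^ n}" using l_ge_1 by auto
    then have "{js. set js \<subseteq> {1..l} \<and> length js = N ^ n} \<noteq> {}" by blast
    then show ?thesis by (auto simp: mult.commute)
  qed
  finally show ?case .
qed

text \<open>The iterates produce only concatenations of \<open>N ^ n\<close> words. Since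
  \<open>N \<ge> 2\<close>, these numbers are unbounded, and an arbitrary concatenation is padded on
  the right to such a length.\<close>

lemma legal_words_code:
  assumes \<theta>: "\<And>a. set_pmf (\<theta> a) = w ` {1..l}" and N2: "N \<ge> 2"
  shows "legal_words \<theta> = code_words"
proof (intro equalityI subsetI)
  fix u assume "u \<in> legal_words \<theta>"
  then obtain v n a where u: "u \<noteq> []" "n \<ge> 1" "v \<in> set_pmf (subst_iter \<theta> n [a])" "sublist u v"
    by (auto simp: legal_words_def pmf_positive_iff)
  then obtain n' where "n = Suc n'" by (cases n) auto
  then obtain js where "v = concat (map w js)" "set js \<subseteq> {1..l}"
    using u(3) unfolding \<open>n = Suc n'\<close> set_subst_iter[of \<theta> n' a, OF \<theta>] by blast
  then show "u \<in> code_words" using u by (auto simp: code_words_def)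
next
  fix u assume "u \<in> code_words"
  then obtain js where u: "u \<noteq> []" "set js \<subseteq> {1..l}" "sublist u (concat (map w js))"
    by (auto simp: code_words_def)
  define n where "n = length js"
  have "n < 2 ^ n" by simp
  also have "(2::nat) ^ n \<le> N ^ n" using N2 by (rule power_mono) simp
  finally have n: "n \<le> N ^ n" by simp
  define js' where "js' = js @ replicate (N ^ n - n) 1"
  have js': "set js' \<subseteq> {1..l}" "length js' = N ^ n" using u(2) n l_ge_1 by (auto simp: js'_def n_def)
  \<comment> \<open>The starting letter is arbitrary, as all letters have the same images.\<close>
  have "concat (map w js') \<in> set_pmf (subst_iter \<theta> (Suc n) [undefined])"
    unfolding set_subst_iter[OF \<theta>] using js' by blast
  then have "pmf (subst_iter \<theta> (Suc n) [undefined]) (concat (map w js')) > 0" by (rule pmf_positive)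
  moreover have "sublist u (concat (map w js'))"
    using u(3) unfolding js'_def by (simp add: sublist_append)
  ultimately show "u \<in> legal_words \<theta>" unfolding legal_words_def using u(1) by (metis (mono_tags, lifting) mem_Collect_eq le_add1 plus_1_eq_Suc)
qed

lemma subst_subshift_code:
  assumes "\<And>a. set_pmf (\<theta> a) = w ` {1..l}" "N \<ge> 2"
  shows "subst_subshift \<theta> = code_shift"
  unfolding subst_subshift_def code_shift_def legal_words_code[OF assms] ..

lemma subst_kernel_uniform:
  assumes "\<And>a. \<theta> a = map_pmf w (pmf_of_set {1..l})"
  shows "subst_kernel \<theta> u = map_pmf (\<lambda>js. concat (map w js)) (replicate_pmf (length u) (pmf_of_set {1..l}))"
  by (induction u) (simp_all add: assms map_pmf_def bind_assoc_pmf bind_return_pmf)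

text \<open>All images have length \<open>N\<close>, so the number of windows does not depend on the
  word drawn for the first letter, and the two separate draws merge into one list of independent
  digits.\<close>

lemma induced_subst_uniform:
  assumes \<theta>: "\<And>a. \<theta> a = map_pmf w (pmf_of_set {1..l})" and v: "v \<noteq> []"
  shows "induced_subst \<theta> n v = map_pmf (\<lambda>js. map (\<lambda>k. take n (drop k (concat (map w js)))) [0..<N])
    (replicate_pmf (length v) (pmf_of_set {1..l}))"
proof -
  obtain a v' where v': "v = a # v'" using v by (cases v) auto
  have "induced_subst \<theta> n v = bind_pmf (pmf_of_set {1..l}) (\<lambda>j. bind_pmf (replicate_pmf (length v') (pmf_of_set {1..l}))
      (\<lambda>js. return_pmf (map (\<lambda>k. take n (drop k (w j @ concat (map w js)))) [0..<length (w j)])))"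
    by (simp add: induced_subst_def v' subst_kernel_uniform[OF \<theta>] \<theta> bind_map_pmf)
  also have "\<dots> = bind_pmf (pmf_of_set {1..l}) (\<lambda>j. bind_pmf (replicate_pmf (length v') (pmf_of_set {1..l}))
      (\<lambda>js. return_pmf (map (\<lambda>k. take n (drop k (w j @ concat (map w js)))) [0..<N])))"
    by (rule bind_pmf_cong[OF refl]) (use l_ge_1 length_w in simp)
  also have "\<dots> = map_pmf (\<lambda>js. map (\<lambda>k. take n (drop k (concat (map w js)))) [0..<N])
    (replicate_pmf (length v) (pmf_of_set {1..l}))"
    by (simp add: v' map_pmf_def bind_assoc_pmf bind_return_pmf)
  finally show ?thesis .
qed

lemma expectation_replicate_digits:
  fixes f :: "nat list \<Rightarrow> real"
  shows "(\<integral>js. f js \<partial>measure_pmf (replicate_pmf n (pmf_of_set {1..l})))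
    = (\<integral>\<omega>. f (map (\<lambda>j. \<omega> (int j)) [0..<n]) \<partial>digit_measure)"
proof -
  let ?A = "{js. set js \<subseteq> {1..l} \<and> length js = n}"
  let ?d = "\<lambda>\<omega>::int \<Rightarrow> nat. map (\<lambda>j. \<omega> (int j)) [0..<n]"
  have fin: "finite ?A" by (rule finite_lists_length_eq) simp
  have "(\<integral>js. f js \<partial>measure_pmf (replicate_pmf n (pmf_of_set {1..l})))
      = (\<Sum>js\<in>?A. f js * pmf (replicate_pmf n (pmf_of_set {1..l})) js)"
    by (rule integral_measure_pmf_real[OF fin]) (use l_ge_1 in \<open>auto simp: set_replicate_pmf\<close>)
  also have "\<dots> = (\<Sum>js\<in>?A. fibre_prob digit_measure ?d js * f js)"
  proof (rule sum.cong[OF refl])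
    fix js assume js: "js \<in> ?A"
    have "?d -` {js} \<inter> space digit_measure = {\<omega> \<in> digit_seqs. \<forall>j\<in>{0..<int n}. \<omega> j = js ! nat j}"
    proof -
      have "?d \<omega> = js \<longleftrightarrow> (\<forall>j\<in>{0..<int n}. \<omega> j = js ! nat j)" for \<omega>
      proof
        assume "?d \<omega> = js"
        then have *: "\<omega> (int i) = js ! i" if "i < n" for i using that by (auto simp: list_eq_iff_nth_eq)
        show "\<forall>j\<in>{0..<int n}. \<omega> j = js ! nat j"
        proof
          fix j assume "j \<in> {0..<int n}"
          then show "\<omega> j = js ! nat j" using *[of "nat j"] by auto
        qed
      next
        assume "\<forall>j\<in>{0..<int n}. \<omega> j = js ! nat j"
        then show "?d \<omega> = js" using js by (auto simp: list_eq_iff_nth_eq)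
      qed
      then show ?thesis by (auto simp: space_digit)
    qed
    moreover have "measure digit_measure {\<omega> \<in> digit_seqs. \<forall>j\<in>{0..<int n}. \<omega> j = js ! nat j} = (1 / real l) ^ card {0..<int n}"
    proof (rule digit_cylinder(2))
      fix j assume "j \<in> {0..<int n}"
      then have "js ! nat j \<in> set js" using js by (intro nth_mem) auto
      then show "js ! nat j \<in> {1..l}" using js by blast
    qed simp
    ultimately show "f js * pmf (replicate_pmf n (pmf_of_set {1..l})) js = fibre_prob digit_measure ?d js * f js"
      using js pmf_replicate_uniform[OF l_ge_1, of js] by (simp add: fibre_prob_def)
  qed
  also have "\<dots> = (\<integral>\<omega>. f (?d \<omega>) \<partial>digit_measure)"
  proof (rule digit.integral_simple[symmetric, OF _ fin])
    show "simple_function digit_measure ?d"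
    proof (rule simple_depends_on[of "{0..<int n}"])
      show "depends_on {0..<int n} ?d" unfolding depends_on_def by auto
    qed simp
    show "?d ` space digit_measure \<subseteq> ?A" by (auto simp: space_digit digit_seqs_def)
  qed
  finally show ?thesis .
qed

text \<open>The window at offset \<open>k\<close> in the image of \<open>v\<close> is the initial
  window of a random concatenation in phase \<open>k\<close>. Counting occurrences over all offsets
  therefore sums over all phases, whatever the letters of \<open>v\<close> are.\<close>

lemma induced_matrix_uniform:
  assumes \<theta>: "\<And>a. \<theta> a = map_pmf w (pmf_of_set {1..l})" and v: "length v = n" "n \<ge> 1"
  shows "induced_matrix \<theta> n u v = real N * word_prob n u"
proof -
  let ?blk = "\<lambda>k js. take n (drop k (concat (map w js)))"
  let ?d = "\<lambda>\<omega>::int \<Rightarrow> nat. map (\<lambda>j. \<omega> (int j)) [0..<n]"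
  have "v \<noteq> []" using v by auto
  then have "induced_matrix \<theta> n u v
      = (\<integral>js. (\<Sum>k<N. if ?blk k js = u then 1 else 0) \<partial>measure_pmf (replicate_pmf n (pmf_of_set {1..l})))"
    unfolding induced_matrix_def induced_subst_uniform[OF \<theta> \<open>v \<noteq> []\<close>] integral_map_pmf count_list_map_upt v(1)
    by (simp add: of_nat_sum if_distrib cong: if_cong)
  also have "\<dots> = (\<integral>\<omega>. (\<Sum>k<N. if ?blk k (?d \<omega>) = u then 1 else 0) \<partial>digit_measure)"
    by (rule expectation_replicate_digits)
  also have "\<dots> = (\<integral>\<omega>. (\<Sum>k<N. indicator {\<omega> \<in> digit_seqs. window (decode k \<omega>) 0 (int n - 1) = u} \<omega>) \<partial>digit_measure)"
  proof (rule Bochner_Integration.integral_cong[OF refl], rule sum.cong[OF refl])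
    fix \<omega> k assume \<omega>: "\<omega> \<in> space digit_measure" and k: "k \<in> {..<N}"
    \<comment> \<open>The image of \<open>n\<close> letters is long enough for every offset:
      \<open>k + n \<le> (N - 1) + n \<le> n * N\<close>.\<close>
    have "(n - 1) * 1 \<le> (n - 1) * N" using N_pos by (intro mult_left_mono) auto
    moreover have "n * N = (n - 1) * N + N" using v(2) by (cases n) auto
    moreover have "k < N" using k by simp
    ultimately have bd: "k + n \<le> n * N" using v(2) by linarith
    have "window (decode k \<omega>) 0 (int n - 1) = ?blk k (?d \<omega>)"
      by (rule window_decode_concat) (use \<omega> bd in \<open>auto simp: space_digit digit_seqs_def\<close>)
    then show "(if ?blk k (?d \<omega>) = u then 1 else 0) = (indicator {\<omega> \<in> digit_seqs. window (decode k \<omega>) 0 (int n - 1) = u} \<omega> :: real)"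
      using \<omega> by (simp add: space_digit)
  qed
  also have "\<dots> = (\<Sum>k<N. measure digit_measure {\<omega> \<in> digit_seqs. window (decode k \<omega>) 0 (int n - 1) = u})"
  proof -
    have A: "{\<omega> \<in> digit_seqs. window (decode k \<omega>) 0 (int n - 1) = u} \<in> sets digit_measure" for k
      by (rule depends_on_sets[OF _ depends_on_compose[OF decode_window_depends, where g = "\<lambda>v. v = u"]]) simp
    then have "integrable digit_measure (\<lambda>\<omega>. indicator {\<omega> \<in> digit_seqs. window (decode k \<omega>) 0 (int n - 1) = u} \<omega> :: real)" for k
      by (intro integrable_real_indicator) (auto simp: digit.emeasure_eq_measure)
    then show ?thesis using A sets.sets_into_space[OF A]
      by (simp add: Bochner_Integration.integral_sum Int_absorb2)
  qed
  also have "\<dots> = real N * word_prob n u" using N_pos by (simp add: word_prob_eq)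
  finally show ?thesis .
qed

text \<open>The common column is \<open>N\<close> times the word probabilities of the block measure
  and sums to \<open>N\<close>, so normalisation removes exactly this factor.\<close>

lemma freq_vector_uniform:
  assumes \<theta>: "\<And>a. \<theta> a = map_pmf w (pmf_of_set {1..l})" and N2: "N \<ge> 2" and n: "n \<ge> 1"
    and u: "u \<in> legal_words_of_length \<theta> n"
  shows "freq_vector \<theta> n u = word_prob n u"
proof -
  have set_\<theta>: "set_pmf (\<theta> a) = w ` {1..l}" for a using l_ge_1 by (simp add: \<theta>)
  let ?S = "legal_words_of_length \<theta> n"
  have S: "?S = {u \<in> code_words. length u = n}"
    by (simp add: legal_words_of_length_def legal_words_code[OF set_\<theta> N2])
  have "?S \<subseteq> {u. set u \<subseteq> UNIV \<and> length u = n}" by (auto simp: S)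
  then have fin: "finite ?S" by (rule finite_subset) (rule finite_lists_length_eq, simp)
  have pos: "real N * word_prob n i > 0" if "i \<in> ?S" for i
  proof -
    have i: "i \<in> code_words" "length i = n" using that by (auto simp: S)
    have "0 < exp (- 2 * ln (real l)) / real N * exp (- (ln (real l) / real N) * real n)" using N_pos by simp
    also have "\<dots> \<le> word_prob n i" using word_prob_lower[OF i(1)] i(2) by simp
    finally show ?thesis using N_pos by simp
  qed
  have "(\<Sum>i\<in>?S. word_prob n i) = 1"
  proof (rule code.sum_fibre_prob[OF code.simple_window fin])
    show "(\<lambda>x. window x 0 (int n - 1)) ` space code_measure \<subseteq> ?S"
      using n by (auto simp: S code.space_M code_shift_def)
  qed
  then have sum: "(\<Sum>i\<in>?S. real N * word_prob n i) = real N" by (simp flip: sum_distrib_left)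
  have M: "induced_matrix \<theta> n i j = real N * word_prob n i" if "j \<in> ?S" for i j
    using that by (intro induced_matrix_uniform[OF \<theta> _ n]) (simp add: S)
  show ?thesis
    unfolding freq_vector_def
    using PF_eigenvector_equal_columns[of ?S "\<lambda>i. real N * word_prob n i" "real N" "induced_matrix \<theta> n", OF fin pos sum _ M]
      u N_pos by simp
qed

text \<open>The prescribed cylinders are those whose window contains the origin. Among them are all
  symmetric windows, which already determine a measure; this settles the uniqueness behind
  \<open>THE\<close>.\<close>

lemma frequency_measure_uniform:
  assumes \<theta>: "\<And>a. \<theta> a = map_pmf w (pmf_of_set {1..l})" and N2: "N \<ge> 2"
  shows "frequency_measure \<theta> = code_measure"
proof -
  have set_\<theta>: "set_pmf (\<theta> a) = w ` {1..l}" for a using l_ge_1 by (simp add: \<theta>)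
  have X: "subst_subshift \<theta> = code_shift" by (rule subst_subshift_code[OF set_\<theta> N2])
  have cyl: "measure code_measure (cylinder \<theta> k m v) = freq_vector \<theta> (nat (m - k + 1)) v"
    if km: "k \<le> 0" "0 \<le> m" and v: "v \<in> legal_words_of_length \<theta> (nat (m - k + 1))" for k m v
  proof -
    let ?n = "nat (m - k + 1)"
    have "cylinder \<theta> k m v = (\<lambda>x. window x k (k + (int ?n - 1))) -` {v} \<inter> space code_measure"
      using km by (auto simp: cylinder_def X code.space_M)
    then have "measure code_measure (cylinder \<theta> k m v) = fibre_prob code_measure (\<lambda>x. window x k (k + (int ?n - 1))) v"
      by (simp add: fibre_prob_def)
    also have "\<dots> = word_prob ?n v" by (rule code.fibre_prob_window)
    also have "\<dots> = freq_vector \<theta> ?n v" using freq_vector_uniform[OF \<theta> N2 _ v] km by simp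
    finally show ?thesis .
  qed
  show ?thesis
    unfolding frequency_measure_def
  proof (rule the_equality)
    show "is_frequency_measure \<theta> code_measure"
      unfolding is_frequency_measure_def X using sets_code_measure prob_space_code cyl by blast
  next
    fix \<nu> assume nu: "is_frequency_measure \<theta> \<nu>"
    then have \<nu>: "sets \<nu> = sets (shift_borel code_shift)" "prob_space \<nu>"
      and \<nu>_cyl: "\<And>k m v. k \<le> 0 \<Longrightarrow> 0 \<le> m \<Longrightarrow> v \<in> legal_words_of_length \<theta> (nat (m - k + 1)) \<Longrightarrow>
        measure \<nu> (cylinder \<theta> k m v) = freq_vector \<theta> (nat (m - k + 1)) v"
      unfolding is_frequency_measure_def X by auto
    interpret \<nu>: prob_space \<nu> by fact
    show "\<nu> = code_measure"
    proof (rule shift_borel_measure_eqI[OF \<nu>(1) sets_code_measure \<nu>.finite_measure_axioms])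
      fix A assume "A \<in> cylinder_algebra code_shift"
      then obtain m S where A: "A = code_shift \<inter> {x. window x (- int m) (int m) \<in> S}"
        by (auto simp: cylinder_algebra_def)
      let ?n = "nat (int m - (- int m) + 1)"
      let ?V = "{v \<in> legal_words_of_length \<theta> ?n. v \<in> S}"
      let ?C = "\<lambda>v. cylinder \<theta> (- int m) (int m) v"
      have "?V \<subseteq> {v. set v \<subseteq> UNIV \<and> length v = ?n}" by (auto simp: legal_words_of_length_def)
      then have finV: "finite ?V" by (rule finite_subset) (rule finite_lists_length_eq, simp)
      have AV: "A = (\<Union>v\<in>?V. ?C v)"
      proof (intro equalityI subsetI)
        fix x assume x: "x \<in> A"
        then have "window x (- int m) (int m) \<in> legal_words_of_length \<theta> ?n"
          by (auto simp: A legal_words_of_length_def code_shift_def legal_words_code[OF set_\<theta> N2])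
        then show "x \<in> (\<Union>v\<in>?V. ?C v)" using x by (auto simp: A cylinder_def X)
      qed (auto simp: A cylinder_def X)
      have Cs: "?C v \<in> sets (shift_borel code_shift)" for v
      proof -
        have "?C v = code_shift \<inter> {x. window x (- int m) (int m) \<in> {v}}" by (auto simp: cylinder_def X)
        then show ?thesis using window_in_shift_borel[of code_shift "- int m" "int m" "{v}"] by simp
      qed
      have disj: "disjoint_family_on ?C ?V" by (auto simp: disjoint_family_on_def cylinder_def)
      have "measure \<nu> A = (\<Sum>v\<in>?V. measure \<nu> (?C v))"
        unfolding AV by (rule \<nu>.finite_measure_finite_Union[OF finV _ disj]) (use Cs \<nu>(1) in auto)
      also have "\<dots> = (\<Sum>v\<in>?V. measure code_measure (?C v))"
        by (rule sum.cong[OF refl]) (subst \<nu>_cyl, auto simp: cyl)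
      also have "\<dots> = measure code_measure A"
        unfolding AV by (rule code.finite_measure_finite_Union[OF finV _ disj, symmetric]) (use Cs sets_code_measure in auto)
      finally show "emeasure \<nu> A = emeasure code_measure A"
        by (simp add: \<nu>.emeasure_eq_measure code.emeasure_eq_measure)
    qed
  qed
qed

end

theorem proposition6p9:
  fixes l N :: nat and w :: "nat \<Rightarrow> 'a::finite list" and p :: "nat \<Rightarrow> real"
  assumes "l \<ge> 1" and "N \<ge> 1"
    and distinct: "inj_on w {1..l}"
    and len: "\<forall>j\<in>{1..l}. length (w j) = N"
    and abel: "\<forall>j1\<in>{1..l}. \<forall>j2\<in>{1..l}. \<forall>a. count_list (w j1) a = count_list (w j2) a"
    and p: "positive_prob_vector l p"
    and prim: "primitive_subst (common_subst l w p)"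
    and expd: "expanding_subst (common_subst l w p)"
    and legal: "\<forall>j\<in>{1..l}. w j \<in> legal_words (common_subst l w p)"
  shows "(\<forall>q. positive_prob_vector l q \<longrightarrow>
            subst_subshift (common_subst l w q) = subst_subshift (common_subst l w p))
    \<and> intrinsically_ergodic (subst_subshift (common_subst l w p))
    \<and> measure_of_maximal_entropy (subst_subshift (common_subst l w p))
        (frequency_measure (common_subst l w (\<lambda>j. 1 / real l)))"
proof -
  interpret uniform_code l N w
    by unfold_locales (use assms in auto)
  \<comment> \<open>Expansion provides an image with more than one letter; since all images have
    length \<open>N\<close>, it follows that \<open>N \<ge> 2\<close>.\<close>
  obtain a where "measure_pmf.prob (common_subst l w p a) {v. length v > 1} > 0"
    using expd by (auto simp: expanding_subst_def)
  then have "set_pmf (common_subst l w p a) \<inter> {v. length v > 1} \<noteq> {}"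
    using measure_pmf_zero_iff[of "common_subst l w p a" "{v. length v > 1}"] by auto
  then obtain v where v: "v \<in> w ` {1..l}" "length v > 1" unfolding set_common_subst[OF p] by blast
  then have N2: "N \<ge> 2" using length_w by auto
  have X: "subst_subshift (common_subst l w q) = code_shift" if "positive_prob_vector l q" for q
    by (rule subst_subshift_code[OF set_common_subst[OF that] N2])
  have F: "frequency_measure (common_subst l w (\<lambda>j. 1 / real l)) = code_measure"
    by (rule frequency_measure_uniform[OF uniform_common_subst(2)[OF l_ge_1] N2])
  show ?thesis
    unfolding F X[OF p]
    by (intro conjI allI impI X gibbs_measure.intrinsically_ergodic[OF gibbs_code]
        gibbs_measure.maximal_entropy[OF gibbs_code])
qed

end
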